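(* Let $w$ be a majorant satisfying $$\int_0^1\frac{w^2(t)}{t}\,dt=+\infty .$$ Then for any number $0<\delta<1$, there exists a set $E_\delta\subset\partial\mathbb{D}$ of Lebesgue measure $\delta$ and a corresponding subset $\mathcal{U}_{w,\delta}$ of $\mathcal{B}_0(w)$, generic in the sense of Baire categories, such that every element $f\in\mathcal{U}_{w,\delta}$ gives rise to a universal Menshov-pair $(f,E_\delta)$ from $\mathcal{B}_0(w)$.
   Context: $\mathbb{D}$ is the open unit disc, $\partial\mathbb{D}$ the unit circle, $m$ normalized Lebesgue measure on $\partial\mathbb{D}$. A majorant is a continuous non-decreasing function $w$ on $[0,1]$, positive on $(0,1]$, for which there is $0<\alpha<1$ such that $w(t)/t^\alpha$ increases up to $\infty$ as $t\to0+$ (constants are allowed). $\mathcal{B}_0(w)$ is the Banach space of holomorphic $f$ in $\mathbb{D}$ with $\lim_{|z|\to1-}\frac{1-|z|}{w(1-|z|)}f'(z)=0$, with norm $\|f\|_{\mathcal{B}(w)}=|f(0)|+\sup_{z\in\mathbb{D}}\frac{1-|z|}{w(1-|z|)}|f'(z)|$. For $f(z)=\sum_{n\ge0}f_nz^n$ holomorphic in $\mathbb{D}$, $T_N(f)(z)=\sum_{n=0}^Nf_nz^n$. For a Banach space $X$ of holomorphic functions in $\mathbb{D}$, a pair $(f,E)$ with $f\in X$ and $E\subseteq\partial\mathbb{D}$ measurable is a universal Menshov-pair from $X$ if every Lebesgue measurable function $g$ on $E$ is the pointwise $dm$-a.e. limit on $E$ of some subsequence $\{T_{n_k}(f)\}_k$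 of the Taylor polynomials of $f$. A subset of $X$ is generic in the sense of Baire categories if it is dense in $X$ and is a countable intersection of open dense subsets of $X$. *)

theory Defs
  imports "HOL-Complex_Analysis.Complex_Analysis" "HOL-Probability.Probability"
begin

section \<open>Normalized Lebesgue measure on the unit circle\<close>

text \<open>The completion makes the measurable sets and functions the Lebesgue measurable ones.\<close>

definition circle_measure :: "complex measure" where
  "circle_measure =
     completion (distr (uniform_measure lborel {0..1}) (restrict_space borel (sphere 0 1))
                       (\<lambda>t. cis (2 * pi * t)))"

section \<open>Majorants and the little Bloch-type spaces\<close>

definition majorant :: "(real \<Rightarrow> real) \<Rightarrow> bool" where
  "majorant w \<longleftrightarrow>
     continuous_on {0..1} w \<and> mono_on {0..1} w \<and> (\<forall>t\<in>{0<..1}. 0 < w t) \<and>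
     (\<exists>\<alpha>. 0 < \<alpha> \<and> \<alpha> < 1 \<and>
        antimono_on {0<..1} (\<lambda>t. w t / t powr \<alpha>) \<and>
        filterlim (\<lambda>t. w t / t powr \<alpha>) at_top (at_right 0))"

text \<open>A holomorphic function on the disc is represented by its extension by zero, so that
  elements of the space correspond one-to-one to functions on the disc.
  The filter \<open>filtercomap norm (at_left 1)\<close> describes the limit as
  \<open>|z|\<close> tends to \<open>1\<close> from below.\<close>

definition Bloch0 :: "(real \<Rightarrow> real) \<Rightarrow> (complex \<Rightarrow> complex) set" where
  "Bloch0 w = {f. f holomorphic_on ball 0 1 \<and> (\<forall>z. z \<notin> ball 0 1 \<longrightarrow> f z = 0) \<and>
     ((\<lambda>z. of_real ((1 - norm z) / w (1 - norm z)) * deriv f z) \<longlongrightarrow> 0)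
       (filtercomap norm (at_left 1))}"

definition Bloch_norm :: "(real \<Rightarrow> real) \<Rightarrow> (complex \<Rightarrow> complex) \<Rightarrow> real" where
  "Bloch_norm w f =
     norm (f 0) + (SUP z\<in>ball 0 1. (1 - norm z) / w (1 - norm z) * norm (deriv f z))"

text \<open>The locale \<open>Metric_space\<close> requires nonnegativity and symmetry for all arguments, hence
  the value \<open>0\<close> outside the carrier.\<close>

definition Bloch_dist :: "(real \<Rightarrow> real) \<Rightarrow> (complex \<Rightarrow> complex) \<Rightarrow> (complex \<Rightarrow> complex) \<Rightarrow> real" where
  "Bloch_dist w f g =
     (if f \<in> Bloch0 w \<and> g \<in> Bloch0 w then Bloch_norm w (\<lambda>z. f z - g z) else 0)"

definition Bloch0_topology :: "(real \<Rightarrow> real) \<Rightarrow> (complex \<Rightarrow> complex) topology" where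
  "Bloch0_topology w = Metric_space.mtopology (Bloch0 w) (Bloch_dist w)"

section \<open>Baire genericity\<close>

definition Baire_generic :: "'a topology \<Rightarrow> 'a set \<Rightarrow> bool" where
  "Baire_generic X U \<longleftrightarrow>
     X closure_of U = topspace X \<and>
     (\<exists>G :: nat \<Rightarrow> 'a set.
        (\<forall>n. openin X (G n) \<and> X closure_of G n = topspace X) \<and> U = (\<Inter>n. G n))"

section \<open>Taylor polynomials and universal Menshov pairs\<close>

definition Taylor_poly :: "nat \<Rightarrow> (complex \<Rightarrow> complex) \<Rightarrow> complex \<Rightarrow> complex" where
  "Taylor_poly N f z = (\<Sum>n\<le>N. fps_nth (fps_expansion f 0) n * z ^ n)"

definition universal_Menshov_pair ::
    "(complex \<Rightarrow> complex) set \<Rightarrow> (complex \<Rightarrow> complex) \<Rightarrow> complex set \<Rightarrow> bool" where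
  "universal_Menshov_pair X f E \<longleftrightarrow>
     f \<in> X \<and> E \<in> sets circle_measure \<and>
     (\<forall>g :: complex \<Rightarrow> complex. g \<in> borel_measurable (restrict_space circle_measure E) \<longrightarrow>
        (\<exists>n :: nat \<Rightarrow> nat. strict_mono n \<and>
           (AE \<zeta> in restrict_space circle_measure E.
              (\<lambda>k. Taylor_poly (n k) f \<zeta>) \<longlonglongrightarrow> g \<zeta>)))"

section \<open>Well-definedness\<close>

lemma circle_param_measurable:
  "(\<lambda>t. cis (2 * pi * t)) \<in> measurable (uniform_measure lborel {0..1}) (restrict_space borel (sphere 0 1))"
proof -
  have "(\<lambda>t::real. cis (2 * pi * t)) \<in> borel_measurable borel"
    by (intro borel_measurable_continuous_onI continuous_intros)
  then show ?thesis
    by (auto simp: measurable_restrict_space2_iff)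
qed

lemma space_circle_measure: "space circle_measure = sphere 0 1"
  by (simp add: circle_measure_def space_restrict_space)

lemma prob_space_circle_measure: "prob_space circle_measure"
proof -
  have "prob_space (uniform_measure lborel {0..1::real})"
    by (rule prob_space_uniform_measure) auto
  then show ?thesis
    unfolding circle_measure_def
    using circle_param_measurable
    by (intro prob_space.prob_space_completion prob_space.prob_space_distr)
qed

lemma Bloch0_bdd:
  assumes w: "majorant w" and f: "f \<in> Bloch0 w"
  shows "bdd_above ((\<lambda>z. (1 - norm z) / w (1 - norm z) * norm (deriv f z)) ` ball 0 1)"
proof -
  define h where "h = (\<lambda>z::complex. (1 - norm z) / w (1 - norm z) * norm (deriv f z))"
  have wc: "continuous_on {0..1} w" and wp: "\<And>t. 0 < t \<Longrightarrow> t \<le> 1 \<Longrightarrow> 0 < w t"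
    using w by (auto simp: majorant_def)
  have hol: "f holomorphic_on ball 0 1" using f by (simp add: Bloch0_def)
  have "((\<lambda>z. of_real ((1 - norm z) / w (1 - norm z)) * deriv f z) \<longlongrightarrow> 0)
       (filtercomap norm (at_left 1))" using f by (simp add: Bloch0_def)
  then have "eventually (\<lambda>z. dist (of_real ((1 - norm z) / w (1 - norm z)) * deriv f z) 0 < 1)
       (filtercomap norm (at_left 1))"
    by (rule tendstoD) simp
  then obtain P where P: "eventually P (at_left (1::real))"
    and PQ: "\<And>z. P (norm z) \<Longrightarrow> norm (of_real ((1 - norm z) / w (1 - norm z)) * deriv f z) < 1"
    by (auto simp: eventually_filtercomap)
  from P obtain r0 where r0: "r0 < 1" "\<And>y. r0 < y \<Longrightarrow> y < 1 \<Longrightarrow> P y"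
    using eventually_at_left_field by blast
  have cont: "continuous_on (cball 0 r0) h"
    unfolding h_def
  proof (intro continuous_intros)
    show "continuous_on (cball 0 r0) (\<lambda>z::complex. w (1 - norm z))"
      by (rule continuous_on_compose2[OF wc]) (use r0 in \<open>auto intro!: continuous_intros\<close>)
    show "\<forall>z\<in>cball (0::complex) r0. w (1 - norm z) \<noteq> 0"
    proof
      fix z :: complex assume "z \<in> cball 0 r0"
      then show "w (1 - norm z) \<noteq> 0" using wp[of "1 - norm z"] r0 by simp
    qed
    have "continuous_on (ball 0 1) (deriv f)"
      using hol holomorphic_deriv holomorphic_on_imp_continuous_on by blast
    then show "continuous_on (cball 0 r0) (deriv f)"
      by (rule continuous_on_subset) (use r0 in auto)
  qed
  then have "bounded (h ` cball 0 r0)"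
    by (intro compact_imp_bounded compact_continuous_image) auto
  then obtain B where B: "\<And>z. z \<in> cball 0 r0 \<Longrightarrow> norm (h z) \<le> B"
    unfolding bounded_iff by blast
  have "h z \<le> max B 1" if z: "z \<in> ball 0 1" for z
  proof (cases "norm z \<le> r0")
    case True
    then show ?thesis using B[of z] by auto
  next
    case False
    then have "P (norm z)" using r0 z by auto
    moreover have "0 < w (1 - norm z)" using wp[of "1 - norm z"] z by simp
    ultimately have "h z < 1" using PQ[of z] z
      by (simp add: h_def norm_mult abs_mult abs_divide del: of_real_divide of_real_diff)
    then show ?thesis by simp
  qed
  then show ?thesis unfolding h_def by (intro bdd_aboveI2) auto
qed

lemma Bloch0_deriv_diff:
  assumes "f \<in> Bloch0 w" "g \<in> Bloch0 w" "z \<in> ball 0 1"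
  shows "deriv (\<lambda>z. f z - g z) z = deriv f z - deriv g z"
  using assms holomorphic_on_imp_differentiable_at[OF _ open_ball, of _ 0 1 z]
  by (intro deriv_diff) (auto simp: Bloch0_def)

lemma Bloch0_diff:
  assumes f: "f \<in> Bloch0 w" and g: "g \<in> Bloch0 w"
  shows "(\<lambda>z. f z - g z) \<in> Bloch0 w"
proof -
  let ?F = "filtercomap norm (at_left (1::real)) :: complex filter"
  have "eventually (\<lambda>y::real. y < 1) (at_left 1)"
    by (auto simp: eventually_at_filter)
  then have ev: "eventually (\<lambda>z. z \<in> ball (0::complex) 1) ?F"
    by (auto simp: eventually_filtercomap)
  have "((\<lambda>z. of_real ((1 - norm z) / w (1 - norm z)) * deriv f z
            - of_real ((1 - norm z) / w (1 - norm z)) * deriv g z) \<longlongrightarrow> 0 - 0) ?F"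
    using f g by (intro tendsto_diff) (simp_all add: Bloch0_def)
  moreover have "eventually (\<lambda>z. of_real ((1 - norm z) / w (1 - norm z)) * deriv f z
            - of_real ((1 - norm z) / w (1 - norm z)) * deriv g z
          = of_real ((1 - norm z) / w (1 - norm z)) * deriv (\<lambda>z. f z - g z) z) ?F"
    by (rule eventually_mono[OF ev]) (simp add: Bloch0_deriv_diff[OF f g] right_diff_distrib)
  ultimately have "((\<lambda>z. of_real ((1 - norm z) / w (1 - norm z)) * deriv (\<lambda>z. f z - g z) z) \<longlongrightarrow> 0) ?F"
    using Lim_transform_eventually by fastforce
  then show ?thesis
    using f g by (auto simp: Bloch0_def intro: holomorphic_on_diff)
qed

lemma Metric_space_Bloch0:
  assumes w: "majorant w"
  shows "Metric_space (Bloch0 w) (Bloch_dist w)"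
proof -
  define k where "k = (\<lambda>z::complex. (1 - norm z) / w (1 - norm z))"
  have kpos: "0 < k z" if "z \<in> ball 0 1" for z
    using w that by (auto simp: majorant_def k_def)
  define h where "h = (\<lambda>f g z. k z * norm (deriv (\<lambda>z. f z - g z) z))"
  have d: "Bloch_dist w f g = norm (f 0 - g 0) + (SUP z\<in>ball 0 1. h f g z)"
    if "f \<in> Bloch0 w" "g \<in> Bloch0 w" for f g
    using that by (simp add: Bloch_dist_def Bloch_norm_def h_def k_def)
  have h: "h f g z = k z * norm (deriv f z - deriv g z)"
    if "f \<in> Bloch0 w" "g \<in> Bloch0 w" "z \<in> ball 0 1" for f g z
    using Bloch0_deriv_diff[OF that] by (simp add: h_def)
  have bdd: "bdd_above (h f g ` ball 0 1)" if "f \<in> Bloch0 w" "g \<in> Bloch0 w" for f g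
    using Bloch0_bdd[OF w Bloch0_diff[OF that]] by (simp add: h_def k_def)
  have up: "h f g z \<le> (SUP z\<in>ball 0 1. h f g z)"
    if "f \<in> Bloch0 w" "g \<in> Bloch0 w" "z \<in> ball 0 1" for f g z
    using bdd that by (intro cSUP_upper) auto
  have h0: "0 \<le> h f g z" if "z \<in> ball 0 1" for f g z
    using kpos[OF that] by (simp add: h_def)
  have S0: "0 \<le> (SUP z\<in>ball 0 1. h f g z)" if "f \<in> Bloch0 w" "g \<in> Bloch0 w" for f g
    using up[OF that, of 0] h0[of 0 f g] by simp
  have triv: "Bloch_dist w f g = 0 \<longleftrightarrow> f = g" if f: "f \<in> Bloch0 w" and g: "g \<in> Bloch0 w" for f g
  proof
    assume "f = g"
    then show "Bloch_dist w f g = 0" using f g by (simp add: d h_def)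
  next
    assume "Bloch_dist w f g = 0"
    then have eq0: "f 0 - g 0 = 0" and S: "(SUP z\<in>ball 0 1. h f g z) = 0"
      using S0[OF f g] d[OF f g] by (simp_all add: add_nonneg_eq_0_iff)
    have dz: "deriv (\<lambda>z. f z - g z) z = 0" if z: "z \<in> ball 0 1" for z
    proof -
      have "h f g z = 0" using up[OF f g z] h0[OF z, of f g] S by simp
      then show ?thesis using kpos[OF z] by (simp add: h_def)
    qed
    have hol: "(\<lambda>z. f z - g z) holomorphic_on ball 0 1"
      using Bloch0_diff[OF f g] by (simp add: Bloch0_def)
    have "((\<lambda>z. f z - g z) has_field_derivative 0) (at z within ball 0 1)"
      if z: "z \<in> ball 0 1" for z
      using holomorphic_derivI[OF hol _ z] dz[OF z] by (metis open_ball)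
    then obtain c where c: "\<And>z. z \<in> ball 0 1 \<Longrightarrow> f z - g z = c"
      using has_field_derivative_zero_constant[of "ball 0 1" "\<lambda>z. f z - g z"] by auto
    have "f z = g z" for z
    proof (cases "z \<in> ball 0 1")
      case True
      then show ?thesis using c[of z] c[of 0] eq0 by simp
    next
      case False
      then show ?thesis using f g by (simp add: Bloch0_def)
    qed
    then show "f = g" by auto
  qed
  have comm: "Bloch_dist w f g = Bloch_dist w g f" for f g
  proof (cases "f \<in> Bloch0 w \<and> g \<in> Bloch0 w")
    case True
    then have "h f g z = h g f z" if "z \<in> ball 0 1" for z
      using that by (simp add: h norm_minus_commute)
    then have "(SUP z\<in>ball 0 1. h f g z) = (SUP z\<in>ball 0 1. h g f z)"
      by (intro SUP_cong) auto
    then show ?thesis using True by (simp add: d norm_minus_commute)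
  qed (auto simp: Bloch_dist_def)
  have tri: "Bloch_dist w f p \<le> Bloch_dist w f g + Bloch_dist w g p"
    if f: "f \<in> Bloch0 w" and g: "g \<in> Bloch0 w" and p: "p \<in> Bloch0 w" for f g p
  proof -
    have "(SUP z\<in>ball 0 1. h f p z) \<le> (SUP z\<in>ball 0 1. h f g z) + (SUP z\<in>ball 0 1. h g p z)"
    proof (rule cSUP_least)
      fix z :: complex assume z: "z \<in> ball 0 1"
      have "norm (deriv f z - deriv p z) \<le> norm (deriv f z - deriv g z) + norm (deriv g z - deriv p z)"
        by (rule norm_diff_triangle_le[OF order_refl order_refl])
      then have "k z * norm (deriv f z - deriv p z)
          \<le> k z * (norm (deriv f z - deriv g z) + norm (deriv g z - deriv p z))"
        using kpos[OF z] by (intro mult_left_mono) auto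
      then have "h f p z \<le> h f g z + h g p z"
        using z f g p by (simp add: h distrib_left)
      then show "h f p z \<le> (SUP z\<in>ball 0 1. h f g z) + (SUP z\<in>ball 0 1. h g p z)"
        using up[OF f g z] up[OF g p z] by linarith
    qed auto
    moreover have "norm (f 0 - p 0) \<le> norm (f 0 - g 0) + norm (g 0 - p 0)"
      by (rule norm_diff_triangle_le[OF order_refl order_refl])
    ultimately show ?thesis using d[OF f g] d[OF g p] d[OF f p] by linarith
  qed
  show ?thesis
  proof
    show "0 \<le> Bloch_dist w f g" for f g
      using S0[of f g] d[of f g] by (cases "f \<in> Bloch0 w \<and> g \<in> Bloch0 w") (auto simp: Bloch_dist_def)
  qed (use comm triv tri in auto)
qed

lemma topspace_Bloch0_topology: "majorant w \<Longrightarrow> topspace (Bloch0_topology w) = Bloch0 w"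
  by (simp add: Bloch0_topology_def Metric_space.topspace_mtopology Metric_space_Bloch0)

end

theory Submission
  imports Defs
begin

text \<open>By the Baire category theorem it is enough to find, for every function \<open>h\<close> holomorphic near the
  closed disc, functions \<open>p\<close> of the same kind that are arbitrarily small in the Bloch norm and
  arbitrarily close to \<open>h\<close> in measure on the circle.

  Let \<open>R = \<Prod>\<^sub>j (1 + a\<^sub>j cos (q\<^sup>j \<theta>))\<close> be a finite Riesz product with \<open>a\<^sub>j = \<epsilon> w (q\<^sup>-\<^sup>j)\<close>, and \<open>H\<close> its Herglotz
  transform, so \<open>H 0 = 1\<close> and \<open>Re H = R\<close> on the circle. Comparing blocks of \<open>H\<close> with \<open>Re H\<close> by the
  maximum principle gives \<open>(1 - |z|) |H' z| \<le> C \<epsilon> w (1 - |z|) Re (H z)\<close>, while \<open>\<Sum> a\<^sub>j\<^sup>2 = \<infinity>\<close>, which is the divergence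
  of the integral, forces \<open>R\<close> to be small outside a set of small measure. Hence \<open>\<psi> = exp (K (H - 1) / (1 + \<kappa> H))\<close>
  is bounded, has small Bloch seminorm and \<open>\<psi> 0 = 1\<close>, and is small off a set of small measure;
  \<open>p = h (1 - \<psi>)\<close> is the required function.

  The set \<open>E\<close> can be any arc of measure \<open>\<delta>\<close>. Since it has a gap, polynomials in \<open>z\<close> are dense in the
  continuous functions on it, which yields countably many targets.\<close>

section \<open>Mean values and maximum principles on the disc\<close>

text \<open>The Riesz product has mean 1 whatever its length, so Markov's inequality for
  \<open>R\<close> itself gives nothing; the mean of its square root tends to 0. The transform
  \<open>H\<close> cannot be used directly either: \<open>Re H\<close> is not bounded uniformly in
  the number of factors, and it enters the bound on the derivative as a weight. Dividing by
  \<open>1 + \<kappa> H\<close> cures both defects, since the quotient is bounded and the squared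
  denominator in its derivative absorbs the weight. For \<open>\<psi>\<close> to be small,
  \<open>Im H\<close> has to be under control as well; this comes from a weak-type estimate based on
  the mean of \<open>1 / (1 + l H)\<close>. The order of choices matters: \<open>K\<close>,
  \<open>\<kappa>\<close> and the bound for \<open>\<psi>\<close> depend only on the size of the
  exceptional set, and the Bloch seminorm is made small afterwards. In \<open>h (1 - \<psi>)\<close>
  the factor \<open>1 - \<psi>\<close> then need only be bounded near the circle, where
  \<open>1 - |z|\<close> is negligible against \<open>w (1 - |z|)\<close>; on a compact disc it is
  small because \<open>\<psi> 0 = 1\<close> and the derivative of \<open>\<psi>\<close> is
  small.\<close>

lemma mean_value_circle:
  assumes "continuous_on (cball 0 1) f" "f holomorphic_on ball 0 1"
  shows "((\<lambda>x. f (cis (2 * pi * x))) has_integral f 0) {0..1}"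
proof -
  have "((\<lambda>u. f u / (u - 0)) has_contour_integral (2 * of_real pi * \<i> * f 0)) (circlepath 0 1)"
    by (rule Cauchy_integral_circlepath[OF assms]) simp
  then have "((\<lambda>x. f (circlepath 0 1 x) / (circlepath 0 1 x - 0)
      * vector_derivative (circlepath 0 1) (at x within {0..1})) has_integral
        (2 * of_real pi * \<i> * f 0)) {0..1}"
    by (simp add: has_contour_integral_def)
  then have "((\<lambda>x. (2 * of_real pi * \<i>) * f (cis (2 * pi * x))) has_integral
        (2 * of_real pi * \<i> * f 0)) {0..1}"
  proof (rule has_integral_eq[rotated])
    fix x :: real assume "x \<in> {0..1}"
    then have "vector_derivative (circlepath 0 1) (at x within {0..1}) = 2 * pi * \<i> * cis (2 * pi * x)"
      by (simp add: vector_derivative_circlepath01 cis_conv_exp mult_ac)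
    moreover have "circlepath 0 1 x = cis (2 * pi * x)"
      by (simp add: circlepath cis_conv_exp mult_ac)
    ultimately show "f (circlepath 0 1 x) / (circlepath 0 1 x - 0)
      * vector_derivative (circlepath 0 1) (at x within {0..1}) = 2 * of_real pi * \<i> * f (cis (2 * pi * x))"
      by simp
  qed
  then have "((\<lambda>x. inverse (2 * of_real pi * \<i>) * ((2 * of_real pi * \<i>) * f (cis (2 * pi * x)))) has_integral
        inverse (2 * of_real pi * \<i>) * (2 * of_real pi * \<i> * f 0)) {0..1}"
    by (rule has_integral_mult_right)
  moreover have "inverse (2 * of_real pi * \<i>) * ((2 * of_real pi * \<i>) * w) = w" for w :: complex
    using left_inverse[of "2 * of_real pi * \<i>"] by (simp only: mult.assoc[symmetric]) simp
  ultimately show ?thesis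
    by (simp only:)
qed

lemma markov_01:
  fixes u :: "real \<Rightarrow> real"
  assumes cont: "continuous_on {0..1} u" and nonneg: "\<And>x. x \<in> {0..1} \<Longrightarrow> 0 \<le> u x"
    and "0 < c" and int: "(u has_integral I) {0..1}"
  shows "measure lborel {x\<in>{0..1}. c \<le> u x} \<le> I / c"
proof -
  define S where "S = {x\<in>{0..1}. c \<le> u x}"
  have "closed S"
    unfolding S_def using continuous_closed_preimage[OF cont, of "{c..}"] by (simp add: vimage_def Int_def)
  then have S: "S \<in> sets borel" by simp
  have "S \<subseteq> {0..1}" by (auto simp: S_def)
  then have "emeasure lborel S \<le> emeasure lborel {0..1::real}" by (intro emeasure_mono) auto
  then have "emeasure lborel S < \<infinity>" by (auto simp: le_less_trans ennreal_less_top)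
  then have "((\<lambda>x. 1::real) has_integral measure lborel S) S"
    using has_integral_measure_lborel[OF S] by simp
  then have "((\<lambda>x. if x \<in> S then 1 else 0::real) has_integral measure lborel S) {0..1}"
    using \<open>S \<subseteq> {0..1}\<close> by (simp add: has_integral_restrict)
  then have "((\<lambda>x. c * (if x \<in> S then 1 else 0::real)) has_integral c * measure lborel S) {0..1}"
    by (rule has_integral_mult_right)
  then have "c * measure lborel S \<le> I"
    by (rule has_integral_le[OF _ int]) (use nonneg in \<open>auto simp: S_def\<close>)
  then show ?thesis using \<open>0 < c\<close> by (simp add: S_def field_simps)
qed

text \<open>\<open>norm A\<close> is subharmonic and \<open>Re H\<close> is harmonic, so domination
  passes from the circle to the disc. Concretely, \<open>exp (c A - H)\<close> has modulus at most 1
  on the circle, where the unimodular \<open>c\<close> is chosen to make \<open>c A\<close> real and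
  nonnegative at the point in question.\<close>

lemma norm_le_Re_maximum_principle:
  assumes A: "continuous_on (cball 0 1) A" "A holomorphic_on ball 0 1"
    and H: "continuous_on (cball 0 1) H" "H holomorphic_on ball 0 1"
    and le: "\<And>z. norm z = 1 \<Longrightarrow> norm (A z) \<le> Re (H z)"
    and z: "norm z \<le> 1"
  shows "norm (A z) \<le> Re (H z)"
proof -
  obtain c where c: "norm c = 1" "c * A z = norm (A z)"
  proof (cases "A z = 0")
    case True then show ?thesis using that[of 1] by simp
  next
    case False
    have "cnj (sgn (A z)) * A z = norm (A z)"
      using False complex_norm_square[of "A z"]
      by (simp add: sgn_eq field_simps power2_eq_square)
    then show ?thesis using that[of "cnj (sgn (A z))"] False by (simp add: norm_sgn)
  qed
  define F where "F = (\<lambda>z. exp (c * A z - H z))"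
  have "norm (F z) \<le> 1"
  proof (rule maximum_modulus_frontier[of F "cball 0 1"])
    show "F holomorphic_on interior (cball 0 1)"
      unfolding F_def by (auto intro!: holomorphic_intros A H)
    show "continuous_on (closure (cball 0 1)) F"
      unfolding F_def by (auto intro!: continuous_intros A H)
    show "norm (F z) \<le> 1" if "z \<in> frontier (cball 0 1)" for z
    proof -
      have "norm z = 1" using that by (simp add: frontier_cball)
      then have "Re (c * A z) \<le> Re (H z)"
        using le[of z] complex_Re_le_cmod[of "c * A z"] c(1) by (simp add: norm_mult)
      then show ?thesis by (simp add: F_def)
    qed
  qed (use z in auto)
  then show ?thesis using c(2) by (simp add: F_def)
qed

lemma compact_superlevel_01:
  fixes f :: "real \<Rightarrow> real"
  assumes "continuous_on {0..1} f"
  shows "compact {x\<in>{0..1}. c \<le> f x}"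
proof -
  have "closed ({0..1} \<inter> f -` {c..})"
    using assms by (intro continuous_closed_preimage) auto
  moreover have "{x\<in>{0..1}. c \<le> f x} = {0..1} \<inter> ({0..1} \<inter> f -` {c..})" by auto
  ultimately show ?thesis by (metis compact_Int_closed compact_Icc)
qed

text \<open>The Taylor coefficient 1/8 is weakened to 1/10. This is the largest constant for which
  the squared right side, even without its fourth-order term, still dominates \<open>1 + u\<close>
  up to \<open>u = 1 / 2\<close>.\<close>

lemma sqrt_one_plus_le:
  fixes u :: real
  assumes "\<bar>u\<bar> \<le> 1 / 2"
  shows "sqrt (1 + u) \<le> 1 + u / 2 - u\<^sup>2 / 10"
proof (rule real_le_lsqrt)
  have "u\<^sup>2 \<le> (1 / 2)\<^sup>2" using assms by (intro power2_le_imp_le[of "\<bar>u\<bar>", THEN power2_mono] abs_le_square_iff[THEN iffD1]) auto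
  then show "0 \<le> 1 + u / 2 - u\<^sup>2 / 10" using assms by (auto simp: power2_eq_square abs_le_iff)
  have "0 \<le> u\<^sup>2 * (1 / 20 - u / 10 + u\<^sup>2 / 100)"
    using assms by (intro mult_nonneg_nonneg) (auto simp: abs_le_iff add_nonneg_nonneg)
  then show "1 + u \<le> (1 + u / 2 - u\<^sup>2 / 10)\<^sup>2" by (simp add: power2_eq_square field_simps)
qed

section \<open>Riesz products and their Herglotz transforms\<close>

text \<open>The bound 1/2 keeps every factor of the product between 1/2 and 3/2. The lacunarity
  \<open>q \<ge> 4\<close> makes each frequency at least three times the sum of all lower
  ones.\<close>

locale riesz_product =
  fixes a :: "nat \<Rightarrow> real" and q :: nat
  assumes a_pos: "\<And>k. 0 < a k" and a_le: "\<And>k. a k \<le> 1 / 2" and q_ge: "4 \<le> q"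
begin

text \<open>The degree of \<open>R k\<close> as a trigonometric polynomial on the circle.\<close>

definition deg :: "nat \<Rightarrow> nat" where "deg k = (\<Sum>j<k. q ^ j)"

definition R :: "nat \<Rightarrow> complex \<Rightarrow> real" where
  "R n z = (\<Prod>j<n. 1 + a j * Re (z ^ (q ^ j)))"

text \<open>\<open>A n\<close> is the polynomial that agrees with \<open>z ^ deg n * R n z\<close> on the circle, and \<open>H n\<close> is the
  Herglotz transform of \<open>R n\<close>.\<close>

definition A :: "nat \<Rightarrow> complex \<Rightarrow> complex" where
  "A n z = (\<Prod>j<n. z ^ (q ^ j) + of_real (a j) * (1 + z ^ (2 * q ^ j)) / 2)"

definition H :: "nat \<Rightarrow> complex \<Rightarrow> complex" where
  "H n z = 1 + (\<Sum>k<n. of_real (a k) * (z ^ (q ^ k - deg k) * A k z))"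

text \<open>A geometric sum. The factor 3 is what the sequel consumes: together with
  \<open>deg_less\<close> it places twice the degree strictly below \<open>q ^ k\<close>, and it
  pays for the constant in \<open>deriv_A_circle\<close>.\<close>

lemma deg_le: "3 * deg k \<le> q ^ k"
proof -
  have "3 * deg k + 1 \<le> q ^ k"
  proof (induction k)
    case (Suc k)
    then have "3 * deg (Suc k) + 1 \<le> q ^ k + 3 * q ^ k" by (simp add: deg_def)
    also have "\<dots> \<le> q * q ^ k" using mult_right_mono[OF q_ge, of "q ^ k"] by simp
    finally show ?case by simp
  qed (simp add: deg_def)
  then show ?thesis by simp
qed

lemma deg_less: "deg k < q ^ k"
  using deg_le[of k] q_ge by (cases "deg k") auto

lemma hol_A: "A n holomorphic_on S"
  unfolding A_def[abs_def] by (intro holomorphic_intros) auto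

lemma hol_H: "H n holomorphic_on S"
  unfolding H_def[abs_def] by (intro holomorphic_intros hol_A) 

text \<open>On the circle conjugation is inversion, so multiplying by \<open>z ^ N\<close> clears
  the negative frequency of a cosine factor and leaves a polynomial.\<close>

lemma circle_factor:
  assumes "norm z = 1"
  shows "z ^ N + of_real c * (1 + z ^ (2 * N)) / 2 = z ^ N * of_real (1 + c * Re (z ^ N))"
proof -
  have "z ^ N * cnj (z ^ N) = 1"
    using assms complex_norm_square[of "z ^ N"] by (simp add: norm_power)
  moreover have "2 * complex_of_real (Re (z ^ N)) = z ^ N + cnj (z ^ N)"
    by (simp add: complex_add_cnj del: complex_cnj_power)
  ultimately have eq: "z ^ N * (2 * complex_of_real (Re (z ^ N))) = 1 + z ^ (2 * N)"
    by (simp only: distrib_left mult_2 power_add add.commute)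
  show ?thesis
    unfolding eq[symmetric] by (simp add: distrib_left mult_ac)
qed

lemma A_circle: "norm z = 1 \<Longrightarrow> A n z = z ^ deg n * of_real (R n z)"
  unfolding A_def R_def deg_def
  by (simp add: circle_factor power_sum prod.distrib)

lemma R_factor:
  assumes "norm z = 1"
  shows "1 - a j \<le> 1 + a j * Re (z ^ N)" "1 + a j * Re (z ^ N) \<le> 1 + a j"
proof -
  have "\<bar>Re (z ^ N)\<bar> \<le> 1"
    using abs_Re_le_cmod[of "z ^ N"] assms by (simp add: norm_power)
  then have "\<bar>a j * Re (z ^ N)\<bar> \<le> a j * 1"
    unfolding abs_mult using a_pos[of j] by (intro mult_mono) auto
  then show "1 - a j \<le> 1 + a j * Re (z ^ N)" "1 + a j * Re (z ^ N) \<le> 1 + a j" by auto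
qed

lemma R_factor_pos: "norm z = 1 \<Longrightarrow> 1 / 2 \<le> 1 + a j * Re (z ^ N)"
  using R_factor(1)[of z j N] a_le[of j] by simp

lemma R_pos: "norm z = 1 \<Longrightarrow> 0 < R n z"
  unfolding R_def by (intro prod_pos) (use R_factor_pos in \<open>auto intro: less_le_trans[of 0 "1/2"]\<close>)

lemma norm_A_circle: "norm z = 1 \<Longrightarrow> norm (A n z) = R n z"
  using R_pos[of z n] by (simp add: A_circle norm_mult norm_power)

text \<open>\<open>R\<close> telescopes: the increment from \<open>n\<close> to \<open>n + 1\<close>
  is \<open>a n * R n z * Re (z ^ (q ^ n))\<close>, which is the real part of the block added to
  \<open>H\<close>. Since \<open>deg n < q ^ n\<close>, that block has only positive frequencies and
  is a polynomial vanishing at 0.\<close>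

lemma Re_H_circle:
  assumes "norm z = 1"
  shows "Re (H n z) = R n z"
proof (induction n)
  case (Suc n)
  have "z ^ (q ^ n - deg n) * A n z = z ^ (q ^ n) * of_real (R n z)"
    using deg_less[of n] by (simp add: A_circle[OF assms] mult.assoc[symmetric] flip: power_add)
  then have "H (Suc n) z = H n z + of_real (a n * R n z) * z ^ (q ^ n)"
    by (simp add: H_def algebra_simps)
  moreover have "R (Suc n) z = R n z + a n * R n z * Re (z ^ (q ^ n))"
    by (simp add: R_def algebra_simps)
  ultimately show ?case using Suc by (simp add: mult.assoc)
qed (simp add: H_def R_def)

lemma H_0 [simp]: "H n 0 = 1"
proof -
  have "of_real (a k) * (0 ^ (q ^ k - deg k) * A k 0) = 0" for k
    using deg_less[of k] by simp
  then have "(\<Sum>k<n. of_real (a k) * (0 ^ (q ^ k - deg k) * A k 0)) = 0"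
    by (intro sum.neutral ballI)
  then show ?thesis unfolding H_def by simp
qed

text \<open>Both sides equal \<open>R n\<close> on the circle, so the maximum principle applies with
  equality on the boundary.\<close>

lemma norm_A_le:
  assumes "norm z \<le> 1"
  shows "norm (A n z) \<le> Re (H n z)"
  by (rule norm_le_Re_maximum_principle[OF _ hol_A _ hol_H _ assms])
     (auto intro: holomorphic_on_imp_continuous_on hol_A hol_H simp: Re_H_circle norm_A_circle)

text \<open>The minimum principle for the harmonic function \<open>Re (H n)\<close>, obtained by
  taking its boundary minimum as the dominated constant.\<close>

lemma Re_H_pos:
  assumes "norm z \<le> 1"
  shows "0 < Re (H n z)"
proof -
  have "compact (sphere (0::complex) 1)" by simp
  moreover have "continuous_on (sphere 0 1) (\<lambda>z. Re (H n z))"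
    by (intro continuous_intros holomorphic_on_imp_continuous_on hol_H)
  moreover have "sphere (0::complex) 1 \<noteq> {}" by simp
  ultimately obtain y where y: "norm y = 1" "\<And>z. norm z = 1 \<Longrightarrow> Re (H n y) \<le> Re (H n z)"
    using continuous_attains_inf[of "sphere 0 1" "\<lambda>z. Re (H n z)"] by auto
  have pos: "0 < Re (H n y)" using y(1) by (simp add: Re_H_circle R_pos)
  have "norm ((\<lambda>_. complex_of_real (Re (H n y))) z) \<le> Re (H n z)"
    by (rule norm_le_Re_maximum_principle[OF _ _ _ hol_H _ assms])
       (use pos y(2) in \<open>auto intro: holomorphic_on_imp_continuous_on hol_H\<close>)
  then show ?thesis using pos by simp
qed

section \<open>Derivative estimates weighted by the real part of the transform\<close>

text \<open>A Bernstein inequality with the weight \<open>R n\<close>, proved through the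
  logarithmic derivative: the factor with frequency \<open>N = q ^ j\<close> contributes at most
  \<open>N (1 + a j) / (1 - a j)\<close>, and this is at most \<open>3 N\<close> because
  \<open>a j \<le> 1 / 2\<close>.\<close>

lemma deriv_A_circle:
  assumes "norm z = 1"
  shows "norm (z * deriv (A n) z) \<le> 3 * deg n * R n z"
proof (induction n)
  case 0
  have "A 0 = (\<lambda>_. 1)" by (auto simp: A_def)
  then show ?case by (simp add: deg_def)
next
  case (Suc n)
  define N where "N = q ^ n"
  define f where "f = (\<lambda>z::complex. z ^ N + of_real (a n) * (1 + z ^ (2 * N)) / 2)"
  define f' where "f' = of_nat N * z ^ (N - 1) + of_real (a n) * (of_nat (2 * N) * z ^ (2 * N - 1)) / 2"
  have N: "0 < N" using q_ge by (simp add: N_def)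
  have df: "(f has_field_derivative f') (at z)"
    unfolding f_def f'_def by (auto intro!: derivative_eq_intros)
  have dA: "(A n has_field_derivative deriv (A n) z) (at z)"
    by (rule holomorphic_derivI[OF hol_A open_UNIV]) simp
  have "A (Suc n) = (\<lambda>z. A n z * f z)" by (auto simp: A_def f_def N_def)
  then have "deriv (A (Suc n)) z = deriv (A n) z * f z + f' * A n z"
    using DERIV_imp_deriv[OF DERIV_mult[OF dA df]] by simp
  then have "norm (z * deriv (A (Suc n)) z) \<le> norm (z * deriv (A n) z) * norm (f z) + norm (z * f') * norm (A n z)"
    unfolding norm_mult[symmetric]
    using norm_triangle_ineq[of "z * deriv (A n) z * f z" "z * f' * A n z"] by (simp only: distrib_left mult.assoc)
  also have "norm (f z) = 1 + a n * Re (z ^ N)"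
    using circle_factor[OF assms, of N "a n"] R_factor_pos[OF assms, of n N] assms
    by (simp add: f_def norm_mult norm_power del: of_real_add of_real_mult)
  also have "z * f' = of_nat N * z ^ N + of_real (a n) * (of_nat N * z ^ (2 * N))"
  proof -
    have "z * z ^ (N - 1) = z ^ N" "z * z ^ (2 * N - 1) = z ^ (2 * N)"
      using N by (simp_all flip: power_Suc)
    then show ?thesis by (simp add: f'_def distrib_left mult.left_commute[of z])
  qed
  also have "norm \<dots> \<le> N + a n * N"
    using a_pos[of n] assms
    by (intro norm_triangle_le add_mono) (simp_all add: norm_mult norm_power)
  also have "norm (z * deriv (A n) z) \<le> 3 * deg n * R n z" by (rule Suc)
  also have "norm (A n z) = R n z" using assms by (rule norm_A_circle)
  also have "N + a n * N \<le> 3 * N * (1 + a n * Re (z ^ N))"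
  proof -
    have "1 + a n \<le> 3 * (1 + a n * Re (z ^ N))"
      using mult_left_mono[OF R_factor(1)[OF assms, of n N], of 3] a_le[of n] by simp
    then have "N * (1 + a n) \<le> N * (3 * (1 + a n * Re (z ^ N)))" by (intro mult_left_mono) auto
    then show ?thesis by (simp add: algebra_simps)
  qed
  finally have "norm (z * deriv (A (Suc n)) z) \<le> 3 * deg n * R n z * (1 + a n * Re (z ^ N))
      + 3 * N * (1 + a n * Re (z ^ N)) * R n z"
    using R_pos[OF assms, of n] R_factor_pos[OF assms, of n N] by (auto simp: mult_right_mono)
  then show ?case by (simp add: deg_def R_def N_def algebra_simps)
qed

text \<open>With \<open>e = q ^ n - deg n\<close>, the left side is the derivative of
  \<open>z ^ e * A n z\<close> after the factor \<open>z ^ (e - 1)\<close> has been divided out.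
  What remains is a polynomial comparable with \<open>Re (H n)\<close> on the whole closed disc, and
  the separated power is kept as damping inside the disc.\<close>

lemma deriv_term_le:
  assumes "norm z \<le> 1"
  shows "norm (of_nat (q ^ n - deg n) * A n z + z * deriv (A n) z) \<le> 2 * q ^ n * Re (H n z)"
proof -
  define F where "F = (\<lambda>z. (of_nat (q ^ n - deg n) * A n z + z * deriv (A n) z) / (2 * of_nat (q ^ n)))"
  have hol: "F holomorphic_on S" for S
    unfolding F_def by (rule holomorphic_on_subset[of _ UNIV]) (auto intro!: holomorphic_intros hol_A simp: q_ge)
  have pos: "0 < 2 * real (q ^ n)" using q_ge by simp
  have circ: "norm (F z) \<le> Re (H n z)" if "norm z = 1" for z
  proof -
    have "norm (of_nat (q ^ n - deg n) * A n z + z * deriv (A n) z)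
        \<le> real (q ^ n - deg n) * R n z + 3 * deg n * R n z"
      by (intro norm_triangle_le add_mono deriv_A_circle that) (simp add: norm_mult norm_A_circle[OF that])
    also have "\<dots> = (real (q ^ n) + 2 * deg n) * R n z"
      using deg_less[of n] by (simp add: algebra_simps of_nat_diff)
    also have "\<dots> \<le> (2 * real (q ^ n)) * R n z"
    proof (rule mult_right_mono)
      have "3 * real (deg n) \<le> real (q ^ n)"
        using of_nat_mono[OF deg_le[of n], where 'a = real] by simp
      then show "real (q ^ n) + 2 * deg n \<le> 2 * real (q ^ n)" by linarith
    qed (use R_pos[OF that, of n] in simp)
    finally show ?thesis
      using pos by (simp add: F_def norm_divide Re_H_circle[OF that] field_simps norm_mult norm_power)
  qed
  have "norm (F z) \<le> Re (H n z)"
    by (rule norm_le_Re_maximum_principle[OF _ hol _ hol_H circ assms])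
       (auto intro: holomorphic_on_imp_continuous_on hol hol_H)
  then show ?thesis
    using pos by (simp add: F_def norm_divide field_simps norm_mult norm_power)
qed

text \<open>The new block is small relative to \<open>Re (H n)\<close> itself, not merely in
  absolute size. Hence one more factor can lower the weight only by a ratio close to 1.\<close>

lemma Re_H_Suc_ge:
  assumes "norm z \<le> 1"
  shows "(1 - a n * norm z ^ (q ^ n - deg n)) * Re (H n z) \<le> Re (H (Suc n) z)"
proof -
  let ?T = "of_real (a n) * (z ^ (q ^ n - deg n) * A n z)"
  have "H (Suc n) z = H n z + ?T" by (simp add: H_def)
  moreover have "\<bar>Re ?T\<bar> \<le> norm ?T" by (rule abs_Re_le_cmod)
  moreover have "norm ?T \<le> a n * (norm z ^ (q ^ n - deg n) * Re (H n z))"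
    unfolding norm_mult norm_power using a_pos[of n] norm_A_le[OF assms, of n]
    by (auto intro!: mult_left_mono)
  ultimately show ?thesis by (simp add: algebra_simps)
qed

lemma deriv_H_Suc_le:
  assumes "norm z \<le> 1"
  shows "norm (deriv (H (Suc n)) z) \<le> norm (deriv (H n) z)
      + 2 * a n * q ^ n * norm z ^ (q ^ n - deg n - 1) * Re (H n z)"
proof -
  define e where "e = q ^ n - deg n"
  have e: "0 < e" using deg_less[of n] by (simp add: e_def)
  have dH: "(H n has_field_derivative deriv (H n) z) (at z)"
    by (rule holomorphic_derivI[OF hol_H open_UNIV]) simp
  have dA: "(A n has_field_derivative deriv (A n) z) (at z)"
    by (rule holomorphic_derivI[OF hol_A open_UNIV]) simp
  have "H (Suc n) = (\<lambda>z. H n z + of_real (a n) * (z ^ e * A n z))"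
    by (auto simp: H_def e_def)
  moreover have "((\<lambda>z. H n z + of_real (a n) * (z ^ e * A n z)) has_field_derivative
      deriv (H n) z + of_real (a n) * (z ^ (e - 1) * (of_nat e * A n z + z * deriv (A n) z))) (at z)"
  proof -
    have "((\<lambda>z. H n z + of_real (a n) * (z ^ e * A n z)) has_field_derivative
      deriv (H n) z + of_real (a n) * (of_nat e * z ^ (e - 1) * A n z + deriv (A n) z * z ^ e)) (at z)"
      by (auto intro!: derivative_eq_intros dH dA)
    moreover have "of_nat e * z ^ (e - 1) * A n z + deriv (A n) z * z ^ e
        = z ^ (e - 1) * (of_nat e * A n z + z * deriv (A n) z)"
      using power_minus_mult[OF e, of z] by (simp add: distrib_left mult_ac)
    ultimately show ?thesis by simp
  qed
  ultimately have "deriv (H (Suc n)) z = deriv (H n) z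
      + of_real (a n) * (z ^ (e - 1) * (of_nat e * A n z + z * deriv (A n) z))"
    using DERIV_imp_deriv by metis
  then have "norm (deriv (H (Suc n)) z) \<le> norm (deriv (H n) z)
      + a n * (norm z ^ (e - 1) * norm (of_nat e * A n z + z * deriv (A n) z))"
    using a_pos[of n] by (auto intro: norm_triangle_le simp: norm_mult norm_power)
  also have "a n * (norm z ^ (e - 1) * norm (of_nat e * A n z + z * deriv (A n) z))
      \<le> a n * (norm z ^ (e - 1) * (2 * q ^ n * Re (H n z)))"
    using deriv_term_le[OF assms, of n] a_pos[of n]
    by (intro mult_left_mono) (auto simp: e_def)
  finally show ?thesis by (simp add: e_def mult_ac)
qed

text \<open>With \<open>s n = q ^ n * (1 - norm z)\<close>, the blocks with \<open>s n \<le> 1\<close> contribute a geometric sum, because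
  \<open>w t / t powr \<alpha>\<close> decreases, and those with \<open>s n > 1\<close> are damped by \<open>norm z ^ q ^ n\<close>.\<close>

lemma hyperbolic_derivative_bound:
  fixes w :: "real \<Rightarrow> real" and \<alpha> \<epsilon> :: real
  assumes \<alpha>: "0 < \<alpha>" "\<alpha> < 1" and anti: "antimono_on {0<..1} (\<lambda>t. w t / t powr \<alpha>)"
    and mono: "mono_on {0..1} w" and wpos: "\<And>t. 0 < t \<Longrightarrow> t \<le> 1 \<Longrightarrow> 0 < w t"
    and "0 < \<epsilon>" and a: "\<And>k. a k = \<epsilon> * w (1 / q ^ k)" and a1: "\<And>k. a k \<le> 1 / 1000"
    and q: "200 \<le> q" "4 \<le> real q powr (1 - \<alpha>)" and z: "norm z < 1"
  shows "(1 - norm z) * norm (deriv (H n) z) \<le> 2 * q * \<epsilon> * w (1 - norm z) * Re (H n z)"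
proof -
  define t where "t = 1 - norm z"
  define s where "s = (\<lambda>n. q ^ n * t)"
  define V where "V = (\<lambda>n. Re (H n z))"
  define D where "D = (\<lambda>n. t * norm (deriv (H n) z))"
  define e where "e = (\<lambda>n. q ^ n - deg n)"
  define c where "c = \<epsilon> * w t"
  define \<beta> where "\<beta> = 1 - \<alpha>"
  have t: "0 < t" "t \<le> 1" using z by (auto simp: t_def)
  have c: "0 < c" using wpos[OF t] \<open>0 < \<epsilon>\<close> by (simp add: c_def)
  have q0: "0 < real q" using q by simp
  have s_pos: "0 < s n" for n using t q by (simp add: s_def)
  have s_Suc: "s (Suc n) = q * s n" for n by (simp add: s_def)
  have V_pos: "0 < V n" for n using Re_H_pos[of z n] z by (simp add: V_def)
  have V_Suc: "(1 - a n * norm z ^ e n) * V n \<le> V (Suc n)" for n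
    using Re_H_Suc_ge[of z n] z by (simp add: V_def e_def)
  have D_Suc: "D (Suc n) \<le> D n + 2 * (a n * s n) * norm z ^ (e n - 1) * V n" for n
  proof -
    have "t * norm (deriv (H (Suc n)) z) \<le> t * (norm (deriv (H n) z)
      + 2 * a n * q ^ n * norm z ^ (e n - 1) * V n)"
      using deriv_H_Suc_le[of z n] z t by (intro mult_left_mono) (auto simp: e_def V_def)
    then show ?thesis by (simp add: D_def s_def algebra_simps)
  qed
  have D_0: "D 0 = 0"
  proof -
    have "H 0 = (\<lambda>_. 1)" by (auto simp: H_def)
    then show ?thesis by (simp add: D_def)
  qed
  have pow_le: "norm z ^ m \<le> 1" for m using z by (simp add: power_le_one)
  have N: "0 < 1 / real q ^ n" "1 / real q ^ n \<le> 1" for n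
    using q by auto
  \<comment> \<open>The claim reaches up to \<open>s n \<le> q\<close>, one index beyond
    \<open>s n \<le> 1\<close>, so that it also provides the start for \<open>large\<close>. One
    step costs a factor 3 (the old bound plus twice the new term) and 4/3 for replacing
    \<open>V n\<close> by \<open>V (Suc n)\<close>; the product 4 is absorbed by
    \<open>q powr \<beta>\<close>.\<close>
  have small: "s n \<le> q \<Longrightarrow> D n \<le> c * s n powr \<beta> * V n" for n
  proof (induction n)
    case 0
    then show ?case using D_0 c V_pos[of 0] by simp
  next
    case (Suc n)
    then have s1: "s n \<le> 1" using q0 by (simp add: s_Suc)
    moreover have "1 \<le> real q" using q by simp
    ultimately have IH: "D n \<le> c * s n powr \<beta> * V n" using Suc.IH by linarith
    \<comment> \<open>Here \<open>t \<le> 1 / q ^ n\<close>, so the antimonotone quotient gives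
      \<open>w (1 / q ^ n) \<le> w t * s n powr (- \<alpha>)\<close>.\<close>
    have as: "a n * s n \<le> c * s n powr \<beta>"
    proof -
      have "t \<le> 1 / q ^ n" using s1 q0 by (simp add: s_def field_simps)
      moreover have "t \<in> {0<..1}" "1 / q ^ n \<in> {0<..1}" using t N[of n] by simp_all
      ultimately have "w (1 / q ^ n) / (1 / q ^ n) powr \<alpha> \<le> w t / t powr \<alpha>"
        by (intro monotone_onD[OF anti])
      then have "w (1 / q ^ n) \<le> w t * ((1 / q ^ n) powr \<alpha> / t powr \<alpha>)"
        using N[of n] by (simp add: divide_le_eq)
      also have "(1 / q ^ n) powr \<alpha> / t powr \<alpha> = (1 / s n) powr \<alpha>"
        using t q0 by (simp add: s_def powr_divide powr_mult)
      finally have "\<epsilon> * w (1 / q ^ n) * s n \<le> \<epsilon> * (w t * (1 / s n) powr \<alpha>) * s n"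
        using \<open>0 < \<epsilon>\<close> s_pos[of n] by (intro mult_right_mono mult_left_mono) auto
      also have "\<dots> = c * (s n powr (- \<alpha>) * s n powr 1)"
        using s_pos[of n] by (simp add: c_def powr_minus powr_divide divide_inverse inverse_powr)
      also have "\<dots> = c * s n powr \<beta>"
        by (simp only: \<beta>_def powr_add[symmetric]) simp
      finally show ?thesis by (simp add: a)
    qed
    have asp: "0 \<le> a n * s n" using a_pos[of n] s_pos[of n] by simp
    have "(a n * s n) * norm z ^ (e n - 1) \<le> (c * s n powr \<beta>) * 1"
      by (rule mult_mono[OF as pow_le]) (use c in simp_all)
    then have "2 * ((a n * s n) * norm z ^ (e n - 1)) * V n \<le> 2 * (c * s n powr \<beta>) * V n"
      using V_pos[of n] by (intro mult_right_mono) auto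
    then have "D (Suc n) \<le> 3 * (c * s n powr \<beta>) * V n" using D_Suc[of n] IH by simp
    also have "\<dots> \<le> 3 * (c * s n powr \<beta>) * (4 / 3 * V (Suc n))"
    proof (rule mult_left_mono)
      have "a n * norm z ^ e n \<le> 1 / 1000 * 1"
        using a1[of n] a_pos[of n] pow_le[of "e n"] by (intro mult_mono) auto
      then have "3 / 4 * V n \<le> (1 - a n * norm z ^ e n) * V n"
        using V_pos[of n] by (intro mult_right_mono) auto
      then show "V n \<le> 4 / 3 * V (Suc n)" using V_Suc[of n] by linarith
    qed (use c in simp)
    also have "\<dots> = c * (4 * s n powr \<beta>) * V (Suc n)" by simp
    also have "\<dots> \<le> c * (real q powr \<beta> * s n powr \<beta>) * V (Suc n)"
      using q c V_pos[of "Suc n"] by (intro mult_right_mono mult_left_mono) (auto simp: \<beta>_def)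
    also have "real q powr \<beta> * s n powr \<beta> = s (Suc n) powr \<beta>"
      using s_pos[of n] by (simp add: s_Suc powr_mult)
    finally show ?case .
  qed
  \<comment> \<open>The correction \<open>- 1 / s n\<close> makes the induction close. With
    \<open>y = 1 / s n\<close>, passing to the next index raises the permitted bound from
    \<open>q * (2 - y)\<close> to \<open>2 * q - y\<close>. The gain \<open>(q - 1) * y\<close> pays
    for the new term \<open>36 * y\<close> and for the relative loss \<open>36 / 1000 * y\<close> of
    the weight; \<open>q \<ge> 200\<close> is ample for this.\<close>
  have large: "1 < s n \<Longrightarrow> D n \<le> c * (q * (2 - 1 / s n)) * V n" for n
  proof (induction n)
    case 0
    then show ?case using t by (simp add: s_def)
  next
    case (Suc n)
    show ?case
    proof (cases "s n \<le> 1")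
      case True
      then have sq: "s (Suc n) \<le> q" using q0 by (simp add: s_Suc)
      have "s (Suc n) powr \<beta> \<le> s (Suc n) powr 1"
        using Suc.prems \<alpha> by (intro powr_mono) (auto simp: \<beta>_def)
      also have "\<dots> \<le> real q * 1" using sq Suc.prems by simp
      also have "\<dots> \<le> q * (2 - 1 / s (Suc n))"
        using Suc.prems by (intro mult_left_mono) auto
      finally have "c * s (Suc n) powr \<beta> * V (Suc n) \<le> c * (q * (2 - 1 / s (Suc n))) * V (Suc n)"
        using c V_pos[of "Suc n"] by (intro mult_right_mono mult_left_mono) auto
      then show ?thesis using small[OF sq] by linarith
    next
      case False
      define y where "y = 1 / s n"
      have y: "0 < y" "y \<le> 1" using False s_pos[of n] by (auto simp: y_def)
      have IH: "D n \<le> c * (q * (2 - y)) * V n" using Suc.IH False by (simp add: y_def)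
      have "1 / q ^ n \<le> t" using False q0 by (simp add: s_def field_simps)
      moreover have "t \<in> {0..1}" "1 / q ^ n \<in> {0..1}" using t N[of n] by simp_all
      ultimately have "w (1 / q ^ n) \<le> w t"
        by (intro mono_onD[OF mono])
      then have an: "a n \<le> c" using \<open>0 < \<epsilon>\<close> by (simp add: a c_def)
      have n0: "n \<noteq> 0" using False t by (auto simp: s_def intro: Nat.gr0I)
      \<comment> \<open>Exponential damping is weakened to a quadratic one, with
        \<open>x = s n / 3\<close> in \<open>exp x \<ge> x\<^sup>2 / 2\<close>. One factor
        \<open>y\<close> cancels the \<open>s n\<close> in \<open>a n * s n\<close>; the other one
        is the summable gain.\<close>
      have zpow: "norm z ^ (e n - 1) \<le> 18 * y\<^sup>2"
      proof -
        have qn: "200 \<le> q ^ n" using q(1) n0 self_le_power[of q n] by linarith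
        have "q ^ n \<le> 3 * (e n - 1)" using deg_le[of n] qn unfolding e_def by linarith
        then have "real (q ^ n) \<le> real (3 * (e n - 1))" by (rule of_nat_mono)
        then have "s n / 3 \<le> real (e n - 1) * t" using t by (simp add: s_def)
        have "norm z ^ (e n - 1) \<le> exp (- t) ^ (e n - 1)"
          using exp_ge_add_one_self[of "- t"] by (intro power_mono) (auto simp: t_def)
        also have "\<dots> = exp (- (real (e n - 1) * t))" by (simp add: exp_of_nat_mult[symmetric])
        also have "\<dots> \<le> exp (- (s n / 3))" using \<open>s n / 3 \<le> _\<close> by simp
        also have "\<dots> = 1 / exp (s n / 3)" by (simp add: exp_minus field_simps)
        also have "\<dots> \<le> 1 / ((s n / 3)\<^sup>2 / 2)"
        proof (rule divide_left_mono)
          show "(s n / 3)\<^sup>2 / 2 \<le> exp (s n / 3)"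
            using exp_lower_Taylor_quadratic[of "s n / 3"] s_pos[of n] by simp
        qed (use s_pos[of n] in auto)
        also have "\<dots> = 18 * y\<^sup>2" using s_pos[of n] by (simp add: y_def power2_eq_square field_simps)
        finally show ?thesis .
      qed
      have "a n * s n * norm z ^ (e n - 1) \<le> c * s n * (18 * y\<^sup>2)"
        using an a_pos[of n] zpow c s_pos[of n] by (intro mult_mono) auto
      also have "\<dots> = c * (18 * y)" using s_pos[of n] by (simp add: y_def power2_eq_square)
      finally have "2 * (a n * s n) * norm z ^ (e n - 1) * V n \<le> c * (36 * y) * V n"
        using V_pos[of n] by (simp add: mult.assoc[symmetric])
      then have D: "D (Suc n) \<le> c * (q * (2 - y) + 36 * y) * V n"
        using D_Suc[of n] IH by (simp add: algebra_simps)
      \<comment> \<open>The bound \<open>a n \<le> 1 / 1000\<close> makes the relative loss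
        \<open>x\<close> at most \<open>18 / 1000 * y\<close>; then
        \<open>1 / (1 - x) \<le> 1 + 2 * x\<close>.\<close>
      have V: "V n \<le> V (Suc n) * (1 + 36 / 1000 * y)"
      proof -
        define x where "x = a n * norm z ^ e n"
        have "norm z ^ e n \<le> norm z ^ (e n - 1)"
          using z by (intro power_decreasing) auto
        also have "\<dots> \<le> 18 * y"
        proof -
          have "y\<^sup>2 \<le> y" using mult_right_mono[of y 1 y] y by (simp add: power2_eq_square)
          then show ?thesis using zpow by linarith
        qed
        finally have "x \<le> 1 / 1000 * (18 * y)"
          unfolding x_def using a1[of n] a_pos[of n] by (intro mult_mono) auto
        moreover have "0 \<le> x" using a_pos[of n] by (simp add: x_def)
        ultimately have x: "0 \<le> x" "x \<le> 18 / 1000 * y" by auto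
        have "1 \<le> (1 - x) * (1 + 2 * x)"
        proof -
          have "x * (1 - 2 * x) \<ge> 0" using x y by (intro mult_nonneg_nonneg) linarith+
          then show ?thesis by (simp add: algebra_simps)
        qed
        then have "1 * V n \<le> (1 - x) * (1 + 2 * x) * V n" using V_pos[of n] by (intro mult_right_mono) auto
        also have "\<dots> = ((1 - x) * V n) * (1 + 2 * x)" by simp
        also have "\<dots> \<le> V (Suc n) * (1 + 2 * x)"
          using V_Suc[of n] x by (intro mult_right_mono) (auto simp: x_def)
        also have "\<dots> \<le> V (Suc n) * (1 + 36 / 1000 * y)"
          using x V_pos[of "Suc n"] by (intro mult_left_mono) auto
        finally show ?thesis by simp
      qed
      have "0 \<le> real q * (2 - y) + 36 * y" using y by simp
      then have "D (Suc n) \<le> c * (q * (2 - y) + 36 * y) * (V (Suc n) * (1 + 36 / 1000 * y))"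
        by (intro order_trans[OF D] mult_left_mono V mult_nonneg_nonneg) (use c in auto)
      also have "\<dots> = c * ((q * (2 - y) + 36 * y) * (1 + 36 / 1000 * y)) * V (Suc n)"
        by (simp add: mult_ac)
      also have "(q * (2 - y) + 36 * y) * (1 + 36 / 1000 * y) \<le> q * (2 - 1 / s (Suc n))"
      proof -
        have "q * (2 - 1 / s (Suc n)) = 2 * q - y"
          using q0 s_pos[of n] by (simp add: y_def s_Suc field_simps)
        moreover have "(q * (2 - y) + 36 * y) * (1 + 36 / 1000 * y)
            = 2 * q - y - (y * (928 / 1000 * q - 37) + y\<^sup>2 * (36 / 1000 * q - 1296 / 1000))"
          by (simp add: algebra_simps power2_eq_square)
        moreover have "0 \<le> y * (928 / 1000 * q - 37)" "0 \<le> y\<^sup>2 * (36 / 1000 * q - 1296 / 1000)"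
          using y q by (auto intro!: mult_nonneg_nonneg)
        ultimately show ?thesis by linarith
      qed
      finally show ?thesis using c V_pos[of "Suc n"] by simp
    qed
  qed
  have "D n \<le> c * (2 * q) * V n"
  proof (cases "s n \<le> 1")
    case True
    have "s n powr \<beta> \<le> 1 powr \<beta>" using True \<alpha> s_pos[of n] by (intro powr_mono2) (auto simp: \<beta>_def)
    then have "s n powr \<beta> \<le> 2 * q" using q by simp
    then have "c * s n powr \<beta> * V n \<le> c * (2 * q) * V n"
      using c V_pos[of n] by (intro mult_right_mono mult_left_mono) auto
    moreover have "s n \<le> q" using True q by linarith
    ultimately show ?thesis using small[of n] by linarith
  next
    case False
    have "q * (2 - 1 / s n) \<le> real q * 2" using s_pos[of n] by (intro mult_left_mono) auto
    then have "c * (q * (2 - 1 / s n)) * V n \<le> c * (2 * q) * V n"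
      using c V_pos[of n] by (intro mult_right_mono mult_left_mono) auto
    then show ?thesis using large[of n] False by linarith
  qed
  then show ?thesis by (simp add: D_def c_def V_def t_def mult_ac)
qed

section \<open>Decay in measure of the Riesz product\<close>

text \<open>\<open>Q n\<close> dominates \<open>sqrt (R n)\<close> factor by factor. Its frequencies are so sparse that the mean of the
  product is the product of the means.\<close>

definition Q :: "nat \<Rightarrow> complex \<Rightarrow> real" where
  "Q n z = (\<Prod>j<n. 1 - (a j)\<^sup>2 / 20 + a j / 2 * Re (z ^ (q ^ j)) - (a j)\<^sup>2 / 20 * Re (z ^ (2 * q ^ j)))"

lemma Re_power2_circle:
  assumes "norm z = 1"
  shows "(Re (z ^ N))\<^sup>2 = (1 + Re (z ^ (2 * N))) / 2"
proof -
  have "z ^ (2 * N) = z ^ N * z ^ N" by (simp add: mult_2 power_add)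
  then have "Re (z ^ (2 * N)) = (Re (z ^ N))\<^sup>2 - (Im (z ^ N))\<^sup>2"
    by (simp add: power2_eq_square)
  moreover have "(Re (z ^ N))\<^sup>2 + (Im (z ^ N))\<^sup>2 = 1"
    using assms by (simp add: norm_power flip: cmod_power2)
  ultimately show ?thesis by (simp add: field_simps)
qed

text \<open>\<open>sqrt_one_plus_le\<close> is applied to each factor, with the squared cosine
  expressed by the double angle. The mean 1/2 of the squared cosine turns the constant term into
  \<open>1 - (a j)\<^sup>2 / 20\<close>, and this deficit is the source of the decay.\<close>

lemma sqrt_R_le_Q:
  assumes z: "norm z = 1"
  shows "sqrt (R n z) \<le> Q n z"
proof -
  have "sqrt (R n z) = (\<Prod>j<n. sqrt (1 + a j * Re (z ^ (q ^ j))))"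
    unfolding R_def by (induction n) (auto simp: real_sqrt_mult)
  also have "\<dots> \<le> Q n z"
    unfolding Q_def
  proof (intro prod_mono conjI)
    fix j assume "j \<in> {..<n}"
    define u where "u = a j * Re (z ^ (q ^ j))"
    have "1 - a j \<le> 1 + u" "1 + u \<le> 1 + a j"
      using R_factor[OF z, of j "q ^ j"] by (auto simp: u_def)
    then have "\<bar>u\<bar> \<le> 1 / 2" using a_le[of j] by (auto simp: abs_le_iff)
    then have "sqrt (1 + u) \<le> 1 + u / 2 - u\<^sup>2 / 10" by (rule sqrt_one_plus_le)
    also have "u\<^sup>2 = (a j)\<^sup>2 * ((1 + Re (z ^ (2 * q ^ j))) / 2)"
      by (simp only: u_def power_mult_distrib Re_power2_circle[OF z])
    also have "1 + u / 2 - \<dots> / 10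
      = 1 - (a j)\<^sup>2 / 20 + a j / 2 * Re (z ^ (q ^ j)) - (a j)\<^sup>2 / 20 * Re (z ^ (2 * q ^ j))"
      by (simp add: u_def field_simps)
    finally show "sqrt (1 + a j * Re (z ^ q ^ j)) \<le> \<dots>" by (simp only: u_def)
    show "0 \<le> sqrt (1 + a j * Re (z ^ q ^ j))"
      using \<open>\<bar>u\<bar> \<le> 1 / 2\<close> by (simp add: u_def[symmetric] abs_le_iff)
  qed
  finally show ?thesis .
qed

lemma circle_cnj_power:
  assumes "norm z = 1"
  shows "z ^ N * cnj (z ^ N) = 1"
  using assms complex_norm_square[of "z ^ N"] by (simp add: norm_power)

text \<open>The lowest frequency in the \<open>j\<close>-th factor of \<open>Q n\<close> is
  \<open>- 2 * q ^ j\<close>, so the shift by \<open>2 * deg n\<close> removes all negative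
  frequencies.\<close>

lemma Q_entire:
  obtains P where "P holomorphic_on UNIV"
    "\<And>z. norm z = 1 \<Longrightarrow> P z = z ^ (2 * deg n) * of_real (Q n z)"
proof -
  define P where "P = (\<lambda>z. \<Prod>j<n. of_real (1 - (a j)\<^sup>2 / 20) * z ^ (2 * q ^ j)
     + of_real (a j / 4) * (z ^ (3 * q ^ j) + z ^ (q ^ j))
     - of_real ((a j)\<^sup>2 / 40) * (z ^ (4 * q ^ j) + 1) :: complex)"
  have "P holomorphic_on UNIV"
    unfolding P_def by (intro holomorphic_intros)
  moreover have "P z = z ^ (2 * deg n) * of_real (Q n z)" if z: "norm z = 1" for z
  proof -
    have fac: "of_real (1 - (a j)\<^sup>2 / 20) * z ^ (2 * N)
       + of_real (a j / 4) * (z ^ (3 * N) + z ^ N) - of_real ((a j)\<^sup>2 / 40) * (z ^ (4 * N) + 1)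
       = z ^ (2 * N) * of_real (1 - (a j)\<^sup>2 / 20 + a j / 2 * Re (z ^ N) - (a j)\<^sup>2 / 20 * Re (z ^ (2 * N)))"
      for j N
    proof -
      define x where "x = z ^ N"
      define y where "y = cnj x"
      have xy: "x * y = 1" using circle_cnj_power[OF z, of N] by (simp add: x_def y_def)
      have Re1: "complex_of_real (Re x) = (x + y) / 2"
        by (simp add: y_def complex_add_cnj)
      have Re2: "complex_of_real (Re (x * x)) = (x * x + y * y) / 2"
        using complex_add_cnj[of "x * x"] by (simp add: y_def)
      have pow: "z ^ (2 * N) = x * x" "z ^ (3 * N) = x * x * x" "z ^ (4 * N) = x * x * x * x"
        by (simp_all add: x_def eval_nat_numeral power_add mult_ac)
      have "x * x * (x + y) = x * x * x + x * (x * y)" "x * x * (x * x + y * y) = x * x * x * x + (x * y) * (x * y)"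
        by (simp_all add: algebra_simps)
      then have *: "x * x * (x + y) = x * x * x + x" "x * x * (x * x + y * y) = x * x * x * x + 1"
        by (simp_all add: xy)
      have "x * x * of_real (1 - (a j)\<^sup>2 / 20 + a j / 2 * Re x - (a j)\<^sup>2 / 20 * Re (x * x))
        = x * x * of_real (1 - (a j)\<^sup>2 / 20) + of_real (a j / 2) * (x * x * (of_real (Re x)))
            - of_real ((a j)\<^sup>2 / 20) * (x * x * of_real (Re (x * x)))"
        by (simp only: of_real_add of_real_diff of_real_mult distrib_left right_diff_distrib mult_ac)
      also have "x * x * of_real (Re x) = (x * x * x + x) / 2"
        by (simp only: Re1 times_divide_eq_right *)
      also have "x * x * of_real (Re (x * x)) = (x * x * x * x + 1) / 2"
        by (simp only: Re2 times_divide_eq_right *)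
      finally have "x * x * of_real (1 - (a j)\<^sup>2 / 20 + a j / 2 * Re x - (a j)\<^sup>2 / 20 * Re (x * x))
        = of_real (1 - (a j)\<^sup>2 / 20) * (x * x) + of_real (a j / 4) * (x * x * x + x)
           - of_real ((a j)\<^sup>2 / 40) * (x * x * x * x + 1)"
        by (simp add: mult.commute)
      then show ?thesis unfolding pow x_def[symmetric] by (rule sym)
    qed
    show ?thesis
      unfolding P_def fac prod.distrib Q_def deg_def of_real_prod
      by (simp add: power_sum sum_distrib_left)
  qed
  ultimately show ?thesis using that by blast
qed

text \<open>Orthogonality of frequencies: those of \<open>Q n\<close> lie between
  \<open>- 2 * deg n\<close> and \<open>2 * deg n\<close>, hence \<open>z ^ N * Q n z\<close>
  extends from the circle to an entire function vanishing at 0, and the mean value property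
  applies.\<close>

lemma has_integral_Q_power:
  assumes "2 * deg n < N"
  shows "((\<lambda>x. Q n (cis (2 * pi * x)) * Re (cis (2 * pi * x) ^ N)) has_integral 0) {0..1}"
proof -
  obtain P where P: "P holomorphic_on UNIV"
    "\<And>z. norm z = 1 \<Longrightarrow> P z = z ^ (2 * deg n) * of_real (Q n z)"
    using Q_entire by blast
  define F where "F = (\<lambda>z. z ^ (N - 2 * deg n) * P z)"
  have "F holomorphic_on UNIV" unfolding F_def by (intro holomorphic_intros P(1))
  then have "((\<lambda>x. F (cis (2 * pi * x))) has_integral F 0) {0..1}"
    by (intro mean_value_circle) (auto intro: holomorphic_on_imp_continuous_on holomorphic_on_subset)
  then have "((\<lambda>x. Re (F (cis (2 * pi * x)))) has_integral Re (F 0)) {0..1}"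
    by (rule has_integral_Re)
  moreover have "F 0 = 0" using assms by (simp add: F_def)
  moreover have "F z = z ^ N * of_real (Q n z)" if "norm z = 1" for z
    using assms by (simp add: F_def P(2)[OF that] mult.assoc[symmetric] flip: power_add)
  ultimately show ?thesis by (simp add: mult.commute)
qed

lemma has_integral_Q:
  "((\<lambda>x. Q n (cis (2 * pi * x))) has_integral (\<Prod>j<n. 1 - (a j)\<^sup>2 / 20)) {0..1}"
proof (induction n)
  case 0
  show ?case using has_integral_const_real[of "1::real" 0 1] by (simp add: Q_def)
next
  case (Suc n)
  have deg: "2 * deg n < q ^ n" using deg_le[of n] deg_less[of n] by linarith
  let ?Q = "\<lambda>x. Q n (cis (2 * pi * x))"
  have "((\<lambda>x. (1 - (a n)\<^sup>2 / 20) * ?Q x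
      + a n / 2 * (?Q x * Re (cis (2 * pi * x) ^ (q ^ n)))
      - (a n)\<^sup>2 / 20 * (?Q x * Re (cis (2 * pi * x) ^ (2 * q ^ n)))) has_integral
      (1 - (a n)\<^sup>2 / 20) * (\<Prod>j<n. 1 - (a j)\<^sup>2 / 20) + a n / 2 * 0 - (a n)\<^sup>2 / 20 * 0) {0..1}"
    using deg by (intro has_integral_add has_integral_diff has_integral_mult_right Suc has_integral_Q_power) auto
  then show ?case
    by (simp add: Q_def algebra_simps)
qed

text \<open>Markov's inequality for \<open>Q n\<close>, which dominates the square root of
  \<open>R n\<close>.\<close>

lemma measure_R_ge:
  assumes "0 < \<tau>"
  shows "measure lborel {x\<in>{0..1}. \<tau> \<le> R n (cis (2 * pi * x))} \<le> (\<Prod>j<n. 1 - (a j)\<^sup>2 / 20) / sqrt \<tau>"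
proof -
  have cont: "continuous_on {0..1} (\<lambda>x. Q n (cis (2 * pi * x)))"
    unfolding Q_def by (intro continuous_intros)
  have nn: "0 \<le> Q n (cis (2 * pi * x))" for x
    using sqrt_R_le_Q[of "cis (2 * pi * x)" n] R_pos[of "cis (2 * pi * x)" n] real_sqrt_ge_zero
    by (smt (verit) norm_cis)
  have "measure lborel {x\<in>{0..1}. \<tau> \<le> R n (cis (2 * pi * x))}
      \<le> measure lborel {x\<in>{0..1}. sqrt \<tau> \<le> Q n (cis (2 * pi * x))}"
  proof (rule measure_mono_fmeasurable)
    show "{x \<in> {0..1}. \<tau> \<le> R n (cis (2 * pi * x))} \<subseteq> {x \<in> {0..1}. sqrt \<tau> \<le> Q n (cis (2 * pi * x))}"
      using sqrt_R_le_Q by (auto intro: order_trans[OF real_sqrt_le_mono])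
    have "continuous_on {0..1} (\<lambda>x. R n (cis (2 * pi * x)))"
      unfolding R_def by (intro continuous_intros)
    then show "{x \<in> {0..1}. \<tau> \<le> R n (cis (2 * pi * x))} \<in> sets lborel"
      using compact_superlevel_01 by (auto intro: borel_compact)
    show "{x \<in> {0..1}. sqrt \<tau> \<le> Q n (cis (2 * pi * x))} \<in> fmeasurable lborel"
      by (intro fmeasurable_compact compact_superlevel_01 cont)
  qed
  also have "\<dots> \<le> (\<Prod>j<n. 1 - (a j)\<^sup>2 / 20) / sqrt \<tau>"
    using assms nn by (intro markov_01 cont has_integral_Q) auto
  finally show ?thesis .
qed

lemma ex_measure_R_ge_small:
  assumes "\<not> summable (\<lambda>k. (a k)\<^sup>2)" "0 < \<tau>" "0 < \<eta>"
  obtains n where "measure lborel {x\<in>{0..1}. \<tau> \<le> R n (cis (2 * pi * x))} \<le> \<eta>"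
proof -
  \<comment> \<open>As \<open>1 - x \<le> exp (- x)\<close>, the product of the means is at most the
    exponential of \<open>- 1 / 20\<close> times the partial sum; the threshold makes this at most
    \<open>\<eta> * sqrt \<tau>\<close>.\<close>
  obtain n where n: "- 20 * ln (\<eta> * sqrt \<tau>) \<le> (\<Sum>k<n. (a k)\<^sup>2)"
    using summableI_nonneg_bounded[of "\<lambda>k. (a k)\<^sup>2" "- 20 * ln (\<eta> * sqrt \<tau>)"] assms(1)
    by (metis linorder_le_cases zero_le_power2)
  have "(\<Prod>j<n. 1 - (a j)\<^sup>2 / 20) \<le> (\<Prod>j<n. exp (- (a j)\<^sup>2 / 20))"
  proof (intro prod_mono conjI)
    fix j
    have "(a j)\<^sup>2 \<le> 1\<^sup>2" using a_pos[of j] a_le[of j] by (intro power_mono) auto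
    then show "0 \<le> 1 - (a j)\<^sup>2 / 20" by simp
    show "1 - (a j)\<^sup>2 / 20 \<le> exp (- (a j)\<^sup>2 / 20)"
      using exp_ge_add_one_self[of "- (a j)\<^sup>2 / 20"] by simp
  qed
  also have "\<dots> = exp (- (\<Sum>k<n. (a k)\<^sup>2) / 20)"
    by (simp add: exp_sum[symmetric] sum_divide_distrib sum_negf)
  also have "\<dots> \<le> exp (ln (\<eta> * sqrt \<tau>))" using n by simp
  also have "\<dots> = \<eta> * sqrt \<tau>" using assms by simp
  finally have "(\<Prod>j<n. 1 - (a j)\<^sup>2 / 20) / sqrt \<tau> \<le> \<eta>" using assms by (simp add: field_simps)
  then show ?thesis using that[of n] measure_R_ge[OF \<open>0 < \<tau>\<close>, of n] by linarith
qed

end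

section \<open>Simultaneous approximation\<close>

lemma continuous_on_circle_param:
  fixes f :: "complex \<Rightarrow> 'a::topological_space"
  assumes "continuous_on (cball 0 1) f"
  shows "continuous_on S (\<lambda>x::real. f (cis (2 * pi * x)))"
  by (rule continuous_on_compose2[OF assms]) (auto intro!: continuous_intros)

text \<open>On the interval from \<open>1 / q ^ Suc k\<close> to \<open>1 / q ^ k\<close> the
  integrand is at most \<open>(w (1 / q ^ k))\<^sup>2 * q ^ Suc k\<close> and the length is at most
  \<open>1 / q ^ k\<close>. Summability would thus bound the integral by \<open>q\<close> times the
  sum.\<close>

lemma not_summable_majorant:
  fixes w :: "real \<Rightarrow> real" and q :: nat
  assumes mono: "mono_on {0..1} w" and wpos: "\<And>t. 0 < t \<Longrightarrow> t \<le> 1 \<Longrightarrow> 0 < w t"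
    and int: "(\<integral>\<^sup>+ t\<in>{0<..1}. ennreal ((w t)\<^sup>2 / t) \<partial>lborel) = \<infinity>" and q: "2 \<le> q"
  shows "\<not> summable (\<lambda>k. (w (1 / q ^ k))\<^sup>2)"
proof
  assume sum: "summable (\<lambda>k. (w (1 / q ^ k))\<^sup>2)"
  define c where "c = (\<lambda>k. (w (1 / q ^ k))\<^sup>2 * q ^ Suc k)"
  define I where "I = (\<lambda>k. {1 / real q ^ Suc k <.. 1 / real q ^ k})"
  have q0: "0 < real q" "1 < real q" using q by auto
  have c0: "0 \<le> c k" for k by (simp add: c_def)
  have "(\<integral>\<^sup>+ t\<in>{0<..1}. ennreal ((w t)\<^sup>2 / t) \<partial>lborel)
      \<le> (\<integral>\<^sup>+ t. (\<Sum>k. ennreal (c k) * indicator (I k) t) \<partial>lborel)"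
  proof (rule nn_integral_mono)
    fix t :: real
    show "ennreal ((w t)\<^sup>2 / t) * indicator {0<..1} t \<le> (\<Sum>k. ennreal (c k) * indicator (I k) t)"
    proof (cases "t \<in> {0<..1}")
      case True
      \<comment> \<open>The least such \<open>n\<close> is positive because
        \<open>t \<le> 1\<close>; its predecessor is the index of the interval containing
        \<open>t\<close>.\<close>
      define n where "n = (LEAST n. 1 / real q ^ n < t)"
      have ex: "\<exists>n. 1 / real q ^ n < t"
        using real_arch_pow_inv[of t "1 / real q"] True q0 by (auto simp: power_divide)
      then have n: "1 / real q ^ n < t" unfolding n_def by (rule LeastI_ex)
      then have "n \<noteq> 0" using True by (intro notI) auto
      then obtain k where k: "n = Suc k" using not0_implies_Suc by blast
      then have "\<not> 1 / real q ^ k < t" using not_less_Least[of k "\<lambda>n. 1 / real q ^ n < t"] by (simp add: n_def)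
      then have t: "1 / real q ^ Suc k < t" "t \<le> 1 / real q ^ k" using n by (auto simp: k)
      have "1 / real q ^ k \<in> {0..1}" using q0 by simp
      then have "w t \<le> w (1 / q ^ k)" using True t by (intro mono_onD[OF mono]) auto
      then have w2: "(w t)\<^sup>2 \<le> (w (1 / q ^ k))\<^sup>2" using wpos[of t] True by (intro power_mono) auto
      have "1 / t \<le> q ^ Suc k" using t True q0 by (simp add: field_simps)
      then have "(w t)\<^sup>2 * (1 / t) \<le> c k" unfolding c_def using True
        by (intro mult_mono w2) auto
      then have "ennreal ((w t)\<^sup>2 / t) * indicator {0<..1} t \<le> ennreal (c k) * indicator (I k) t"
        using True t by (simp add: I_def ennreal_leI)
      also have "\<dots> \<le> (\<Sum>k. ennreal (c k) * indicator (I k) t)"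
      proof -
        have "F k \<le> suminf F" for F :: "nat \<Rightarrow> ennreal"
          using sum_le_suminf[of F "{k}"] by auto
        then show ?thesis .
      qed
      finally show ?thesis .
    qed simp
  qed
  also have "\<dots> = (\<Sum>k. ennreal (c k) * emeasure lborel (I k))"
    by (subst nn_integral_suminf) (auto simp: I_def nn_integral_cmult_indicator)
  also have "\<dots> \<le> (\<Sum>k. ennreal (q * (w (1 / q ^ k))\<^sup>2))"
  proof (rule suminf_le)
    fix k
    have "1 / real q ^ Suc k \<le> 1 / real q ^ k"
      using q0 by (intro divide_left_mono power_increasing) auto
    then have "emeasure lborel (I k) = ennreal (1 / real q ^ k - 1 / real q ^ Suc k)" by (simp add: I_def)
    also have "\<dots> \<le> ennreal (1 / real q ^ k)" using q0 by (intro ennreal_leI) auto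
    finally have "ennreal (c k) * emeasure lborel (I k) \<le> ennreal (c k) * ennreal (1 / real q ^ k)"
      by (rule mult_left_mono) simp
    also have "\<dots> = ennreal (q * (w (1 / q ^ k))\<^sup>2)"
      using c0 q0 by (simp add: ennreal_mult[symmetric] c_def)
    finally show "ennreal (c k) * emeasure lborel (I k) \<le> \<dots>" .
  qed auto
  also have "\<dots> < \<infinity>"
    using summable_mult[OF sum, of "real q"] by (simp add: suminf_ennreal2 less_top)
  finally show False using int by simp
qed

lemma majorant_pos: "majorant w \<Longrightarrow> 0 < t \<Longrightarrow> t \<le> 1 \<Longrightarrow> 0 < w t"
  by (auto simp: majorant_def)

lemma majorant_mono: "majorant w \<Longrightarrow> mono_on {0..1} w"
  by (auto simp: majorant_def)

context
  fixes w :: "real \<Rightarrow> real"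
  assumes maj: "majorant w"
    and int: "(\<integral>\<^sup>+ t\<in>{0<..1}. ennreal ((w t)\<^sup>2 / t) \<partial>lborel) = \<infinity>"
begin

text \<open>\<open>q\<close> depends on \<open>\<alpha>\<close> alone and the coefficients on
  \<open>q\<close>, \<open>\<epsilon>\<close> and \<open>w\<close>. The number of factors is chosen
  last, which is possible because the derivative bound is uniform in it.\<close>

lemma ex_Riesz_Herglotz_function:
  assumes "0 < \<epsilon>" "0 < \<tau>" "0 < \<eta>"
  obtains H where "H holomorphic_on UNIV" "H 0 = 1" "\<And>z. norm z \<le> 1 \<Longrightarrow> 0 < Re (H z)"
    "\<And>z. norm z < 1 \<Longrightarrow> (1 - norm z) * norm (deriv H z) \<le> \<epsilon> * w (1 - norm z) * Re (H z)"
    "measure lborel {x\<in>{0..1}. \<tau> \<le> Re (H (cis (2 * pi * x)))} \<le> \<eta>"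
proof -
  obtain \<alpha> where \<alpha>: "0 < \<alpha>" "\<alpha> < 1" and anti: "antimono_on {0<..1} (\<lambda>t. w t / t powr \<alpha>)"
    using maj by (auto simp: majorant_def)
  define q where "q = nat \<lceil>max 200 (4 powr (1 / (1 - \<alpha>)))\<rceil>"
  have qr: "max 200 (4 powr (1 / (1 - \<alpha>))) \<le> real q"
    unfolding q_def by linarith
  then have q: "200 \<le> q" and "4 powr (1 / (1 - \<alpha>)) \<le> real q" by simp_all
  then have "(4 powr (1 / (1 - \<alpha>))) powr (1 - \<alpha>) \<le> real q powr (1 - \<alpha>)"
    using \<alpha> by (intro powr_mono2) auto
  then have q4: "4 \<le> real q powr (1 - \<alpha>)" using \<alpha> by (simp add: powr_powr)
  have w1: "0 < w 1" using majorant_pos[OF maj] by simp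
  \<comment> \<open>The first entry compensates the factor \<open>2 * q\<close> of
    \<open>hyperbolic_derivative_bound\<close>, the second keeps all coefficients below
    1/1000.\<close>
  define \<epsilon>' where "\<epsilon>' = min (\<epsilon> / (2 * q)) (1 / (1000 * w 1))"
  have \<epsilon>': "0 < \<epsilon>'" "2 * q * \<epsilon>' \<le> \<epsilon>" "\<epsilon>' * w 1 \<le> 1 / 1000"
  proof -
    show "0 < \<epsilon>'" using assms q w1 by (simp add: \<epsilon>'_def)
    have "2 * q * \<epsilon>' \<le> 2 * q * (\<epsilon> / (2 * q))" by (intro mult_left_mono) (auto simp: \<epsilon>'_def)
    then show "2 * q * \<epsilon>' \<le> \<epsilon>" using q by simp
    have "\<epsilon>' * w 1 \<le> 1 / (1000 * w 1) * w 1"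
      using w1 by (intro mult_right_mono) (auto simp: \<epsilon>'_def)
    then show "\<epsilon>' * w 1 \<le> 1 / 1000" using w1 by simp
  qed
  define a where "a = (\<lambda>k. \<epsilon>' * w (1 / q ^ k))"
  have qk: "0 < 1 / real q ^ k" "1 / real q ^ k \<le> 1" for k using q by auto
  have a1: "a k \<le> 1 / 1000" for k
  proof -
    have "w (1 / q ^ k) \<le> w 1"
      using qk[of k] by (intro mono_onD[OF majorant_mono[OF maj]]) auto
    then have "\<epsilon>' * w (1 / q ^ k) \<le> \<epsilon>' * w 1" using \<epsilon>'(1) by (intro mult_left_mono) auto
    then show ?thesis using \<epsilon>'(3) unfolding a_def by linarith
  qed
  have a_pos: "0 < a k" for k using \<epsilon>'(1) majorant_pos[OF maj] qk[of k] by (simp add: a_def)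
  interpret riesz_product a q
  proof
    show "a k \<le> 1 / 2" for k using a1[of k] by linarith
  qed (use a_pos q in auto)
  have "\<not> summable (\<lambda>k. (a k)\<^sup>2)"
  proof
    assume "summable (\<lambda>k. (a k)\<^sup>2)"
    then have "summable (\<lambda>k. (w (1 / q ^ k))\<^sup>2)"
      using \<epsilon>'(1) by (simp add: a_def power_mult_distrib summable_cmult_iff)
    then show False
      using not_summable_majorant[OF majorant_mono[OF maj] majorant_pos[OF maj] int, of q] q by simp
  qed
  then obtain n where n: "measure lborel {x\<in>{0..1}. \<tau> \<le> R n (cis (2 * pi * x))} \<le> \<eta>"
    using ex_measure_R_ge_small assms by blast
  show ?thesis
  proof (rule that[of "H n"])
    show "(1 - norm z) * norm (deriv (H n) z) \<le> \<epsilon> * w (1 - norm z) * Re (H n z)" if z: "norm z < 1" for z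
    proof -
      have "(1 - norm z) * norm (deriv (H n) z) \<le> 2 * q * \<epsilon>' * w (1 - norm z) * Re (H n z)"
        by (rule hyperbolic_derivative_bound[OF \<alpha> anti majorant_mono[OF maj] majorant_pos[OF maj] \<epsilon>'(1) _ a1 q q4 z])
           (simp_all add: a_def)
      also have "\<dots> \<le> \<epsilon> * w (1 - norm z) * Re (H n z)"
        using \<epsilon>'(2) majorant_pos[OF maj, of "1 - norm z"] z Re_H_pos[of z n]
        by (intro mult_right_mono) auto
      finally show ?thesis .
    qed
    show "measure lborel {x\<in>{0..1}. \<tau> \<le> Re (H n (cis (2 * pi * x)))} \<le> \<eta>"
      using n by (simp add: Re_H_circle)
  qed (use hol_H Re_H_pos in auto)
qed

text \<open>The quantifier order is the point: \<open>M\<close> is fixed before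
  \<open>\<epsilon>\<close>. Only then can \<open>ex_simultaneous_approximation\<close> select a
  boundary layer in terms of \<open>M\<close> and ask for a small derivative afterwards.\<close>

lemma ex_peak_function:
  assumes "0 < \<eta>"
  obtains M where "\<And>\<epsilon>. 0 < \<epsilon> \<Longrightarrow> \<exists>\<psi>. \<psi> analytic_on cball 0 1 \<and> \<psi> 0 = 1 \<and> (\<forall>z\<in>cball 0 1. norm (\<psi> z) \<le> M)
    \<and> (\<forall>z\<in>ball 0 1. (1 - norm z) * norm (deriv \<psi> z) \<le> \<epsilon> * w (1 - norm z))
    \<and> measure lborel {x\<in>{0..1}. \<eta> \<le> norm (\<psi> (cis (2 * pi * x)))} \<le> \<eta>"
proof -
  define l where "l = min (\<eta> / 4) 1"
  have l: "0 < l" "l \<le> 1" "4 * l \<le> \<eta>" using assms by (auto simp: l_def)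
  \<comment> \<open>Off the exceptional set \<open>l * norm h < 3\<close> will hold for the value
    \<open>h\<close> of \<open>H\<close>; the constant 144 then yields
    \<open>\<kappa> * (norm h)\<^sup>2 \<le> 1 / 16\<close> and
    \<open>\<kappa> * norm h \<le> 1 / 48\<close>.\<close>
  define \<kappa> where "\<kappa> = l\<^sup>2 / 144"
  have \<kappa>: "0 < \<kappa>" using l by (simp add: \<kappa>_def)
  define K where "K = 2 * \<bar>ln \<eta>\<bar> + 1"
  have K: "0 < K" "exp (- (K / 2)) < \<eta>"
  proof -
    have "- (K / 2) < ln \<eta>" by (cases "0 \<le> ln \<eta>") (simp_all add: K_def field_simps)
    then have "exp (- (K / 2)) < exp (ln \<eta>)" by (simp only: exp_less_mono)
    then show "exp (- (K / 2)) < \<eta>" using assms by simp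
  qed (simp add: K_def)
  \<comment> \<open>The quotient equals
    \<open>1 / \<kappa> - (1 / \<kappa> + 1) / (1 + \<kappa> H)\<close>, and its denominator has
    modulus at least 1 since \<open>Re H > 0\<close>; hence the bound
    \<open>2 / \<kappa> + 1\<close>.\<close>
  define M where "M = exp (K * (2 / \<kappa> + 1))"
  have M: "0 < M" by (simp add: M_def)
  show ?thesis
  proof (rule that[of M])
    fix \<epsilon> :: real assume "0 < \<epsilon>"
    \<comment> \<open>The derivative of \<open>\<psi>\<close> costs
      \<open>M * K * (1 + \<kappa>)\<close>, and removing the weight \<open>Re H\<close> costs
      another \<open>1 / \<kappa>\<close>.\<close>
    define \<epsilon>' where "\<epsilon>' = \<epsilon> * \<kappa> / (M * K * (1 + \<kappa>))"
    have \<epsilon>': "0 < \<epsilon>'" using \<open>0 < \<epsilon>\<close> \<kappa> K M by (simp add: \<epsilon>'_def)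
    obtain H where H: "H holomorphic_on UNIV" "H 0 = 1" "\<And>z. norm z \<le> 1 \<Longrightarrow> 0 < Re (H z)"
      "\<And>z. norm z < 1 \<Longrightarrow> (1 - norm z) * norm (deriv H z) \<le> \<epsilon>' * w (1 - norm z) * Re (H z)"
      and Hm: "measure lborel {x\<in>{0..1}. 1 / 4 \<le> Re (H (cis (2 * pi * x)))} \<le> \<eta> / 2"
      using ex_Riesz_Herglotz_function[of \<epsilon>' "1 / 4" "\<eta> / 2"] \<epsilon>' assms by auto
    have an: "H analytic_on S" for S
      using H(1) analytic_on_open analytic_on_subset by blast
    have contH: "continuous_on S H" for S
      using H(1) holomorphic_on_imp_continuous_on continuous_on_subset by blast
    have Re_den: "1 \<le> Re (1 + of_real c * H z)" if "norm z \<le> 1" "0 \<le> c" for c z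
      using H(3)[of z] that by simp
    have den: "1 \<le> norm (1 + of_real c * H z)" if "norm z \<le> 1" "0 \<le> c" for c z
      using Re_den[OF that] complex_Re_le_cmod order_trans by blast
    have den0: "1 + of_real c * H z \<noteq> 0" if "norm z \<le> 1" "0 \<le> c" for c z
      using den[OF that] by auto
    define g where "g = (\<lambda>z. (H z - 1) / (1 + of_real \<kappa> * H z))"
    define \<psi> where "\<psi> = (\<lambda>z. exp (of_real K * g z))"
    have "g analytic_on cball 0 1"
      unfolding g_def using \<kappa> den0 by (intro analytic_intros an) auto
    then have an\<psi>: "\<psi> analytic_on cball 0 1"
      unfolding \<psi>_def by (intro analytic_intros)
    have \<psi>M: "norm (\<psi> z) \<le> M" if z: "z \<in> cball 0 1" for z
    proof -
      let ?d = "1 + of_real \<kappa> * H z"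
      have d: "1 \<le> norm ?d" "?d \<noteq> 0" using den[of z \<kappa>] den0[of z \<kappa>] z \<kappa> by auto
      have "H z - 1 = of_real (1 / \<kappa>) * ?d - of_real (1 / \<kappa> + 1)"
        using \<kappa> by (simp add: field_simps)
      then have "g z = (of_real (1 / \<kappa>) * ?d - of_real (1 / \<kappa> + 1)) / ?d"
        by (simp only: g_def)
      also have "\<dots> = of_real (1 / \<kappa>) - of_real (1 / \<kappa> + 1) / ?d"
        using d(2) by (simp only: diff_divide_distrib nonzero_mult_div_cancel_right not_False_eq_True)
      also have "norm \<dots> \<le> norm (complex_of_real (1 / \<kappa>)) + norm (of_real (1 / \<kappa> + 1) / ?d)" by (rule norm_triangle_ineq4)
      also have "norm (of_real (1 / \<kappa> + 1) / ?d) = (1 / \<kappa> + 1) / norm ?d"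
        using \<kappa> unfolding norm_divide norm_of_real by simp
      also have "\<dots> \<le> (1 / \<kappa> + 1) / 1"
        using d(1) \<kappa> by (intro divide_left_mono) (auto intro: add_nonneg_nonneg)
      also have "norm (complex_of_real (1 / \<kappa>)) = 1 / \<kappa>" using \<kappa> unfolding norm_of_real by simp
      finally have "norm (g z) \<le> 2 / \<kappa> + 1" by simp
      then have "Re (g z) \<le> 2 / \<kappa> + 1" using complex_Re_le_cmod[of "g z"] by linarith
      then show ?thesis using K by (simp add: \<psi>_def M_def)
    qed
    have d\<psi>: "(1 - norm z) * norm (deriv \<psi> z) \<le> \<epsilon> * w (1 - norm z)" if "z \<in> ball 0 1" for z
    proof -
      have z: "norm z < 1" using that by simp
      let ?d = "1 + of_real \<kappa> * H z"
      have d: "1 \<le> norm ?d" "?d \<noteq> 0" using den[of z \<kappa>] den0[of z \<kappa>] z \<kappa> by auto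
      have dH: "(H has_field_derivative deriv H z) (at z)"
        by (rule holomorphic_derivI[OF H(1) open_UNIV]) simp
      have "(g has_field_derivative (deriv H z * ?d - (H z - 1) * (of_real \<kappa> * deriv H z)) / (?d * ?d)) (at z)"
        unfolding g_def using d(2) by (auto intro!: derivative_eq_intros dH)
      also have "deriv H z * ?d - (H z - 1) * (of_real \<kappa> * deriv H z) = of_real (1 + \<kappa>) * deriv H z"
        by (simp add: algebra_simps)
      finally have dg: "(g has_field_derivative (of_real (1 + \<kappa>) * deriv H z) / (?d * ?d)) (at z)" .
      have "(\<psi> has_field_derivative \<psi> z * (of_real K * ((of_real (1 + \<kappa>) * deriv H z) / (?d * ?d)))) (at z)"
        unfolding \<psi>_def by (auto intro!: derivative_eq_intros dg)
      then have "norm (deriv \<psi> z) = norm (\<psi> z) * (K * ((1 + \<kappa>) * norm (deriv H z) / (norm ?d * norm ?d)))"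
      proof -
        have "norm (1 + complex_of_real \<kappa>) = 1 + \<kappa>"
          using \<kappa> by (metis abs_of_pos add_pos_pos norm_of_real of_real_1 of_real_add zero_less_one)
        then show ?thesis
          using K \<open>(\<psi> has_field_derivative _) _\<close> by (simp add: DERIV_imp_deriv norm_mult norm_divide)
      qed
      also have "\<dots> \<le> M * (K * ((1 + \<kappa>) * norm (deriv H z) / (norm ?d * norm ?d)))"
        using \<psi>M[of z] z K \<kappa> by (intro mult_right_mono) auto
      finally have "(1 - norm z) * norm (deriv \<psi> z)
          \<le> (1 - norm z) * (M * (K * ((1 + \<kappa>) * norm (deriv H z) / (norm ?d * norm ?d))))"
        using z by (intro mult_left_mono) auto
      also have "\<dots> = (M * K * (1 + \<kappa>)) * (((1 - norm z) * norm (deriv H z)) / (norm ?d * norm ?d))"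
        by (simp add: mult_ac)
      also have "\<dots> \<le> (M * K * (1 + \<kappa>)) * ((\<epsilon>' * w (1 - norm z) * Re (H z)) / (norm ?d * norm ?d))"
        using H(4)[OF z] M K \<kappa> by (intro mult_left_mono divide_right_mono) auto
      also have "\<dots> = (M * K * (1 + \<kappa>)) * (\<epsilon>' * w (1 - norm z)) * (Re (H z) / (norm ?d * norm ?d))"
        by simp
      \<comment> \<open>The weight disappears here: \<open>norm ?d\<close> is at least 1 and at
        least \<open>\<kappa> * Re (H z)\<close>, so its square dominates
        \<open>\<kappa> * Re (H z)\<close>.\<close>
      also have "\<dots> \<le> (M * K * (1 + \<kappa>)) * (\<epsilon>' * w (1 - norm z)) * (1 / \<kappa>)"
      proof (rule mult_left_mono)
        have "1 + \<kappa> * Re (H z) \<le> norm ?d" using complex_Re_le_cmod[of ?d] by simp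
        moreover have "0 < \<kappa> * Re (H z)" using \<kappa> H(3)[of z] z by simp
        ultimately have "\<kappa> * Re (H z) * 1 \<le> norm ?d * norm ?d" by (intro mult_mono) auto
        then show "Re (H z) / (norm ?d * norm ?d) \<le> 1 / \<kappa>"
          using \<kappa> d by (simp add: field_simps)
      qed (use M K \<kappa> \<epsilon>' majorant_pos[OF maj, of "1 - norm z"] z in auto)
      also have "\<dots> = \<epsilon> * w (1 - norm z)"
      proof -
        have "X * (\<epsilon> * \<kappa> / X * W) * (1 / \<kappa>) = \<epsilon> * W" if "X \<noteq> 0" for X W
          using that \<kappa> by simp
        moreover have "M * K * (1 + \<kappa>) \<noteq> 0" using M K \<kappa> by simp
        ultimately show ?thesis unfolding \<epsilon>'_def by blast
      qed
      finally show ?thesis .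
    qed
    \<comment> \<open>A weak-type bound for the modulus of \<open>H\<close>, imaginary part
      included. \<open>u\<close> is nonnegative and has mean \<open>l / (1 + l)\<close>; where
      \<open>u < 1 / 2\<close>, the modulus of \<open>1 + l H\<close> is below 2.\<close>
    define u where "u = (\<lambda>x. 1 - Re (1 / (1 + of_real l * H (cis (2 * pi * x)))))"
    have contu: "continuous_on {0..1} u"
      unfolding u_def using den0 l by (auto intro!: continuous_intros continuous_on_circle_param contH)
    have u0: "0 \<le> u x" for x
    proof -
      have "1 \<le> norm (1 + of_real l * H (cis (2 * pi * x)))" using den l by simp
      then have "norm (1 / (1 + of_real l * H (cis (2 * pi * x)))) \<le> 1"
        by (simp add: norm_divide divide_le_eq_1)
      then show ?thesis unfolding u_def using complex_Re_le_cmod order_trans by (smt (verit))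
    qed
    have "(\<lambda>z. 1 / (1 + of_real l * H z)) analytic_on cball 0 1"
      using den0 l by (intro analytic_intros an) auto
    then have "((\<lambda>x. 1 / (1 + of_real l * H (cis (2 * pi * x)))) has_integral 1 / (1 + of_real l * H 0)) {0..1}"
      by (intro mean_value_circle analytic_imp_holomorphic[OF analytic_on_subset]
            holomorphic_on_imp_continuous_on[OF analytic_imp_holomorphic]) auto
    then have "((\<lambda>x. Re (1 / (1 + of_real l * H (cis (2 * pi * x))))) has_integral Re (1 / (1 + of_real l * H 0))) {0..1}"
      by (rule has_integral_Re)
    then have "(u has_integral 1 - Re (1 / (1 + of_real l * H 0))) {0..1}"
      unfolding u_def using has_integral_const_real[of "1::real" 0 1] by (intro has_integral_diff) auto
    also have "1 - Re (1 / (1 + of_real l * H 0)) = l / (1 + l)"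
    proof -
      have "1 / (1 + of_real l * H 0) = complex_of_real (1 / (1 + l))" by (simp add: H(2))
      then show ?thesis using l by (simp only: Re_complex_of_real) (simp add: field_simps)
    qed
    finally have intu: "(u has_integral l / (1 + l)) {0..1}" .
    define B1 where "B1 = {x\<in>{0..1}. 1 / 4 \<le> Re (H (cis (2 * pi * x)))}"
    define B2 where "B2 = {x\<in>{0..1}. 1 / 2 \<le> u x}"
    have cB1: "compact B1" unfolding B1_def
      by (intro compact_superlevel_01 continuous_on_Re continuous_on_circle_param contH)
    have cB2: "compact B2" unfolding B2_def by (intro compact_superlevel_01 contu)
    have "measure lborel B2 \<le> (l / (1 + l)) / (1 / 2)"
      unfolding B2_def by (rule markov_01[OF contu u0 _ intu]) auto
    also have "\<dots> \<le> \<eta> / 2"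
    proof -
      have "l / (1 + l) \<le> l / 1" using l by (intro divide_left_mono) auto
      then show ?thesis using l(3) by simp
    qed
    finally have B2m: "measure lborel B2 \<le> \<eta> / 2" .
    \<comment> \<open>Off \<open>B1\<close> and \<open>B2\<close> the numerator of
      \<open>Re g\<close> is at most \<open>1 / 4 - 1 + 1 / 16 = - 11 / 16\<close>, and the
      denominator differs from 1 by little, so \<open>Re g \<le> - 1 / 2\<close>; \<open>K\<close>
      was chosen for this value.\<close>
    have small: "norm (\<psi> (cis (2 * pi * x))) < \<eta>" if x: "x \<in> {0..1}" "x \<notin> B1" "x \<notin> B2" for x
    proof -
      define h where "h = H (cis (2 * pi * x))"
      define d where "d = 1 + of_real \<kappa> * h"
      have R: "0 < Re h" "Re h < 1 / 4" using x H(3)[of "cis (2 * pi * x)"] by (auto simp: B1_def h_def)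
      have "1 / 2 < Re (1 / (1 + of_real l * h))" using x by (simp add: B2_def u_def h_def)
      also have "\<dots> \<le> 1 / norm (1 + of_real l * h)"
        using complex_Re_le_cmod[of "1 / (1 + of_real l * h)"] by (simp add: norm_divide)
      finally have "norm (1 + of_real l * h) < 2"
        by (cases "norm (1 + of_real l * h) = 0") (simp_all add: field_simps)
      moreover have "norm (of_real l * h) \<le> norm (1 + of_real l * h) + 1"
        using norm_triangle_ineq4[of "1 + of_real l * h" 1] by simp
      ultimately have lh: "l * norm h < 3" using l by (simp add: norm_mult)
      then have "(l * norm h) * (l * norm h) \<le> 3 * 3" using l by (intro mult_mono) auto
      then have kh2: "\<kappa> * (norm h)\<^sup>2 \<le> 1 / 16" by (simp add: \<kappa>_def power2_eq_square field_simps)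
      have "l * (l * norm h) \<le> 1 * 3" using l lh by (intro mult_mono) auto
      then have kh: "\<kappa> * norm h \<le> 1 / 48" by (simp add: \<kappa>_def power2_eq_square)
      have d1: "1 \<le> norm d" "d \<noteq> 0" using den[of "cis (2 * pi * x)" \<kappa>] \<kappa> by (auto simp: d_def h_def)
      have "norm d \<le> 1 + \<kappa> * norm h" using norm_triangle_ineq[of 1 "of_real \<kappa> * h"] \<kappa> by (simp add: d_def norm_mult)
      then have "norm d \<le> 49 / 48" using kh by linarith
      then have dle: "(norm d)\<^sup>2 \<le> (49 / 48)\<^sup>2" by (intro power_mono) auto
      have Reg: "Re (g (cis (2 * pi * x))) = (Re h - 1 + \<kappa> * (norm h)\<^sup>2 - \<kappa> * Re h) / (norm d)\<^sup>2"
      proof -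
        have "Re (g (cis (2 * pi * x))) = Re ((h - 1) / d)" by (simp add: g_def h_def d_def)
        also have "\<dots> = Re ((h - 1) * cnj d) / (norm d)\<^sup>2" by (simp add: complex_div_cnj[of "h - 1" d] del: cnj.simps complex_cnj_mult flip: of_real_power)
        also have "Re ((h - 1) * cnj d) = Re h - 1 + \<kappa> * (norm h)\<^sup>2 - \<kappa> * Re h"
          unfolding cmod_power2 by (simp add: d_def algebra_simps power2_eq_square)
        finally show ?thesis .
      qed
      also have "\<dots> \<le> (- 11 / 16) / (norm d)\<^sup>2"
      proof (rule divide_right_mono)
        have "0 < \<kappa> * Re h" using \<kappa> R by simp
        then show "Re h - 1 + \<kappa> * (norm h)\<^sup>2 - \<kappa> * Re h \<le> - 11 / 16" using R kh2 by linarith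
      qed simp
      also have "\<dots> \<le> - 1 / 2"
        using d1 dle by (simp add: field_simps power2_eq_square)
      finally have "Re (g (cis (2 * pi * x))) \<le> - 1 / 2" .
      then have "K * Re (g (cis (2 * pi * x))) \<le> K * (- 1 / 2)" using K by (intro mult_left_mono) auto
      then have "norm (\<psi> (cis (2 * pi * x))) \<le> exp (- (K / 2))" by (simp add: \<psi>_def)
      then show ?thesis using K by linarith
    qed
    have "measure lborel {x\<in>{0..1}. \<eta> \<le> norm (\<psi> (cis (2 * pi * x)))} \<le> measure lborel (B1 \<union> B2)"
    proof (rule measure_mono_fmeasurable)
      show "{x\<in>{0..1}. \<eta> \<le> norm (\<psi> (cis (2 * pi * x)))} \<subseteq> B1 \<union> B2" using small by force
      have "continuous_on (cball 0 1) \<psi>"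
        using an\<psi> by (intro holomorphic_on_imp_continuous_on analytic_imp_holomorphic)
      then have "compact {x\<in>{0..1}. \<eta> \<le> norm (\<psi> (cis (2 * pi * x)))}"
        by (intro compact_superlevel_01 continuous_on_norm continuous_on_circle_param)
      then show "{x\<in>{0..1}. \<eta> \<le> norm (\<psi> (cis (2 * pi * x)))} \<in> sets lborel" by (simp add: borel_compact)
      show "B1 \<union> B2 \<in> fmeasurable lborel" by (intro fmeasurable_compact compact_Un cB1 cB2)
    qed
    also have "\<dots> \<le> measure lborel B1 + measure lborel B2"
      by (intro measure_Un_le) (simp_all add: cB1 cB2 borel_compact)
    also have "\<dots> \<le> \<eta>" using B2m Hm by (simp add: B1_def)
    finally have "measure lborel {x\<in>{0..1}. \<eta> \<le> norm (\<psi> (cis (2 * pi * x)))} \<le> \<eta>" .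
    moreover have "\<psi> 0 = 1" by (simp add: \<psi>_def g_def H(2))
    ultimately show "\<exists>\<psi>. \<psi> analytic_on cball 0 1 \<and> \<psi> 0 = 1 \<and> (\<forall>z\<in>cball 0 1. norm (\<psi> z) \<le> M)
      \<and> (\<forall>z\<in>ball 0 1. (1 - norm z) * norm (deriv \<psi> z) \<le> \<epsilon> * w (1 - norm z))
      \<and> measure lborel {x\<in>{0..1}. \<eta> \<le> norm (\<psi> (cis (2 * pi * x)))} \<le> \<eta>"
      using an\<psi> \<psi>M d\<psi> by blast
  qed
qed

end

section \<open>Functions analytic past the closed disc, and growth of majorants\<close>

lemma analytic_cball_holomorphic: "F analytic_on cball 0 1 \<Longrightarrow> F holomorphic_on ball 0 1"
  by (rule analytic_imp_holomorphic, erule analytic_on_subset) auto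

lemma analytic_cball_continuous: "F analytic_on cball 0 1 \<Longrightarrow> continuous_on (cball 0 1) F"
  by (intro holomorphic_on_imp_continuous_on analytic_imp_holomorphic)

lemma analytic_cball_bounded:
  assumes "F analytic_on cball 0 1"
  obtains B where "1 \<le> B" "\<And>z. z \<in> cball 0 1 \<Longrightarrow> norm (F z) \<le> B" "\<And>z. z \<in> cball 0 1 \<Longrightarrow> norm (deriv F z) \<le> B"
proof -
  have *: "\<exists>B. \<forall>z\<in>cball 0 1. norm (G z) \<le> B" if "G analytic_on cball 0 1" for G :: "complex \<Rightarrow> complex"
  proof -
    have "continuous_on (cball 0 1) G" using that by (rule analytic_cball_continuous)
    then have "bounded (G ` cball 0 1)" by (intro compact_imp_bounded compact_continuous_image) auto
    then show ?thesis by (auto simp: bounded_iff)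
  qed
  obtain B1 where B1: "\<forall>z\<in>cball 0 1. norm (F z) \<le> B1" using *[OF assms] by blast
  obtain B2 where B2: "\<forall>z\<in>cball 0 1. norm (deriv F z) \<le> B2" using *[OF analytic_deriv[OF assms]] by blast
  show ?thesis
    by (rule that[of "max 1 (max B1 B2)"]) (use B1 B2 in \<open>auto simp: le_max_iff_disj\<close>)
qed

text \<open>\<open>t / w t\<close> is the product of the increasing functions
  \<open>t powr (1 - \<alpha>)\<close> and \<open>t powr \<alpha> / w t\<close>. It lets a dilation
  pass through the Bloch weight.\<close>

lemma majorant_quotient_mono:
  assumes maj: "majorant w" and st: "0 < s" "s \<le> t" "t \<le> 1"
  shows "s / w s \<le> t / w t"
proof -
  obtain \<alpha> where \<alpha>: "0 < \<alpha>" "\<alpha> < 1" and anti: "antimono_on {0<..1} (\<lambda>t. w t / t powr \<alpha>)"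
    using maj by (auto simp: majorant_def)
  have pos: "0 < w s" "0 < w t" using st by (auto intro!: majorant_pos[OF maj])
  have "w t / t powr \<alpha> \<le> w s / s powr \<alpha>" using st by (intro monotone_onD[OF anti]) auto
  then have 1: "s powr \<alpha> / w s \<le> t powr \<alpha> / w t" using pos st by (simp add: field_simps)
  have 2: "s powr (1 - \<alpha>) \<le> t powr (1 - \<alpha>)" using st \<alpha> by (intro powr_mono2) auto
  have eq: "u powr (1 - \<alpha>) * (u powr \<alpha> / w u) = u / w u" if "0 < u" for u
    using that by (simp flip: powr_add)
  have "s powr (1 - \<alpha>) * (s powr \<alpha> / w s) \<le> t powr (1 - \<alpha>) * (t powr \<alpha> / w t)"
    using 1 2 pos by (intro mult_mono) auto
  then show ?thesis unfolding eq[OF st(1)] eq[OF less_le_trans[OF st(1,2)]] .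
qed

text \<open>By antimonotonicity \<open>w t \<ge> w 1 * t powr \<alpha>\<close>, so \<open>t\<close>
  is negligible against \<open>w t\<close> near 0; \<open>\<rho>\<close> solves
  \<open>t powr (1 - \<alpha>) = \<sigma> * w 1\<close>, truncated at 1.\<close>

lemma majorant_dominates_identity:
  assumes maj: "majorant w" and "0 < \<sigma>"
  obtains \<rho> where "0 < \<rho>" "\<rho> \<le> 1" "\<And>t. 0 < t \<Longrightarrow> t < \<rho> \<Longrightarrow> t \<le> \<sigma> * w t"
proof -
  obtain \<alpha> where \<alpha>: "0 < \<alpha>" "\<alpha> < 1" and anti: "antimono_on {0<..1} (\<lambda>t. w t / t powr \<alpha>)"
    using maj by (auto simp: majorant_def)
  have w1: "0 < w 1" using majorant_pos[OF maj] by simp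
  define \<rho> where "\<rho> = min 1 ((\<sigma> * w 1) powr (1 / (1 - \<alpha>)))"
  show ?thesis
  proof (rule that[of \<rho>])
    fix t assume t: "0 < t" "t < \<rho>"
    then have "t powr (1 - \<alpha>) \<le> ((\<sigma> * w 1) powr (1 / (1 - \<alpha>))) powr (1 - \<alpha>)"
      using \<alpha> by (intro powr_mono2) (auto simp: \<rho>_def)
    also have "\<dots> = \<sigma> * w 1" using \<alpha> w1 assms by (simp add: powr_powr)
    finally have 1: "t powr (1 - \<alpha>) \<le> \<sigma> * w 1" .
    have "w 1 / 1 powr \<alpha> \<le> w t / t powr \<alpha>" using t by (intro monotone_onD[OF anti]) (auto simp: \<rho>_def)
    then have 2: "w 1 * t powr \<alpha> \<le> w t" using t by (simp add: field_simps)
    have "t = t powr (1 - \<alpha>) * t powr \<alpha>" using t by (simp flip: powr_add)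
    also have "\<dots> \<le> (\<sigma> * w 1) * t powr \<alpha>" using 1 by (intro mult_right_mono) auto
    also have "\<dots> \<le> \<sigma> * w t" using 2 assms by (simp add: mult.assoc)
    finally show "t \<le> \<sigma> * w t" .
  next
    have "\<sigma> * w 1 \<noteq> 0" using w1 \<open>0 < \<sigma>\<close> by simp
    then have "0 < (\<sigma> * w 1) powr (1 / (1 - \<alpha>))" by simp
    then show "0 < \<rho>" by (simp add: \<rho>_def)
    show "\<rho> \<le> 1" unfolding \<rho>_def by (rule min.cobounded1)
  qed
qed

lemma norm_diff_le_deriv_bound:
  assumes f: "f holomorphic_on ball 0 1" and z: "norm z < 1"
    and B: "\<And>u. norm u \<le> norm z \<Longrightarrow> norm (deriv f u) \<le> B"
  shows "norm (f z - f 0) \<le> B"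
proof -
  have "norm (f z - f 0) \<le> B * norm (z - 0)"
  proof (rule field_differentiable_bound[of "cball 0 (norm z)" f "deriv f"])
    show "(f has_field_derivative deriv f u) (at u within cball 0 (norm z))" if "u \<in> cball 0 (norm z)" for u
      by (rule has_field_derivative_at_within, rule holomorphic_derivI[OF f open_ball]) (use that z in auto)
  qed (use B in auto)
  also have "\<dots> \<le> B * 1"
    using z order_trans[OF norm_ge_zero B[of 0]] by (intro mult_left_mono) auto
  finally show ?thesis by simp
qed

text \<open>For \<open>p = h * (1 - \<psi>)\<close> the error \<open>p - h\<close> is
  \<open>- h * \<psi>\<close>, small where \<open>\<psi>\<close> is. In
  \<open>p' = h' * (1 - \<psi>) - h * \<psi>'\<close> the last term inherits the small seminorm of
  \<open>\<psi>\<close>; the first one needs a split of the disc.\<close>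

lemma ex_simultaneous_approximation:
  fixes w :: "real \<Rightarrow> real"
  assumes maj: "majorant w"
    and int: "(\<integral>\<^sup>+ t\<in>{0<..1}. ennreal ((w t)\<^sup>2 / t) \<partial>lborel) = \<infinity>"
    and h: "h analytic_on cball 0 1" and "0 < \<epsilon>"
  obtains p where "p analytic_on cball 0 1" "p 0 = 0"
    "\<And>z. z \<in> ball 0 1 \<Longrightarrow> (1 - norm z) * norm (deriv p z) \<le> \<epsilon> * w (1 - norm z)"
    "measure lborel {x\<in>{0..1}. \<epsilon> \<le> norm (p (cis (2 * pi * x)) - h (cis (2 * pi * x)))} \<le> \<epsilon>"
proof -
  note wpos = majorant_pos[OF maj] and wmono = majorant_mono[OF maj]
  obtain B where B: "1 \<le> B" "\<And>z. z \<in> cball 0 1 \<Longrightarrow> norm (h z) \<le> B" "\<And>z. z \<in> cball 0 1 \<Longrightarrow> norm (deriv h z) \<le> B"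
    using analytic_cball_bounded[OF h] by blast
  define \<eta> where "\<eta> = \<epsilon> / B"
  have \<eta>: "0 < \<eta>" "\<eta> \<le> \<epsilon>" "\<eta> * B = \<epsilon>"
    using \<open>0 < \<epsilon>\<close> B(1) by (auto simp: \<eta>_def field_simps)
  obtain M where M: "\<And>\<epsilon>. 0 < \<epsilon> \<Longrightarrow> \<exists>\<psi>. \<psi> analytic_on cball 0 1 \<and> \<psi> 0 = 1 \<and> (\<forall>z\<in>cball 0 1. norm (\<psi> z) \<le> M)
    \<and> (\<forall>z\<in>ball 0 1. (1 - norm z) * norm (deriv \<psi> z) \<le> \<epsilon> * w (1 - norm z))
    \<and> measure lborel {x\<in>{0..1}. \<eta> \<le> norm (\<psi> (cis (2 * pi * x)))} \<le> \<eta>"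
    using ex_peak_function[OF maj int \<open>0 < \<eta>\<close>] by blast
  have M0: "0 \<le> M"
  proof -
    obtain \<psi> :: "complex \<Rightarrow> complex" where "\<forall>z\<in>cball 0 1. norm (\<psi> z) \<le> M"
      using M[of 1] by auto
    then have "norm (\<psi> 0) \<le> M" by simp
    then show ?thesis using norm_ge_zero[of "\<psi> 0"] by linarith
  qed
  obtain \<rho> where \<rho>: "0 < \<rho>" "\<rho> \<le> 1" "\<And>t. 0 < t \<Longrightarrow> t < \<rho> \<Longrightarrow> t \<le> \<epsilon> / (2 * B * (1 + M)) * w t"
    using majorant_dominates_identity[OF maj, of "\<epsilon> / (2 * B * (1 + M))"] \<open>0 < \<epsilon>\<close> B(1) M0 by auto
  have w\<rho>: "0 < w \<rho>" and w1: "0 < w 1" using wpos \<rho> by auto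
  \<comment> \<open>The first entry serves the term with the derivative of \<open>\<psi>\<close>;
    the second makes \<open>1 - \<psi>\<close> small on the disc of radius
    \<open>1 - \<rho>\<close>, where integrating the derivative costs
    \<open>w 1 / \<rho>\<close>.\<close>
  define \<epsilon>1 where "\<epsilon>1 = min (\<epsilon> / (2 * B)) (\<epsilon> * w \<rho> * \<rho> / (2 * B * w 1))"
  have \<epsilon>1: "0 < \<epsilon>1" using \<open>0 < \<epsilon>\<close> B(1) w\<rho> w1 \<rho> by (simp add: \<epsilon>1_def)
  obtain \<psi> where \<psi>: "\<psi> analytic_on cball 0 1" "\<psi> 0 = 1" "\<And>z. z \<in> cball 0 1 \<Longrightarrow> norm (\<psi> z) \<le> M"
    "\<And>z. z \<in> ball 0 1 \<Longrightarrow> (1 - norm z) * norm (deriv \<psi> z) \<le> \<epsilon>1 * w (1 - norm z)"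
    and \<psi>m: "measure lborel {x\<in>{0..1}. \<eta> \<le> norm (\<psi> (cis (2 * pi * x)))} \<le> \<eta>"
    using M[OF \<epsilon>1] by blast
  define p where "p = (\<lambda>z. h z * (1 - \<psi> z))"
  have anp: "p analytic_on cball 0 1" unfolding p_def by (intro analytic_intros h \<psi>)
  have deriv_p: "deriv p z = deriv h z * (1 - \<psi> z) - deriv \<psi> z * h z" if z: "z \<in> ball 0 1" for z
  proof -
    have "h holomorphic_on ball 0 1" "\<psi> holomorphic_on ball 0 1"
      using h \<psi>(1) by (simp_all add: analytic_cball_holomorphic)
    then have "(h has_field_derivative deriv h z) (at z)" "(\<psi> has_field_derivative deriv \<psi> z) (at z)"
      using z by (simp_all add: holomorphic_derivI[OF _ open_ball])
    then have "(p has_field_derivative (deriv h z * (1 - \<psi> z) - deriv \<psi> z * h z)) (at z)"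
      unfolding p_def by (auto intro!: derivative_eq_intros)
    then show ?thesis by (rule DERIV_imp_deriv)
  qed
  have bound: "(1 - norm z) * norm (deriv p z) \<le> \<epsilon> * w (1 - norm z)" if z: "z \<in> ball 0 1" for z
  proof -
    define t where "t = 1 - norm z"
    have t: "0 < t" "t \<le> 1" using z by (auto simp: t_def)
    have wt: "0 < w t" using wpos t by blast
    have hz: "norm (h z) \<le> B" "norm (deriv h z) \<le> B" using B(2,3)[of z] z by auto
    have "t * (norm (deriv \<psi> z) * norm (h z)) \<le> (\<epsilon>1 * w t) * B"
      using mult_mono[OF \<psi>(4)[OF z] hz(1)] \<epsilon>1 wt by (simp add: t_def mult.assoc)
    also have "\<dots> \<le> (\<epsilon> / (2 * B) * w t) * B"
      using B(1) wt by (intro mult_right_mono) (auto simp: \<epsilon>1_def)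
    also have "\<dots> = \<epsilon> / 2 * w t" using B(1) by simp
    finally have 1: "t * (norm (deriv \<psi> z) * norm (h z)) \<le> \<epsilon> / 2 * w t" .
    \<comment> \<open>Near the circle only \<open>norm (1 - \<psi> z) \<le> 1 + M\<close> is used,
      against the smallness of \<open>t\<close> relative to \<open>w t\<close>. Farther inside,
      \<open>\<psi>\<close> is close to its value 1 at the origin.\<close>
    have 2: "t * (B * norm (1 - \<psi> z)) \<le> \<epsilon> / 2 * w t"
    proof (cases "t < \<rho>")
      case True
      have "norm (1 - \<psi> z) \<le> 1 + M"
        using norm_triangle_ineq4[of 1 "\<psi> z"] \<psi>(3)[of z] z by auto
      then have "t * (B * norm (1 - \<psi> z)) \<le> (\<epsilon> / (2 * B * (1 + M)) * w t) * (B * (1 + M))"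
        using \<rho>(3)[OF t(1) True] B(1) M0 wt t \<open>0 < \<epsilon>\<close> by (intro mult_mono) auto
      also have "\<dots> = \<epsilon> / 2 * w t"
      proof -
        have "\<epsilon> / (2 * B * X) * W * (B * X) = \<epsilon> / 2 * W" if "X \<noteq> 0" for X W
          using that B(1) by simp
        moreover have "1 + M \<noteq> 0" using M0 by simp
        ultimately show ?thesis by blast
      qed
      finally show ?thesis .
    next
      case False
      have "norm (\<psi> z - \<psi> 0) \<le> \<epsilon>1 * w 1 / \<rho>"
      proof (rule norm_diff_le_deriv_bound)
        show "\<psi> holomorphic_on ball 0 1" using \<psi>(1) by (rule analytic_cball_holomorphic)
        fix u :: complex assume u: "norm u \<le> norm z"
        then have u1: "u \<in> ball 0 1" "\<rho> \<le> 1 - norm u" using z False by (auto simp: t_def)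
        have "\<rho> * norm (deriv \<psi> u) \<le> (1 - norm u) * norm (deriv \<psi> u)" using u1 by (intro mult_right_mono) auto
        also have "\<dots> \<le> \<epsilon>1 * w (1 - norm u)" by (rule \<psi>(4)[OF u1(1)])
        also have "\<dots> \<le> \<epsilon>1 * w 1"
          using \<epsilon>1 u1 by (intro mult_left_mono mono_onD[OF wmono]) auto
        finally show "norm (deriv \<psi> u) \<le> \<epsilon>1 * w 1 / \<rho>" using \<rho>(1) by (simp add: field_simps)
      qed (use z in auto)
      then have "B * norm (1 - \<psi> z) \<le> B * (\<epsilon>1 * w 1 / \<rho>)"
        using B(1) by (intro mult_left_mono) (auto simp: \<psi>(2) norm_minus_commute)
      also have "\<dots> \<le> B * ((\<epsilon> * w \<rho> * \<rho> / (2 * B * w 1)) * w 1 / \<rho>)"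
        using B(1) w1 \<rho> by (intro mult_left_mono divide_right_mono mult_right_mono) (auto simp: \<epsilon>1_def)
      also have "\<dots> = \<epsilon> / 2 * w \<rho>" using B(1) w1 \<rho> by simp
      also have "\<dots> \<le> \<epsilon> / 2 * w t"
        using \<open>0 < \<epsilon>\<close> False t \<rho> by (intro mult_left_mono mono_onD[OF wmono]) auto
      finally have le: "B * norm (1 - \<psi> z) \<le> \<epsilon> / 2 * w t" .
      have "t * (B * norm (1 - \<psi> z)) \<le> 1 * (\<epsilon> / 2 * w t)"
        by (rule mult_mono[OF t(2) le]) (use B(1) in auto)
      then show ?thesis by simp
    qed
    have "norm (deriv p z) \<le> norm (deriv h z) * norm (1 - \<psi> z) + norm (deriv \<psi> z) * norm (h z)"
      unfolding deriv_p[OF z] norm_mult[symmetric] by (rule norm_triangle_ineq4)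
    also have "\<dots> \<le> B * norm (1 - \<psi> z) + norm (deriv \<psi> z) * norm (h z)"
      using hz(2) by (intro add_right_mono mult_right_mono) auto
    finally have "t * norm (deriv p z) \<le> t * (B * norm (1 - \<psi> z) + norm (deriv \<psi> z) * norm (h z))"
      using t by (intro mult_left_mono) auto
    also have "\<dots> \<le> \<epsilon> / 2 * w t + \<epsilon> / 2 * w t"
      unfolding distrib_left using 1 2 by (rule add_mono[rotated])
    finally show ?thesis by (simp add: t_def)
  qed
  note cont = analytic_cball_continuous
  have "measure lborel {x\<in>{0..1}. \<epsilon> \<le> norm (p (cis (2 * pi * x)) - h (cis (2 * pi * x)))}
      \<le> measure lborel {x\<in>{0..1}. \<eta> \<le> norm (\<psi> (cis (2 * pi * x)))}"
  proof (rule measure_mono_fmeasurable)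
    show "{x\<in>{0..1}. \<epsilon> \<le> norm (p (cis (2 * pi * x)) - h (cis (2 * pi * x)))}
        \<subseteq> {x\<in>{0..1}. \<eta> \<le> norm (\<psi> (cis (2 * pi * x)))}"
    proof safe
      fix x :: real
      let ?z = "cis (2 * pi * x)"
      assume "\<epsilon> \<le> norm (p ?z - h ?z)"
      also have "p ?z - h ?z = - (h ?z * \<psi> ?z)" by (simp add: p_def algebra_simps)
      also have "norm \<dots> \<le> B * norm (\<psi> ?z)" unfolding norm_minus_cancel norm_mult using B(2)[of ?z] by (intro mult_right_mono) auto
      finally have "\<eta> * B \<le> norm (\<psi> ?z) * B" using \<eta> by (simp add: mult.commute)
      then show "\<eta> \<le> norm (\<psi> ?z)" using B(1) by simp
    qed
    have "compact {x\<in>{0..1}. \<epsilon> \<le> norm (p (cis (2 * pi * x)) - h (cis (2 * pi * x)))}"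
      by (intro compact_superlevel_01 continuous_on_norm continuous_on_diff continuous_on_circle_param cont anp h)
    then show "{x\<in>{0..1}. \<epsilon> \<le> norm (p (cis (2 * pi * x)) - h (cis (2 * pi * x)))} \<in> sets lborel"
      by (simp add: borel_compact)
    show "{x\<in>{0..1}. \<eta> \<le> norm (\<psi> (cis (2 * pi * x)))} \<in> fmeasurable lborel"
      by (intro fmeasurable_compact compact_superlevel_01 continuous_on_norm continuous_on_circle_param cont \<psi>)
  qed
  then have "measure lborel {x\<in>{0..1}. \<epsilon> \<le> norm (p (cis (2 * pi * x)) - h (cis (2 * pi * x)))} \<le> \<epsilon>"
    using \<psi>m \<eta>(2) by linarith
  then show ?thesis using that anp bound by (simp add: p_def \<psi>(2))
qed

section \<open>The Bloch-type space\<close>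

lemma Bloch0_iff:
  assumes maj: "majorant w"
  shows "f \<in> Bloch0 w \<longleftrightarrow> f holomorphic_on ball 0 1 \<and> (\<forall>z. z \<notin> ball 0 1 \<longrightarrow> f z = 0) \<and>
    (\<forall>e>0. \<exists>\<rho><1. \<forall>z\<in>ball 0 1. \<rho> < norm z \<longrightarrow> (1 - norm z) * norm (deriv f z) \<le> e * w (1 - norm z))"
    (is "_ \<longleftrightarrow> ?A \<and> ?B \<and> ?C")
proof -
  let ?F = "filtercomap norm (at_left (1::real)) :: complex filter"
  let ?g = "\<lambda>z. of_real ((1 - norm z) / w (1 - norm z)) * deriv f z"
  have norm_g: "norm (?g z) = (1 - norm z) * norm (deriv f z) / w (1 - norm z)" and wz: "0 < w (1 - norm z)"
    if "z \<in> ball 0 1" for z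
  proof -
    show "0 < w (1 - norm z)" using that by (intro majorant_pos[OF maj]) auto
    then show "norm (?g z) = (1 - norm z) * norm (deriv f z) / w (1 - norm z)"
      using that unfolding norm_mult norm_of_real by simp
  qed
  have "(?g \<longlongrightarrow> 0) ?F \<longleftrightarrow> ?C"
  proof
    assume lim: "(?g \<longlongrightarrow> 0) ?F"
    show ?C
    proof (intro allI impI)
      fix e :: real assume "0 < e"
      then have "eventually (\<lambda>z. dist (?g z) 0 < e) ?F" using lim by (rule tendstoD[rotated])
      then obtain P where P: "eventually P (at_left (1::real))" "\<And>z. P (norm z) \<Longrightarrow> norm (?g z) < e"
        by (auto simp: eventually_filtercomap)
      obtain \<rho> where \<rho>: "\<rho> < 1" "\<And>y. \<rho> < y \<Longrightarrow> y < 1 \<Longrightarrow> P y"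
        using P(1) eventually_at_left_field by blast
      have "(1 - norm z) * norm (deriv f z) \<le> e * w (1 - norm z)" if "z \<in> ball 0 1" "\<rho> < norm z" for z
      proof -
        have "norm (?g z) < e" using that \<rho> by (intro P) auto
        then have "(1 - norm z) * norm (deriv f z) / w (1 - norm z) < e"
          by (simp only: norm_g[OF that(1)])
        then show ?thesis using wz[OF that(1)] by (simp add: divide_less_eq)
      qed
      then show "\<exists>\<rho><1. \<forall>z\<in>ball 0 1. \<rho> < norm z \<longrightarrow> (1 - norm z) * norm (deriv f z) \<le> e * w (1 - norm z)"
        using \<rho>(1) by blast
    qed
  next
    assume C: ?C
    show "(?g \<longlongrightarrow> 0) ?F"
    proof (rule tendstoI)
      fix e :: real assume "0 < e"
      then obtain \<rho> where \<rho>: "\<rho> < 1" "\<And>z. z \<in> ball 0 1 \<Longrightarrow> \<rho> < norm z \<Longrightarrow> (1 - norm z) * norm (deriv f z) \<le> e / 2 * w (1 - norm z)"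
        using C[rule_format, of "e / 2"] by auto
      have "eventually (\<lambda>y. max 0 \<rho> < y \<and> y < 1) (at_left (1::real))"
        unfolding eventually_at_left_field using \<rho>(1) by (intro exI[of _ "max 0 \<rho>"]) auto
      then have "eventually (\<lambda>z::complex. max 0 \<rho> < norm z \<and> norm z < 1) ?F" by (rule eventually_filtercomapI)
      then show "eventually (\<lambda>z. dist (?g z) 0 < e) ?F"
      proof (rule eventually_mono)
        fix z :: complex assume "max 0 \<rho> < norm z \<and> norm z < 1"
        then have z: "z \<in> ball 0 1" "\<rho> < norm z" by auto
        have "norm (?g z) \<le> e / 2"
          unfolding norm_g[OF z(1)] using \<rho>(2)[OF z] wz[OF z(1)] by (simp add: divide_le_eq)
        then show "dist (?g z) 0 < e" using \<open>0 < e\<close> by simp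
      qed
    qed
  qed
  then show ?thesis by (simp add: Bloch0_def)
qed

lemma Bloch0_holomorphic: "f \<in> Bloch0 w \<Longrightarrow> f holomorphic_on ball 0 1"
  by (simp add: Bloch0_def)

lemma Bloch_dist_le:
  assumes maj: "majorant w" and fg: "f \<in> Bloch0 w" "g \<in> Bloch0 w"
    and a: "norm (f 0 - g 0) \<le> a"
    and b: "\<And>z. z \<in> ball 0 1 \<Longrightarrow> (1 - norm z) * norm (deriv f z - deriv g z) \<le> b * w (1 - norm z)"
  shows "Bloch_dist w f g \<le> a + b"
proof -
  have "(SUP z\<in>ball 0 1. (1 - norm z) / w (1 - norm z) * norm (deriv (\<lambda>z. f z - g z) z)) \<le> b"
  proof (rule cSUP_least)
    fix z :: complex assume z: "z \<in> ball 0 1"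
    have "0 < w (1 - norm z)" using z by (intro majorant_pos[OF maj]) auto
    then show "(1 - norm z) / w (1 - norm z) * norm (deriv (\<lambda>z. f z - g z) z) \<le> b"
      using b[OF z] by (simp add: Bloch0_deriv_diff[OF fg z] divide_le_eq)
  qed auto
  then show ?thesis using a fg by (simp add: Bloch_dist_def Bloch_norm_def)
qed

lemma
  assumes maj: "majorant w" and fg: "f \<in> Bloch0 w" "g \<in> Bloch0 w"
  shows Bloch_dist_ge_0: "norm (f 0 - g 0) \<le> Bloch_dist w f g"
    and Bloch_dist_ge_deriv: "z \<in> ball 0 1 \<Longrightarrow>
      (1 - norm z) * norm (deriv f z - deriv g z) \<le> Bloch_dist w f g * w (1 - norm z)"
proof -
  let ?h = "\<lambda>z. (1 - norm z) / w (1 - norm z) * norm (deriv (\<lambda>z. f z - g z) z)"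
  have upper: "?h z \<le> (SUP z\<in>ball 0 1. ?h z)" if "z \<in> ball 0 1" for z
    by (rule cSUP_upper[OF that Bloch0_bdd[OF maj Bloch0_diff[OF fg]]])
  have w0: "0 < w (1 - norm z)" if "z \<in> ball 0 1" for z :: complex
    using that by (intro majorant_pos[OF maj]) auto
  have "0 \<le> ?h 0" using w0[of 0] by simp
  then have "0 \<le> (SUP z\<in>ball 0 1. ?h z)" using upper[of 0] by simp
  then show "norm (f 0 - g 0) \<le> Bloch_dist w f g" using fg by (simp add: Bloch_dist_def Bloch_norm_def)
  show "(1 - norm z) * norm (deriv f z - deriv g z) \<le> Bloch_dist w f g * w (1 - norm z)"
    if z: "z \<in> ball 0 1"
  proof -
    have "?h z \<le> Bloch_dist w f g" using upper[OF z] fg by (simp add: Bloch_dist_def Bloch_norm_def add_increasing)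
    then show ?thesis using w0[OF z] by (simp add: Bloch0_deriv_diff[OF fg z] divide_le_eq)
  qed
qed

text \<open>Point evaluations are continuous: the derivative bound is integrated from the origin,
  with \<open>w\<close> replaced by its maximum \<open>w 1\<close>. Bloch convergence is therefore
  locally uniform.\<close>

lemma Bloch_dist_pointwise:
  assumes maj: "majorant w" and fg: "f \<in> Bloch0 w" "g \<in> Bloch0 w" and z: "norm z < 1"
  shows "norm (f z - g z) \<le> Bloch_dist w f g * (1 + w 1 / (1 - norm z))"
proof -
  have "norm ((\<lambda>z. f z - g z) z - (\<lambda>z. f z - g z) 0) \<le> Bloch_dist w f g * w 1 / (1 - norm z)"
  proof (rule norm_diff_le_deriv_bound[OF _ z])
    show "(\<lambda>z. f z - g z) holomorphic_on ball 0 1"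
      using fg by (intro holomorphic_on_diff Bloch0_holomorphic)
    fix u :: complex assume u: "norm u \<le> norm z"
    then have u1: "u \<in> ball 0 1" using z by simp
    have "norm (deriv f u - deriv g u) * (1 - norm z) \<le> (1 - norm u) * norm (deriv f u - deriv g u)"
      using u by (subst mult.commute, intro mult_right_mono) auto
    also have "\<dots> \<le> Bloch_dist w f g * w (1 - norm u)" by (rule Bloch_dist_ge_deriv[OF maj fg u1])
    also have "\<dots> \<le> Bloch_dist w f g * w 1"
      using u1 order_trans[OF norm_ge_zero Bloch_dist_ge_0[OF maj fg]]
      by (intro mult_left_mono mono_onD[OF majorant_mono[OF maj]]) auto
    finally show "norm (deriv (\<lambda>z. f z - g z) u) \<le> Bloch_dist w f g * w 1 / (1 - norm z)"
      using z by (simp add: Bloch0_deriv_diff[OF fg u1] field_simps)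
  qed
  then have "norm (f z - g z) \<le> norm (f 0 - g 0) + Bloch_dist w f g * w 1 / (1 - norm z)"
    using norm_triangle_sub[of "f z - g z" "f 0 - g 0"] by simp
  then show ?thesis using Bloch_dist_ge_0[OF maj fg] by (simp add: distrib_left)
qed

text \<open>Passes to the representative extended by zero that \<open>Bloch0\<close> requires; the
  values of \<open>F\<close> on the circle remain available through \<open>F\<close> itself.\<close>

definition disc_restrict :: "(complex \<Rightarrow> complex) \<Rightarrow> complex \<Rightarrow> complex" where
  "disc_restrict F = (\<lambda>z. if z \<in> ball 0 1 then F z else 0)"

lemma disc_restrict_holomorphic:
  "F holomorphic_on ball 0 1 \<Longrightarrow> disc_restrict F holomorphic_on ball 0 1"
  by (rule holomorphic_transform) (auto simp: disc_restrict_def)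

lemma deriv_disc_restrict:
  assumes "F holomorphic_on ball 0 1" "z \<in> ball 0 1"
  shows "deriv (disc_restrict F) z = deriv F z"
  by (rule complex_derivative_transform_within_open[OF disc_restrict_holomorphic assms(1) open_ball assms(2)])
     (use assms in \<open>auto simp: disc_restrict_def\<close>)

lemma disc_restrict_0 [simp]: "disc_restrict F 0 = F 0"
  by (simp add: disc_restrict_def)

text \<open>The derivative is bounded on the closed disc, and \<open>1 - norm z\<close> is
  negligible against \<open>w (1 - norm z)\<close>.\<close>

lemma disc_restrict_in_Bloch0:
  assumes maj: "majorant w" and F: "F analytic_on cball 0 1"
  shows "disc_restrict F \<in> Bloch0 w"
  unfolding Bloch0_iff[OF maj]
proof (intro conjI allI impI)
  note hol = analytic_cball_holomorphic[OF F]
  show "disc_restrict F holomorphic_on ball 0 1" using hol by (rule disc_restrict_holomorphic)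
  show "disc_restrict F z = 0" if "z \<notin> ball 0 1" for z using that by (simp add: disc_restrict_def)
  fix e :: real assume "0 < e"
  obtain B where B: "1 \<le> B" "\<And>z. z \<in> cball 0 1 \<Longrightarrow> norm (F z) \<le> B"
      "\<And>z. z \<in> cball 0 1 \<Longrightarrow> norm (deriv F z) \<le> B"
    using analytic_cball_bounded[OF F] by blast
  obtain \<rho> where \<rho>: "0 < \<rho>" "\<rho> \<le> 1" "\<And>t. 0 < t \<Longrightarrow> t < \<rho> \<Longrightarrow> t \<le> e / B * w t"
    using majorant_dominates_identity[OF maj, of "e / B"] \<open>0 < e\<close> B(1) by auto
  have "(1 - norm z) * norm (deriv (disc_restrict F) z) \<le> e * w (1 - norm z)"
    if z: "z \<in> ball 0 1" "1 - \<rho> < norm z" for z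
  proof -
    have "(1 - norm z) * norm (deriv F z) \<le> (e / B * w (1 - norm z)) * B"
      using \<rho>(3)[of "1 - norm z"] B(1) B(3)[of z] z majorant_pos[OF maj, of "1 - norm z"] \<open>0 < e\<close>
      by (intro mult_mono) auto
    then show ?thesis using B(1) by (simp add: deriv_disc_restrict[OF hol z(1)])
  qed
  then show "\<exists>\<rho><1. \<forall>z\<in>ball 0 1. \<rho> < norm z \<longrightarrow>
      (1 - norm z) * norm (deriv (disc_restrict F) z) \<le> e * w (1 - norm z)"
    using \<rho>(1) by (intro exI[of _ "1 - \<rho>"]) auto
qed

lemma mcomplete_Bloch0:
  assumes maj: "majorant w"
  shows "Metric_space.mcomplete (Bloch0 w) (Bloch_dist w)"
proof -
  interpret Metric_space "Bloch0 w" "Bloch_dist w" by (rule Metric_space_Bloch0[OF maj])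
  show ?thesis
    unfolding mcomplete_def
  proof (intro allI impI)
    fix \<sigma> assume "MCauchy \<sigma>"
    then have \<sigma>: "\<sigma> n \<in> Bloch0 w" for n by (auto simp: MCauchy_def)
    have Cauchy: "\<exists>N. \<forall>n m. N \<le> n \<longrightarrow> N \<le> m \<longrightarrow> Bloch_dist w (\<sigma> n) (\<sigma> m) < e" if "0 < e" for e
      using \<open>MCauchy \<sigma>\<close> that by (simp add: MCauchy_def)
    have w1: "0 < w 1" using majorant_pos[OF maj] by simp
    define g where "g = (\<lambda>z. lim (\<lambda>n. \<sigma> n z))"
    have unif: "\<exists>N. \<forall>n\<ge>N. \<forall>m\<ge>N. \<forall>z\<in>cball 0 r. norm (\<sigma> n z - \<sigma> m z) < e" if "0 < e" "r < 1" for e r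
    proof -
      define C where "C = 1 + w 1 / (1 - r)"
      have C: "0 < C" using w1 that by (simp add: C_def add_pos_pos)
      obtain N where N: "\<And>n m. n \<ge> N \<Longrightarrow> m \<ge> N \<Longrightarrow> Bloch_dist w (\<sigma> n) (\<sigma> m) < e / C"
        using Cauchy[of "e / C"] C \<open>0 < e\<close> by auto
      have "norm (\<sigma> n z - \<sigma> m z) < e" if nm: "n \<ge> N" "m \<ge> N" and z: "z \<in> cball 0 r" for n m z
      proof -
        have "norm (\<sigma> n z - \<sigma> m z) \<le> Bloch_dist w (\<sigma> n) (\<sigma> m) * (1 + w 1 / (1 - norm z))"
          using z \<open>r < 1\<close> by (intro Bloch_dist_pointwise[OF maj \<sigma> \<sigma>]) auto
        also have "\<dots> \<le> Bloch_dist w (\<sigma> n) (\<sigma> m) * C"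
          unfolding C_def using z \<open>r < 1\<close> w1 by (intro mult_left_mono add_left_mono divide_left_mono) auto
        also have "\<dots> < e / C * C" using N[OF nm] C by (intro mult_strict_right_mono)
        finally show ?thesis using C by simp
      qed
      then show ?thesis by blast
    qed
    have lim: "(\<lambda>n. \<sigma> n z) \<longlonglongrightarrow> g z" if "norm z < 1" for z
    proof -
      have "Cauchy (\<lambda>n. \<sigma> n z)"
        unfolding Cauchy_def dist_norm using unif[OF _ that] by (meson mem_cball_0 order_refl)
      then show ?thesis unfolding g_def using Cauchy_convergent_iff convergent_LIMSEQ_iff by blast
    qed
    have lim_out: "(\<lambda>n. \<sigma> n z) \<longlonglongrightarrow> 0" if "z \<notin> ball 0 1" for z
      using \<sigma> that by (simp add: Bloch0_def)
    then have g_out: "g z = 0" if "z \<notin> ball 0 1" for z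
      using that unfolding g_def by (metis limI)
    have ulim: "uniform_limit (cball 0 r) \<sigma> g sequentially" if r: "r < 1" for r
    proof (rule uniform_limitI)
      fix e :: real assume "0 < e"
      then obtain N where N: "\<And>n m z. n \<ge> N \<Longrightarrow> m \<ge> N \<Longrightarrow> z \<in> cball 0 r \<Longrightarrow> norm (\<sigma> n z - \<sigma> m z) < e / 2"
        using unif[OF half_gt_zero[OF \<open>0 < e\<close>] r] by meson
      have "dist (\<sigma> n z) (g z) < e" if n: "n \<ge> N" and z: "z \<in> cball 0 r" for n z
      proof -
        have "(\<lambda>m. norm (\<sigma> n z - \<sigma> m z)) \<longlonglongrightarrow> norm (\<sigma> n z - g z)"
          using z r by (intro tendsto_intros lim) auto
        then have "norm (\<sigma> n z - g z) \<le> e / 2"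
          by (rule LIMSEQ_le_const2) (use N n z in \<open>auto intro!: exI[of _ N] less_imp_le\<close>)
        then show ?thesis using \<open>0 < e\<close> by (simp add: dist_norm)
      qed
      then show "\<forall>\<^sub>F n in sequentially. \<forall>z\<in>cball 0 r. dist (\<sigma> n z) (g z) < e"
        unfolding eventually_sequentially by blast
    qed
    have "\<exists>g'. \<forall>z\<in>ball 0 1. (g has_field_derivative g' z) (at z) \<and> (\<lambda>n. deriv (\<sigma> n) z) \<longlonglongrightarrow> g' z"
    proof (rule has_complex_derivative_uniform_sequence[OF open_ball])
      show "(\<sigma> n has_field_derivative deriv (\<sigma> n) z) (at z)" if "z \<in> ball 0 1" for n z
        by (rule holomorphic_derivI[OF Bloch0_holomorphic[OF \<sigma>] open_ball that])
      show "\<exists>d>0. cball z d \<subseteq> ball 0 1 \<and> uniform_limit (cball z d) \<sigma> g sequentially" if z: "z \<in> ball 0 1" for z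
      proof -
        define d where "d = (1 - norm z) / 2"
        have d: "0 < d" "norm z + d < 1" using z by (auto simp: d_def field_simps)
        have sub: "cball z d \<subseteq> cball 0 (norm z + d)"
          by (simp add: subset_iff dist_norm) (metis add.commute add_mono norm_minus_commute norm_triangle_sub order_trans add_left_mono)
        then have "uniform_limit (cball z d) \<sigma> g sequentially"
          using ulim[OF d(2)] uniform_limit_on_subset by blast
        moreover have "cball 0 (norm z + d) \<subseteq> ball (0::complex) 1" using d by auto
        ultimately show ?thesis using d(1) sub by blast
      qed
    qed
    then obtain g' where g': "\<And>z. z \<in> ball 0 1 \<Longrightarrow> (g has_field_derivative g' z) (at z)"
      "\<And>z. z \<in> ball 0 1 \<Longrightarrow> (\<lambda>n. deriv (\<sigma> n) z) \<longlonglongrightarrow> g' z" by blast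
    have hol: "g holomorphic_on ball 0 1"
      unfolding holomorphic_on_open[OF open_ball] using g'(1) by blast
    have deriv_g: "deriv g z = g' z" if "z \<in> ball 0 1" for z
      using g'(1)[OF that] by (rule DERIV_imp_deriv)
    \<comment> \<open>The Cauchy inequality is passed to the limit in \<open>m\<close> at each fixed
      \<open>z\<close>; as \<open>N\<close> does not depend on \<open>z\<close>, the bound is
      uniform on the disc.\<close>
    have close: "\<exists>N. \<forall>n\<ge>N. \<forall>z\<in>ball 0 1. (1 - norm z) * norm (deriv (\<sigma> n) z - deriv g z) \<le> e * w (1 - norm z)"
      if "0 < e" for e
    proof -
      obtain N where N: "\<And>n m. n \<ge> N \<Longrightarrow> m \<ge> N \<Longrightarrow> Bloch_dist w (\<sigma> n) (\<sigma> m) < e"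
        using Cauchy[OF \<open>0 < e\<close>] by auto
      have "(1 - norm z) * norm (deriv (\<sigma> n) z - deriv g z) \<le> e * w (1 - norm z)"
        if n: "n \<ge> N" and z: "z \<in> ball 0 1" for n z
      proof -
        have "(\<lambda>m. (1 - norm z) * norm (deriv (\<sigma> n) z - deriv (\<sigma> m) z))
            \<longlonglongrightarrow> (1 - norm z) * norm (deriv (\<sigma> n) z - g' z)"
          using z by (intro tendsto_intros g'(2)) auto
        moreover have "(1 - norm z) * norm (deriv (\<sigma> n) z - deriv (\<sigma> m) z) \<le> e * w (1 - norm z)" if "m \<ge> N" for m
        proof -
          have "0 < w (1 - norm z)" using z by (intro majorant_pos[OF maj]) auto
          then have "Bloch_dist w (\<sigma> n) (\<sigma> m) * w (1 - norm z) \<le> e * w (1 - norm z)"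
            using N[OF n that] by (intro mult_right_mono) auto
          then show ?thesis using Bloch_dist_ge_deriv[OF maj \<sigma> \<sigma> z, of n m] by linarith
        qed
        ultimately show ?thesis unfolding deriv_g[OF z] by (intro LIMSEQ_le_const2) blast+
      qed
      then show ?thesis by blast
    qed
    have gB: "g \<in> Bloch0 w"
      unfolding Bloch0_iff[OF maj]
    proof (intro conjI allI impI hol g_out)
      fix e :: real assume "0 < e"
      obtain n where n: "\<And>z. z \<in> ball 0 1 \<Longrightarrow> (1 - norm z) * norm (deriv (\<sigma> n) z - deriv g z) \<le> e / 2 * w (1 - norm z)"
        using close[OF half_gt_zero[OF \<open>0 < e\<close>]] by (meson order_refl)
      obtain \<rho> where \<rho>: "\<rho> < 1" "\<And>z. z \<in> ball 0 1 \<Longrightarrow> \<rho> < norm z \<Longrightarrow> (1 - norm z) * norm (deriv (\<sigma> n) z) \<le> e / 2 * w (1 - norm z)"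
        using \<sigma>[of n, unfolded Bloch0_iff[OF maj]] \<open>0 < e\<close> half_gt_zero by meson
      have "(1 - norm z) * norm (deriv g z) \<le> e * w (1 - norm z)" if z: "z \<in> ball 0 1" "\<rho> < norm z" for z
      proof -
        have "norm (deriv g z) \<le> norm (deriv (\<sigma> n) z) + norm (deriv (\<sigma> n) z - deriv g z)"
          using norm_triangle_sub[of "deriv g z" "deriv (\<sigma> n) z"] by (simp add: norm_minus_commute)
        then have "(1 - norm z) * norm (deriv g z) \<le> (1 - norm z) * (norm (deriv (\<sigma> n) z) + norm (deriv (\<sigma> n) z - deriv g z))"
          using z by (intro mult_left_mono) auto
        also have "\<dots> \<le> e / 2 * w (1 - norm z) + e / 2 * w (1 - norm z)"
          unfolding distrib_left by (intro add_mono n \<rho> z)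
        finally show ?thesis by simp
      qed
      then show "\<exists>\<rho><1. \<forall>z\<in>ball 0 1. \<rho> < norm z \<longrightarrow> (1 - norm z) * norm (deriv g z) \<le> e * w (1 - norm z)"
        using \<rho>(1) by blast
    qed
    have "\<exists>N. \<forall>n\<ge>N. \<sigma> n \<in> Bloch0 w \<and> Bloch_dist w (\<sigma> n) g < e" if "0 < e" for e
    proof -
      have e3: "0 < e / 3" using \<open>0 < e\<close> by simp
      obtain N1 where N1: "\<And>n z. n \<ge> N1 \<Longrightarrow> z \<in> ball 0 1 \<Longrightarrow> (1 - norm z) * norm (deriv (\<sigma> n) z - deriv g z) \<le> e / 3 * w (1 - norm z)"
        using close[OF e3] by meson
      have "(\<lambda>n. \<sigma> n 0) \<longlonglongrightarrow> g 0" by (rule lim) simp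
      then obtain N2 where N2: "\<And>n. n \<ge> N2 \<Longrightarrow> norm (\<sigma> n 0 - g 0) < e / 3"
        using LIMSEQ_D[OF _ e3] by blast
      have "Bloch_dist w (\<sigma> n) g < e" if "n \<ge> max N1 N2" for n
      proof -
        have "Bloch_dist w (\<sigma> n) g \<le> e / 3 + e / 3"
          using that N1[of n] N2[of n] by (intro Bloch_dist_le[OF maj \<sigma> gB]) (auto intro: less_imp_le)
        then show ?thesis using \<open>0 < e\<close> by simp
      qed
      then show ?thesis using \<sigma> by blast
    qed
    then show "\<exists>x. limitin mtopology \<sigma> x sequentially"
      unfolding limit_metric_sequentially using gB by blast
  qed
qed

text \<open>Dilations \<open>f (r z)\<close> approximate \<open>f\<close>. The little-o condition
  makes both derivatives small near the circle, the dilated one by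
  \<open>majorant_quotient_mono\<close>; on a compact disc uniform continuity of the derivative
  suffices.\<close>

lemma ex_analytic_near_Bloch0:
  assumes maj: "majorant w" and f: "f \<in> Bloch0 w" and "0 < e"
  obtains F where "F analytic_on cball 0 1" "Bloch_dist w f (disc_restrict F) < e"
proof -
  note hol = Bloch0_holomorphic[OF f]
  obtain \<rho>0 where \<rho>0: "\<rho>0 < 1" "\<And>z. z \<in> ball 0 1 \<Longrightarrow> \<rho>0 < norm z \<Longrightarrow> (1 - norm z) * norm (deriv f z) \<le> e / 4 * w (1 - norm z)"
  proof -
    have "0 < e / 4" using \<open>0 < e\<close> by simp
    then show thesis using f[unfolded Bloch0_iff[OF maj]] that by meson
  qed
  define \<rho> where "\<rho> = max 0 \<rho>0"
  have \<rho>: "0 \<le> \<rho>" "\<rho> < 1" "\<And>z. z \<in> ball 0 1 \<Longrightarrow> \<rho> < norm z \<Longrightarrow> (1 - norm z) * norm (deriv f z) \<le> e / 4 * w (1 - norm z)"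
    using \<rho>0 by (auto simp: \<rho>_def)
  define \<rho>1 where "\<rho>1 = (1 + \<rho>) / 2"
  have \<rho>1: "\<rho> < \<rho>1" "\<rho>1 < 1" "0 \<le> \<rho>1" using \<rho> by (auto simp: \<rho>1_def)
  have contd: "continuous_on (cball 0 \<rho>1) (deriv f)"
    by (rule continuous_on_subset[OF holomorphic_on_imp_continuous_on[OF holomorphic_deriv[OF hol open_ball]]])
       (use \<rho>1 in auto)
  define \<eta> where "\<eta> = e / 4 * w (1 - \<rho>1)"
  have \<eta>: "0 < \<eta>" unfolding \<eta>_def using \<rho>1 \<open>0 < e\<close> majorant_pos[OF maj, of "1 - \<rho>1"] by simp
  have "uniformly_continuous_on (cball 0 \<rho>1) (deriv f)"
    by (rule compact_uniformly_continuous[OF contd]) simp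
  then obtain \<delta> where \<delta>: "0 < \<delta>" "\<And>u v. u \<in> cball 0 \<rho>1 \<Longrightarrow> v \<in> cball 0 \<rho>1 \<Longrightarrow> dist v u < \<delta> \<Longrightarrow> dist (deriv f v) (deriv f u) < \<eta> / 2"
    unfolding uniformly_continuous_on_def using \<eta> half_gt_zero by metis
  have "bounded (deriv f ` cball 0 \<rho>1)"
    by (intro compact_imp_bounded compact_continuous_image contd) simp
  then obtain B where B: "0 < B" "\<And>z. z \<in> cball 0 \<rho>1 \<Longrightarrow> norm (deriv f z) \<le> B"
    by (auto simp: bounded_pos)
  \<comment> \<open>With \<open>u = r * z\<close>, the difference of derivatives is
    \<open>(f' z - f' u) + s * f' u\<close>. The entries with \<open>\<delta>\<close> and
    \<open>B\<close> make both parts at most \<open>\<eta> / 2\<close>; the last entry keeps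
    \<open>u\<close> beyond radius \<open>\<rho>\<close> whenever \<open>z\<close> is beyond
    \<open>\<rho>1\<close>.\<close>
  define s where "s = Min {1 / 2, \<delta> / 2, \<eta> / (2 * B), (\<rho>1 - \<rho>) / 2}"
  have s: "0 < s" "s \<le> 1 / 2" "s < \<delta>" "s * B \<le> \<eta> / 2" "s < \<rho>1 - \<rho>"
  proof -
    show "0 < s" using \<delta> \<eta> B \<rho>1 by (simp add: s_def)
    have "s \<le> \<delta> / 2" "s \<le> (\<rho>1 - \<rho>) / 2" "s \<le> \<eta> / (2 * B)" "s \<le> 1 / 2"
      unfolding s_def by (intro Min_le; simp)+
    then show "s \<le> 1 / 2" "s < \<delta>" "s * B \<le> \<eta> / 2" "s < \<rho>1 - \<rho>"
      using \<delta> \<rho>1 B by (simp_all add: field_simps)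
  qed
  define r where "r = 1 - s"
  have r: "0 < r" "r < 1" using s by (auto simp: r_def)
  define F where "F = (\<lambda>z. f (of_real r * z))"
  have norm_rz: "norm (of_real r * z) = r * norm z" for z :: complex
    using r by (simp add: norm_mult)
  have "F holomorphic_on ball 0 (1 / r)"
    unfolding F_def
  proof (rule holomorphic_on_compose_gen[of _ _ f "ball 0 1", unfolded o_def])
    show "(\<lambda>z. of_real r * z) ` ball 0 (1 / r) \<subseteq> ball (0::complex) 1"
      using r by (auto simp: norm_mult field_simps)
  qed (auto intro!: holomorphic_intros hol)
  then have "F analytic_on ball 0 (1 / r)" by (simp add: analytic_on_open)
  then have anF: "F analytic_on cball 0 1"
  proof (rule analytic_on_subset)
    have "1 < 1 / r" using r by simp
    then show "cball 0 1 \<subseteq> ball (0::complex) (1 / r)" by (simp only: subset_iff mem_cball_0 mem_ball_0) linarith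
  qed
  have deriv_F: "deriv (disc_restrict F) z = of_real r * deriv f (of_real r * z)" if z: "z \<in> ball 0 1" for z
  proof -
    have rz: "of_real r * z \<in> ball 0 1" using z r norm_rz[of z] mult_left_le_one_le[of "norm z" r] by simp
    have "(f has_field_derivative deriv f (of_real r * z)) (at (of_real r * z))"
      by (rule holomorphic_derivI[OF hol open_ball rz])
    moreover have "((\<lambda>z. of_real r * z) has_field_derivative of_real r) (at z)"
      by (auto intro!: derivative_eq_intros)
    ultimately have "((\<lambda>z. f (of_real r * z)) has_field_derivative deriv f (of_real r * z) * of_real r) (at z)"
      by (rule DERIV_chain2)
    then have "deriv F z = deriv f (of_real r * z) * of_real r"
      unfolding F_def by (rule DERIV_imp_deriv)
    then show ?thesis
      by (simp add: deriv_disc_restrict[OF analytic_cball_holomorphic[OF anF] z] mult.commute)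
  qed
  have "Bloch_dist w f (disc_restrict F) \<le> 0 + e / 2"
  proof (rule Bloch_dist_le[OF maj f disc_restrict_in_Bloch0[OF maj anF]])
    show "norm (f 0 - disc_restrict F 0) \<le> 0" by (simp add: F_def)
    fix z :: complex assume z: "z \<in> ball 0 1"
    define u where "u = of_real r * z"
    have nu: "norm u = r * norm z" unfolding u_def by (rule norm_rz)
    have u: "u \<in> ball 0 1" "norm u \<le> norm z"
      using z r mult_left_le_one_le[of "norm z" r] by (auto simp: nu)
    have wz: "0 < w (1 - norm z)" using z by (intro majorant_pos[OF maj]) auto
    have eq: "deriv f z - deriv (disc_restrict F) z = (deriv f z - deriv f u) + of_real s * deriv f u"
      by (simp add: deriv_F[OF z] u_def r_def algebra_simps)
    show "(1 - norm z) * norm (deriv f z - deriv (disc_restrict F) z) \<le> e / 2 * w (1 - norm z)"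
    proof (cases "norm z \<le> \<rho>1")
      case True
      have uz: "norm (z - u) \<le> s"
      proof -
        have "z - u = of_real s * z" by (simp add: u_def r_def algebra_simps)
        then have "norm (z - u) = s * norm z" using s by (simp add: norm_mult)
        also have "\<dots> \<le> s * 1" using z s by (intro mult_left_mono) auto
        finally show ?thesis by simp
      qed
      have in\<rho>: "z \<in> cball 0 \<rho>1" "u \<in> cball 0 \<rho>1" using True u by auto
      have "norm (deriv f z - deriv f u) \<le> \<eta> / 2"
        using \<delta>(2)[OF in\<rho>(2,1)] uz s by (auto simp: dist_norm)
      moreover have "norm (of_real s * deriv f u) \<le> \<eta> / 2"
      proof -
        have "s * norm (deriv f u) \<le> s * B" using B(2)[OF in\<rho>(2)] s by (intro mult_left_mono) auto
        moreover have "norm (of_real s * deriv f u) = s * norm (deriv f u)" using s(1) by (simp add: norm_mult)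
        ultimately show ?thesis using s(4) by linarith
      qed
      ultimately have "norm (deriv f z - deriv (disc_restrict F) z) \<le> \<eta>"
        unfolding eq using norm_triangle_ineq[of "deriv f z - deriv f u" "of_real s * deriv f u"] by linarith
      then have "(1 - norm z) * norm (deriv f z - deriv (disc_restrict F) z) \<le> 1 * \<eta>"
        using z by (intro mult_mono) auto
      also have "\<dots> \<le> e / 2 * w (1 - norm z)"
        unfolding \<eta>_def mult_1
        using \<open>0 < e\<close> z True \<rho>1 majorant_pos[OF maj, of "1 - \<rho>1"]
        by (intro mult_mono mono_onD[OF majorant_mono[OF maj]]) auto
      finally show ?thesis .
    next
      case False
      have "\<rho> < norm u"
      proof -
        have "s * norm z \<le> s * 1" using z s by (intro mult_left_mono) auto
        then have "norm z - s \<le> norm u" by (simp add: nu r_def algebra_simps)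
        then show ?thesis using False s by linarith
      qed
      then have 2: "(1 - norm u) * norm (deriv f u) \<le> e / 4 * w (1 - norm u)" by (rule \<rho>(3)[OF u(1)])
      have wu: "0 < w (1 - norm u)" using u by (intro majorant_pos[OF maj]) auto
      have "(1 - norm z) / w (1 - norm z) \<le> (1 - norm u) / w (1 - norm u)"
        using z u by (intro majorant_quotient_mono[OF maj]) auto
      then have "(1 - norm z) / w (1 - norm z) * norm (deriv f u) \<le> (1 - norm u) / w (1 - norm u) * norm (deriv f u)"
        by (rule mult_right_mono) simp
      also have "\<dots> \<le> e / 4" using 2 wu by (simp add: divide_le_eq)
      finally have 3: "(1 - norm z) * norm (deriv f u) \<le> e / 4 * w (1 - norm z)" using wz by (simp add: divide_le_eq)
      have 1: "(1 - norm z) * norm (deriv f z) \<le> e / 4 * w (1 - norm z)"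
        using False \<rho>1 by (intro \<rho>(3) z) auto
      have "norm (deriv (disc_restrict F) z) \<le> 1 * norm (deriv f u)"
        unfolding deriv_F[OF z] norm_mult u_def[symmetric] using r by (intro mult_right_mono) auto
      then have "norm (deriv f z - deriv (disc_restrict F) z) \<le> norm (deriv f z) + norm (deriv f u)"
        using norm_triangle_ineq4[of "deriv f z" "deriv (disc_restrict F) z"] by linarith
      then have "(1 - norm z) * norm (deriv f z - deriv (disc_restrict F) z)
          \<le> (1 - norm z) * (norm (deriv f z) + norm (deriv f u))"
        using z by (intro mult_left_mono) auto
      also have "\<dots> \<le> e / 4 * w (1 - norm z) + e / 4 * w (1 - norm z)"
        unfolding distrib_left using 1 3 by (rule add_mono)
      finally show ?thesis by simp
    qed
  qed
  then have "Bloch_dist w f (disc_restrict F) < e" using \<open>0 < e\<close> by simp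
  then show ?thesis using that anF by blast
qed

section \<open>Taylor polynomials on the closed disc\<close>

text \<open>For fixed \<open>N\<close> the Taylor polynomial depends continuously on
  \<open>f\<close> even on the circle, where \<open>f\<close> itself need not have boundary values.
  Cauchy's estimates on radius 1/2 give the powers of 2, and \<open>1 + 2 * w 1\<close> is the
  constant of \<open>Bloch_dist_pointwise\<close> there.\<close>

lemma Taylor_poly_diff_le:
  assumes maj: "majorant w" and fg: "f \<in> Bloch0 w" "g \<in> Bloch0 w" and z: "norm z \<le> 1"
  shows "norm (Taylor_poly N f z - Taylor_poly N g z) \<le> Bloch_dist w f g * ((1 + 2 * w 1) * (\<Sum>n\<le>N. 2 ^ n))"
proof -
  define F where "F = (\<lambda>z. f z - g z)"
  define d where "d = Bloch_dist w f g"
  have hol: "f holomorphic_on ball 0 1" "g holomorphic_on ball 0 1" using fg by (simp_all add: Bloch0_holomorphic)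
  then have holF: "F holomorphic_on ball 0 1" unfolding F_def by (rule holomorphic_on_diff)
  have coeff: "norm (fps_nth (fps_expansion f 0) n - fps_nth (fps_expansion g 0) n) \<le> d * (1 + 2 * w 1) * 2 ^ n" for n
  proof -
    have "norm ((deriv ^^ n) F 0) \<le> fact n * (d * (1 + 2 * w 1)) / (1 / 2) ^ n"
    proof (rule Cauchy_inequality)
      show "F holomorphic_on ball 0 (1 / 2)" "continuous_on (cball 0 (1 / 2)) F"
        by (auto intro: holomorphic_on_subset[OF holF] continuous_on_subset[OF holomorphic_on_imp_continuous_on[OF holF]])
      fix u :: complex assume "norm (0 - u) = 1 / 2"
      then have u: "norm u = 1 / 2" by simp
      have "norm u < 1" using u by simp
      from Bloch_dist_pointwise[OF maj fg this] show "norm (F u) \<le> d * (1 + 2 * w 1)"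
        unfolding u F_def d_def by (simp add: mult.commute)
    qed simp
    moreover have "(deriv ^^ n) F 0 = (deriv ^^ n) f 0 - (deriv ^^ n) g 0"
      unfolding F_def by (rule higher_deriv_diff[OF hol open_ball]) simp
    ultimately have "norm ((deriv ^^ n) f 0 - (deriv ^^ n) g 0) \<le> fact n * (d * (1 + 2 * w 1) * 2 ^ n)"
      by (simp add: power_one_over)
    then have "norm ((deriv ^^ n) f 0 - (deriv ^^ n) g 0) / fact n \<le> d * (1 + 2 * w 1) * 2 ^ n"
      by (simp add: divide_le_eq mult.commute)
    moreover have "fps_nth (fps_expansion f 0) n - fps_nth (fps_expansion g 0) n
        = ((deriv ^^ n) f 0 - (deriv ^^ n) g 0) / fact n"
      by (simp add: fps_expansion_def diff_divide_distrib)
    ultimately show ?thesis by (simp add: norm_divide)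
  qed
  have "Taylor_poly N f z - Taylor_poly N g z
      = (\<Sum>n\<le>N. (fps_nth (fps_expansion f 0) n - fps_nth (fps_expansion g 0) n) * z ^ n)"
    by (simp add: Taylor_poly_def sum_subtractf left_diff_distrib)
  also have "norm \<dots> \<le> (\<Sum>n\<le>N. d * (1 + 2 * w 1) * 2 ^ n)"
  proof (rule sum_norm_le)
    fix n
    have "norm ((fps_nth (fps_expansion f 0) n - fps_nth (fps_expansion g 0) n) * z ^ n)
        \<le> norm (fps_nth (fps_expansion f 0) n - fps_nth (fps_expansion g 0) n) * 1"
      unfolding norm_mult norm_power using z by (intro mult_left_mono power_le_one) auto
    then show "norm ((fps_nth (fps_expansion f 0) n - fps_nth (fps_expansion g 0) n) * z ^ n) \<le> d * (1 + 2 * w 1) * 2 ^ n"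
      using coeff[of n] by simp
  qed
  finally show ?thesis by (simp add: sum_distrib_left d_def mult.assoc)
qed

lemma analytic_cball_larger_ball:
  assumes "F analytic_on cball 0 1"
  obtains R :: real where "1 < R" "F holomorphic_on ball 0 R"
proof -
  obtain T where T: "open T" "cball 0 1 \<subseteq> T" "F holomorphic_on T"
    using assms by (auto simp: analytic_on_holomorphic)
  obtain \<epsilon> where \<epsilon>: "0 < \<epsilon>" "(\<Union>x\<in>cball 0 1. ball x \<epsilon>) \<subseteq> T"
    using compact_subset_open_imp_ball_epsilon_subset[OF compact_cball T(1,2)] by blast
  have "ball 0 (1 + \<epsilon>) \<subseteq> T"
  proof
    fix u :: complex assume u: "u \<in> ball 0 (1 + \<epsilon>)"
    show "u \<in> T"
    proof (cases "norm u \<le> 1")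
      case False
      have "sgn u - u = of_real (1 - norm u) * sgn u" 
      proof -
        have "complex_of_real (norm u) \<noteq> 0" using False by auto
        then show ?thesis by (simp add: sgn_eq left_diff_distrib diff_divide_distrib)
      qed
      moreover have "norm (sgn u) = 1" using False by (auto simp: norm_sgn)
      ultimately have "dist (sgn u) u = norm u - 1"
        using False unfolding dist_norm by (simp only: norm_mult norm_of_real) simp
      then show ?thesis using u \<epsilon>(2) \<open>norm (sgn u) = 1\<close> by (auto intro!: subsetD[OF \<epsilon>(2)] bexI[of _ "sgn u"])
    qed (use T in auto)
  qed
  then have "F holomorphic_on ball 0 (1 + \<epsilon>)" using T(3) by (rule holomorphic_on_subset[rotated])
  then show ?thesis using that[of "1 + \<epsilon>"] \<epsilon>(1) by simp
qed

text \<open>Cauchy's estimates on a circle of radius \<open>s > 1\<close> make the coefficients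
  decay geometrically.\<close>

lemma uniform_limit_Taylor_poly:
  assumes F: "F analytic_on cball 0 1"
  shows "uniform_limit (cball 0 1) (\<lambda>N. Taylor_poly N (disc_restrict F)) F sequentially"
proof -
  obtain R where R: "1 < R" "F holomorphic_on ball 0 R" using analytic_cball_larger_ball[OF F] by blast
  define s where "s = (1 + R) / 2"
  have s: "1 < s" "s < R" using R by (auto simp: s_def)
  have ev: "\<forall>\<^sub>F z in nhds 0. disc_restrict F z = F z"
    by (rule eventually_nhds_in_open[of "ball 0 1", THEN eventually_mono]) (auto simp: disc_restrict_def)
  define c where "c = (\<lambda>n. (deriv ^^ n) F 0 / fact n)"
  have nth: "fps_nth (fps_expansion (disc_restrict F) 0) n = c n" for n
    unfolding fps_expansion_cong[OF ev] by (simp add: fps_expansion_def c_def)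
  have cont: "continuous_on (cball 0 s) F"
    by (rule continuous_on_subset[OF holomorphic_on_imp_continuous_on[OF R(2)]]) (use s in auto)
  then have "bounded (F ` cball 0 s)" by (intro compact_imp_bounded compact_continuous_image) auto
  then obtain B where B: "0 < B" "\<And>z. z \<in> cball 0 s \<Longrightarrow> norm (F z) \<le> B" by (auto simp: bounded_pos)
  have c: "norm (c n) \<le> B * (1 / s) ^ n" for n
  proof -
    have "norm ((deriv ^^ n) F 0) \<le> fact n * B / s ^ n"
      by (rule Cauchy_inequality[OF holomorphic_on_subset[OF R(2)] cont]) (use s B in auto)
    then show ?thesis by (simp add: c_def norm_divide divide_le_eq power_one_over field_simps)
  qed
  have "uniform_limit (cball 0 1) (\<lambda>n z. \<Sum>i<n. c i * z ^ i) (\<lambda>z. suminf (\<lambda>i. c i * z ^ i)) sequentially"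
  proof (rule Weierstrass_m_test)
    show "summable (\<lambda>n. B * (1 / s) ^ n)"
      using s by (intro summable_mult summable_geometric) auto
    show "norm (c n * z ^ n) \<le> B * (1 / s) ^ n" if "z \<in> cball 0 1" for n z
    proof -
      have "norm (c n * z ^ n) \<le> norm (c n) * 1"
        unfolding norm_mult norm_power using that by (intro mult_left_mono power_le_one) auto
      then show ?thesis using c[of n] by simp
    qed
  qed
  moreover have "suminf (\<lambda>i. c i * z ^ i) = F z" if "z \<in> cball 0 1" for z
  proof -
    have "z \<in> ball 0 R" using that R by auto
    from holomorphic_power_series[OF R(2) this] show ?thesis by (simp add: c_def sums_iff)
  qed
  ultimately have "uniform_limit (cball 0 1) (\<lambda>n z. \<Sum>i<n. c i * z ^ i) F sequentially"
    by (simp add: uniform_limit_iff)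
  then have "uniform_limit (cball 0 1) (\<lambda>n z. \<Sum>i<Suc n. c i * z ^ i) F sequentially"
    by (rule filterlim_compose[OF _ filterlim_Suc])
  then show ?thesis
    by (simp add: Taylor_poly_def[abs_def] nth lessThan_Suc_atMost)
qed

section \<open>Polynomial approximation on an arc\<close>

lemma cis_2pi_eq_iff: "cis (2 * pi * x) = cis (2 * pi * y) \<longleftrightarrow> (\<exists>n::int. x = y + n)"
proof -
  have "cis (2 * pi * x) = cis (2 * pi * y) \<longleftrightarrow> sin (2 * pi * x) = sin (2 * pi * y) \<and> cos (2 * pi * x) = cos (2 * pi * y)"
    by (auto simp: complex_eq_iff)
  also have "\<dots> \<longleftrightarrow> (\<exists>n::int. 2 * pi * x = 2 * pi * y + 2 * pi * n)"
    by (simp add: sin_cos_eq_iff)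
  also have "\<dots> \<longleftrightarrow> (\<exists>n::int. x = y + n)"
  proof (rule ex_cong1)
    fix n :: int
    have "2 * pi * x = 2 * pi * y + 2 * pi * n \<longleftrightarrow> 2 * pi * x = 2 * pi * (y + n)"
      by (simp only: distrib_left)
    also have "\<dots> \<longleftrightarrow> x = y + n" by simp
    finally show "2 * pi * x = 2 * pi * y + 2 * pi * n \<longleftrightarrow> x = y + n" .
  qed
  finally show ?thesis .
qed

text \<open>Stated in the parameter \<open>x\<close>, so that Stone-Weierstrass can be used on an
  interval. The approximants are analytic functions rather than polynomials because the pole pushing
  produces rational ones.\<close>

definition arc_approximable :: "real \<Rightarrow> (real \<Rightarrow> complex) \<Rightarrow> bool" where
  "arc_approximable \<delta> u \<longleftrightarrow> (\<forall>\<epsilon>>0. \<exists>F. F analytic_on cball 0 1 \<and>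
     (\<forall>x\<in>{0..\<delta>}. norm (F (cis (2 * pi * x)) - u x) < \<epsilon>))"

lemma arc_approximable_analytic:
  "F analytic_on cball 0 1 \<Longrightarrow> arc_approximable \<delta> (\<lambda>x. F (cis (2 * pi * x)))"
  unfolding arc_approximable_def by (intro allI impI exI[of _ F]) simp

lemma arc_approximable_add:
  assumes "arc_approximable \<delta> u" "arc_approximable \<delta> v"
  shows "arc_approximable \<delta> (\<lambda>x. u x + v x)"
  unfolding arc_approximable_def
proof (intro allI impI)
  fix \<epsilon> :: real assume "0 < \<epsilon>"
  obtain F where F: "F analytic_on cball 0 1" "\<forall>x\<in>{0..\<delta>}. norm (F (cis (2 * pi * x)) - u x) < \<epsilon> / 2"
    using assms(1) half_gt_zero[OF \<open>0 < \<epsilon>\<close>] unfolding arc_approximable_def by meson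
  obtain G where G: "G analytic_on cball 0 1" "\<forall>x\<in>{0..\<delta>}. norm (G (cis (2 * pi * x)) - v x) < \<epsilon> / 2"
    using assms(2) half_gt_zero[OF \<open>0 < \<epsilon>\<close>] unfolding arc_approximable_def by meson
  have "norm ((F (cis (2 * pi * x)) + G (cis (2 * pi * x))) - (u x + v x)) < \<epsilon>" if "x \<in> {0..\<delta>}" for x
  proof -
    have "norm (F (cis (2 * pi * x)) - u x) < \<epsilon> / 2" "norm (G (cis (2 * pi * x)) - v x) < \<epsilon> / 2"
      using F(2) G(2) that by blast+
    then show ?thesis
      using norm_diff_triangle_ineq[of "F (cis (2 * pi * x))" "G (cis (2 * pi * x))" "u x" "v x"] by linarith
  qed
  then show "\<exists>F. F analytic_on cball 0 1 \<and> (\<forall>x\<in>{0..\<delta>}. norm (F (cis (2 * pi * x)) - (u x + v x)) < \<epsilon>)"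
    by (intro exI[of _ "\<lambda>z. F z + G z"] conjI analytic_intros F G) blast
qed

lemma arc_approximable_mult:
  assumes u: "arc_approximable \<delta> u" "continuous_on {0..\<delta>} u"
    and v: "arc_approximable \<delta> v" "continuous_on {0..\<delta>} v"
  shows "arc_approximable \<delta> (\<lambda>x. u x * v x)"
  unfolding arc_approximable_def
proof (intro allI impI)
  fix \<epsilon> :: real assume "0 < \<epsilon>"
  have bnd: "\<exists>B>0. \<forall>x\<in>{0..\<delta>}. norm (u x) \<le> B" if "continuous_on {0..\<delta>} u" for u :: "real \<Rightarrow> complex"
  proof -
    have "bounded (u ` {0..\<delta>})" by (intro compact_imp_bounded compact_continuous_image that) simp
    then show ?thesis by (auto simp: bounded_pos)
  qed
  obtain Bu where Bu: "0 < Bu" "\<And>x. x \<in> {0..\<delta>} \<Longrightarrow> norm (u x) \<le> Bu" using bnd[OF u(2)] by blast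
  obtain Bv where Bv: "0 < Bv" "\<And>x. x \<in> {0..\<delta>} \<Longrightarrow> norm (v x) \<le> Bv" using bnd[OF v(2)] by blast
  define \<eta> where "\<eta> = min 1 (\<epsilon> / (Bu + Bv + 1))"
  have \<eta>: "0 < \<eta>" using \<open>0 < \<epsilon>\<close> Bu Bv by (simp add: \<eta>_def)
  obtain F where F: "F analytic_on cball 0 1" "\<forall>x\<in>{0..\<delta>}. norm (F (cis (2 * pi * x)) - u x) < \<eta>"
    using u(1) \<eta> unfolding arc_approximable_def by meson
  obtain G where G: "G analytic_on cball 0 1" "\<forall>x\<in>{0..\<delta>}. norm (G (cis (2 * pi * x)) - v x) < \<eta>"
    using v(1) \<eta> unfolding arc_approximable_def by meson
  have "norm (F (cis (2 * pi * x)) * G (cis (2 * pi * x)) - u x * v x) < \<epsilon>" if x: "x \<in> {0..\<delta>}" for x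
  proof -
    define a b where "a = F (cis (2 * pi * x))" and "b = G (cis (2 * pi * x))"
    have ab: "norm (a - u x) < \<eta>" "norm (b - v x) < \<eta>" using F(2) G(2) x by (auto simp: a_def b_def)
    have "norm b \<le> norm (v x) + norm (b - v x)" by (rule norm_triangle_sub)
    then have nb: "norm b \<le> Bv + 1" using ab(2) Bv(2)[OF x] by (simp add: \<eta>_def)
    have "a * b - u x * v x = (a - u x) * b + u x * (b - v x)" by (simp add: algebra_simps)
    also have "norm \<dots> \<le> norm (a - u x) * norm b + norm (u x) * norm (b - v x)"
      unfolding norm_mult[symmetric] by (rule norm_triangle_ineq)
    also have "\<dots> \<le> norm (a - u x) * (Bv + 1) + Bu * norm (b - v x)"
      using nb Bu(2)[OF x] by (intro add_mono mult_left_mono mult_right_mono) auto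
    also have "\<dots> < \<eta> * (Bv + 1) + Bu * \<eta>"
      using ab Bu Bv by (intro add_strict_mono mult_strict_right_mono mult_strict_left_mono) auto
    also have "\<dots> = \<eta> * (Bu + Bv + 1)" by (simp add: algebra_simps)
    also have "\<dots> \<le> \<epsilon> / (Bu + Bv + 1) * (Bu + Bv + 1)"
      using Bu Bv by (intro mult_right_mono) (auto simp: \<eta>_def)
    also have "\<dots> = \<epsilon>" using Bu Bv by simp
    finally show ?thesis by (simp add: a_def b_def)
  qed
  then show "\<exists>F. F analytic_on cball 0 1 \<and> (\<forall>x\<in>{0..\<delta>}. norm (F (cis (2 * pi * x)) - u x * v x) < \<epsilon>)"
    by (intro exI[of _ "\<lambda>z. F z * G z"] conjI analytic_intros F G) blast
qed

text \<open>The pole of \<open>1/z\<close> is pushed through the gap of the arc: \<open>K\<close> has its pole outside the closed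
  disc, near the midpoint of the gap, and \<open>Re (z K)\<close> is negative on the arc, so that \<open>1/z\<close> is a
  Neumann series in powers of \<open>1 + \<eta> z K\<close>.\<close>

lemma arc_approximable_inverse:
  assumes \<delta>: "0 < \<delta>" "\<delta> < 1"
  shows "arc_approximable \<delta> (\<lambda>x. 1 / cis (2 * pi * x))"
proof -
  define m where "m = (1 + \<delta>) / 2"
  have m: "\<delta> < m" "m < 1" using \<delta> by (auto simp: m_def)
  define c where "c = cis (- (2 * pi * m))"
  have c: "c * cis (2 * pi * x) = cis (2 * pi * (x - m))" for x
    by (simp add: c_def cis_mult algebra_simps)
  have ne: "{0..\<delta>} \<noteq> {}" using \<delta> by simp
  have cont: "continuous_on {0..\<delta>} (\<lambda>x. cos (2 * pi * (x - m)))"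
    by (intro continuous_intros)
  obtain x0 where x0: "x0 \<in> {0..\<delta>}" "\<And>x. x \<in> {0..\<delta>} \<Longrightarrow> cos (2 * pi * (x - m)) \<le> cos (2 * pi * (x0 - m))"
    using continuous_attains_sup[OF compact_Icc ne cont] by blast
  define C where "C = cos (2 * pi * (x0 - m))"
  have C: "C < 1" "- 1 \<le> C"
  proof -
    have "C \<noteq> 1"
    proof
      assume "C = 1"
      then obtain n :: int where "2 * pi * (x0 - m) = n * (2 * pi)" by (auto simp: C_def cos_one_2pi_int)
      then have "x0 - m = n" by simp
      moreover have "- 1 < x0 - m" "x0 - m < 0" using x0(1) m by auto
      ultimately show False by auto
    qed
    then show "C < 1" by (simp add: C_def order_less_le)
  qed (simp add: C_def)
  \<comment> \<open>The rotation \<open>c\<close> moves the midpoint of the gap to 1, and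
    \<open>C\<close> is the largest cosine on the rotated arc. On that arc \<open>Re (z K)\<close>
    has the sign of \<open>Re u - \<rho>\<close>, hence \<open>\<rho> > C\<close>; the pole has
    modulus \<open>1 / \<rho>\<close>, hence \<open>\<rho> < 1\<close>.\<close>
  define \<rho> where "\<rho> = (3 + C) / 4"
  have \<rho>: "0 < \<rho>" "\<rho> < 1" "C < \<rho>" using C by (auto simp: \<rho>_def)
  define K where "K = (\<lambda>z. 2 * of_real \<rho> * c / (1 - of_real \<rho> * c * z))"
  have den: "1 - of_real \<rho> * c * z \<noteq> 0" if "norm z \<le> 1" for z
  proof -
    have "norm (of_real \<rho> * c * z) = \<rho> * norm z" using \<rho> by (simp add: norm_mult c_def)
    also have "\<dots> \<le> \<rho> * 1" using that \<rho> by (intro mult_left_mono) auto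
    finally have "norm (of_real \<rho> * c * z) < 1" using \<rho> by simp
    then show ?thesis by (metis eq_iff_diff_eq_0 norm_one order_less_irrefl)
  qed
  have anK: "K analytic_on cball 0 1" unfolding K_def using den by (intro analytic_intros) auto
  define L where "L = (\<lambda>z. z * K z)"
  have anL: "L analytic_on cball 0 1" unfolding L_def by (intro analytic_intros anK)
  have contL: "continuous_on {0..\<delta>} (\<lambda>x. L (cis (2 * pi * x)))"
    by (rule continuous_on_circle_param[OF analytic_cball_continuous[OF anL]])
  have ReL: "Re (L (cis (2 * pi * x))) < 0" if x: "x \<in> {0..\<delta>}" for x
  proof -
    define u where "u = cis (2 * pi * (x - m))"
    define d where "d = 1 - of_real \<rho> * u"
    have "d \<noteq> 0" using den[of "cis (2 * pi * x)"] c[of x] by (simp add: d_def u_def mult.assoc)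
    have "L (cis (2 * pi * x)) = 2 * of_real \<rho> * (c * cis (2 * pi * x)) / (1 - of_real \<rho> * (c * cis (2 * pi * x)))"
      by (simp add: L_def K_def mult_ac)
    then have "L (cis (2 * pi * x)) = (2 * of_real \<rho> * u) / d" by (simp only: c u_def d_def)
    then have "Re (L (cis (2 * pi * x))) = Re ((2 * of_real \<rho> * u) * cnj d) / (norm d)\<^sup>2"
      by (simp add: complex_div_cnj[of "2 * of_real \<rho> * u" d] del: cnj.simps complex_cnj_mult flip: of_real_power)
    also have "Re ((2 * of_real \<rho> * u) * cnj d) = 2 * \<rho> * (Re u - \<rho>)"
    proof -
      have "u * cnj u = 1" using complex_norm_square[of u] by (simp add: u_def)
      then have eq: "(2 * of_real \<rho> * u) * cnj d = 2 * of_real \<rho> * (u - of_real \<rho>)"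
        by (simp add: d_def algebra_simps)
      show ?thesis unfolding eq by simp
    qed
    also have "\<dots> / (norm d)\<^sup>2 < 0"
    proof (rule divide_neg_pos)
      have "Re u < \<rho>" using x0(2)[OF x] \<rho> by (simp add: u_def C_def)
      then show "2 * \<rho> * (Re u - \<rho>) < 0" using \<rho> by (intro mult_pos_neg) auto
    qed (use \<open>d \<noteq> 0\<close> in simp)
    finally show ?thesis .
  qed
  obtain x1 where x1: "x1 \<in> {0..\<delta>}" "\<And>x. x \<in> {0..\<delta>} \<Longrightarrow> Re (L (cis (2 * pi * x))) \<le> Re (L (cis (2 * pi * x1)))"
    using continuous_attains_sup[OF compact_Icc ne continuous_on_Re[OF contL]] by blast
  define e where "e = - Re (L (cis (2 * pi * x1)))"
  have e: "0 < e" "\<And>x. x \<in> {0..\<delta>} \<Longrightarrow> Re (L (cis (2 * pi * x))) \<le> - e"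
    using ReL[OF x1(1)] x1(2) by (auto simp: e_def)
  have "bounded ((\<lambda>x. L (cis (2 * pi * x))) ` {0..\<delta>})"
    by (intro compact_imp_bounded compact_continuous_image contL) simp
  then obtain B where B: "0 < B" "\<And>x. x \<in> {0..\<delta>} \<Longrightarrow> norm (L (cis (2 * pi * x))) \<le> B"
    by (auto simp: bounded_pos)
  \<comment> \<open>The minimiser of \<open>1 - 2 * \<eta> * e + \<eta>\<^sup>2 * B\<^sup>2\<close>,
    which bounds the squared modulus of \<open>v\<close> on the arc.\<close>
  define \<eta> where "\<eta> = e / B\<^sup>2"
  have \<eta>: "0 < \<eta>" using e B by (simp add: \<eta>_def)
  define v where "v = (\<lambda>z. 1 + of_real \<eta> * L z)"
  define \<theta> where "\<theta> = sqrt (1 - e\<^sup>2 / B\<^sup>2)"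
  have v: "norm (v (cis (2 * pi * x))) \<le> \<theta>" if x: "x \<in> {0..\<delta>}" for x
  proof -
    define l where "l = L (cis (2 * pi * x))"
    have "(norm (v (cis (2 * pi * x))))\<^sup>2 = 1 + 2 * \<eta> * Re l + \<eta>\<^sup>2 * (norm l)\<^sup>2"
      unfolding cmod_power2 by (simp add: v_def l_def power2_eq_square algebra_simps)
    also have "\<dots> \<le> 1 + 2 * \<eta> * (- e) + \<eta>\<^sup>2 * B\<^sup>2"
      using e(2)[OF x] B(2)[OF x] \<eta> by (intro add_mono mult_left_mono power_mono) (auto simp: l_def)
    also have "\<dots> = 1 - e\<^sup>2 / B\<^sup>2" using B by (simp add: \<eta>_def power2_eq_square field_simps)
    finally show ?thesis unfolding \<theta>_def by (rule real_le_rsqrt)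
  qed
  have \<theta>: "0 \<le> \<theta>" "\<theta> < 1"
  proof -
    show "0 \<le> \<theta>" using v[of 0] \<delta> norm_ge_zero order_trans by (metis atLeastAtMost_iff order_refl less_imp_le)
    have "0 < e\<^sup>2 / B\<^sup>2" using e B by simp
    then show "\<theta> < 1" unfolding \<theta>_def by (simp add: real_sqrt_lt_1_iff)
  qed
  show ?thesis
    unfolding arc_approximable_def
  proof (intro allI impI)
    fix \<epsilon> :: real assume "0 < \<epsilon>"
    obtain n where n: "\<theta> ^ n < \<epsilon>" using real_arch_pow_inv[OF \<open>0 < \<epsilon>\<close> \<theta>(2)] by blast
    \<comment> \<open>Since \<open>- \<eta> * z * K z = 1 - v z\<close>, the geometric sum gives
      \<open>z * F z = 1 - v z ^ n\<close>.\<close>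
    define F where "F = (\<lambda>z. - of_real \<eta> * K z * (\<Sum>i<n. v z ^ i))"
    have "F analytic_on cball 0 1"
      unfolding F_def v_def by (intro analytic_intros anK anL)
    moreover have "norm (F (cis (2 * pi * x)) - 1 / cis (2 * pi * x)) < \<epsilon>" if x: "x \<in> {0..\<delta>}" for x
    proof -
      define z where "z = cis (2 * pi * x)"
      have z: "z \<noteq> 0" "norm z = 1" by (auto simp: z_def)
      have "z * F z = (1 - v z) * (\<Sum>i<n. v z ^ i)" by (simp add: F_def v_def L_def)
      also have "\<dots> = 1 - v z ^ n" by (rule one_diff_power_eq[symmetric])
      finally have "F z = (1 - v z ^ n) / z" using z by (metis nonzero_mult_div_cancel_left)
      then have "F z - 1 / z = - (v z ^ n) / z" by (simp add: diff_divide_distrib)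
      then have "norm (F z - 1 / z) = norm (v z) ^ n" using z by (simp add: norm_divide norm_power)
      also have "\<dots> \<le> \<theta> ^ n" using v[OF x] by (intro power_mono) (auto simp: z_def)
      finally show ?thesis using n by (simp add: z_def)
    qed
    ultimately show "\<exists>F. F analytic_on cball 0 1 \<and> (\<forall>x\<in>{0..\<delta>}. norm (F (cis (2 * pi * x)) - 1 / cis (2 * pi * x)) < \<epsilon>)"
      by blast
  qed
qed

text \<open>The approximable real functions form an algebra. Cosine and sine belong to it because
  \<open>1 / z\<close>, the conjugate of \<open>z\<close> on the circle, is approximable; together
  they separate points as the arc is not the full circle.\<close>

lemma arc_approximable_continuous_real:
  fixes u :: "real \<Rightarrow> real"
  assumes \<delta>: "0 < \<delta>" "\<delta> < 1" and u: "continuous_on {0..\<delta>} u"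
  shows "arc_approximable \<delta> (\<lambda>x. of_real (u x))"
proof -
  define P where "P = (\<lambda>u. continuous_on {0..\<delta>} u \<and> arc_approximable \<delta> (\<lambda>x. complex_of_real (u x)))"
  have const: "arc_approximable \<delta> (\<lambda>x. c)" for c
    using arc_approximable_analytic[of "\<lambda>_. c" \<delta>] by simp
  have lin: "arc_approximable \<delta> (\<lambda>x. a * cis (2 * pi * x) + b * (1 / cis (2 * pi * x)))" for a b
    by (intro arc_approximable_add arc_approximable_mult const arc_approximable_inverse[OF \<delta>]
         arc_approximable_analytic[of "\<lambda>z. z"] analytic_intros continuous_intros) auto
  have "\<exists>g. P g \<and> (\<forall>x\<in>{0..\<delta>}. \<bar>u x - g x\<bar> < \<epsilon>)" if "0 < \<epsilon>" for \<epsilon>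
  proof (rule Stone_Weierstrass_HOL[OF compact_Icc _ _ _ _ _ u that])
    show "P (\<lambda>x. c)" for c using const by (simp add: P_def)
    show "continuous_on {0..\<delta>} f" if "P f" for f using that by (simp add: P_def)
    show "P (\<lambda>x. f x + g x)" if "P f \<and> P g" for f g
      using that arc_approximable_add by (auto simp: P_def intro!: continuous_intros)
    show "P (\<lambda>x. f x * g x)" if "P f \<and> P g" for f g
    proof -
      have "arc_approximable \<delta> (\<lambda>x. complex_of_real (f x) * complex_of_real (g x))"
        using that by (intro arc_approximable_mult continuous_on_of_real) (auto simp: P_def)
      then show ?thesis using that by (auto simp: P_def intro!: continuous_intros)
    qed
    show "\<exists>f. P f \<and> f x \<noteq> f y" if "x \<in> {0..\<delta>} \<and> y \<in> {0..\<delta>} \<and> x \<noteq> y" for x y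
    proof -
      have inv: "1 / cis (2 * pi * x) = cis (- (2 * pi * x))" for x by (simp add: cis_inverse[symmetric] inverse_eq_divide)
      have "complex_of_real (cos (2 * pi * x)) = (1 / 2) * cis (2 * pi * x) + (1 / 2) * (1 / cis (2 * pi * x))" for x
        unfolding inv by (simp add: complex_eq_iff)
      then have Pcos: "P (\<lambda>x. cos (2 * pi * x))"
        unfolding P_def using lin[of "1 / 2" "1 / 2"] by (auto intro!: continuous_intros)
      have "complex_of_real (sin (2 * pi * x)) = (- \<i> / 2) * cis (2 * pi * x) + (\<i> / 2) * (1 / cis (2 * pi * x))" for x
        unfolding inv by (simp add: complex_eq_iff)
      then have Psin: "P (\<lambda>x. sin (2 * pi * x))"
        unfolding P_def using lin[of "- \<i> / 2" "\<i> / 2"] by (auto intro!: continuous_intros)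
      have "cis (2 * pi * x) \<noteq> cis (2 * pi * y)"
      proof
        assume "cis (2 * pi * x) = cis (2 * pi * y)"
        then obtain n :: int where n: "x = y + n" by (auto simp: cis_2pi_eq_iff)
        have "\<bar>x - y\<bar> < 1" using that \<delta> by auto
        then have "\<bar>real_of_int n\<bar> < 1" using n by simp
        then have "n = 0" by linarith
        then show False using n that by simp
      qed
      then have "cos (2 * pi * x) \<noteq> cos (2 * pi * y) \<or> sin (2 * pi * x) \<noteq> sin (2 * pi * y)"
        by (auto simp: complex_eq_iff)
      then show ?thesis using Pcos Psin by blast
    qed
  qed
  then show ?thesis
    unfolding arc_approximable_def
  proof (intro allI impI)
    fix \<epsilon> :: real assume ex: "\<And>\<epsilon>. 0 < \<epsilon> \<Longrightarrow> \<exists>g. P g \<and> (\<forall>x\<in>{0..\<delta>}. \<bar>u x - g x\<bar> < \<epsilon>)" and "0 < \<epsilon>"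
    then have e2: "0 < \<epsilon> / 2" by simp
    obtain g where g: "P g" "\<And>x. x \<in> {0..\<delta>} \<Longrightarrow> \<bar>u x - g x\<bar> < \<epsilon> / 2" using ex[OF e2] by blast
    obtain F where F: "F analytic_on cball 0 1" "\<And>x. x \<in> {0..\<delta>} \<Longrightarrow> norm (F (cis (2 * pi * x)) - of_real (g x)) < \<epsilon> / 2"
      using g(1) e2 unfolding P_def arc_approximable_def by meson
    have "norm (F (cis (2 * pi * x)) - of_real (u x)) < \<epsilon>" if "x \<in> {0..\<delta>}" for x
    proof -
      have "norm (complex_of_real (g x) - of_real (u x)) < \<epsilon> / 2"
        using g(2)[OF that] by (simp add: abs_minus_commute flip: of_real_diff)
      then show ?thesis
        using F(2)[OF that] norm_triangle_ineq[of "F (cis (2 * pi * x)) - of_real (g x)" "of_real (g x) - of_real (u x)"]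
        by simp
    qed
    then show "\<exists>F. F analytic_on cball 0 1 \<and> (\<forall>x\<in>{0..\<delta>}. norm (F (cis (2 * pi * x)) - of_real (u x)) < \<epsilon>)"
      using F(1) by blast
  qed
qed

lemma arc_approximable_continuous:
  assumes \<delta>: "0 < \<delta>" "\<delta> < 1" and u: "continuous_on {0..\<delta>} u"
  shows "arc_approximable \<delta> u"
proof -
  have i: "arc_approximable \<delta> (\<lambda>x. \<i>)"
    using arc_approximable_analytic[of "\<lambda>_. \<i>" \<delta>] by simp
  have "arc_approximable \<delta> (\<lambda>x. of_real (Re (u x)) + \<i> * of_real (Im (u x)))"
    by (intro arc_approximable_add arc_approximable_mult i arc_approximable_continuous_real[OF \<delta>]
         continuous_on_of_real continuous_on_Re continuous_on_Im continuous_on_const u)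
  then show ?thesis by (simp add: complex_eq[symmetric])
qed

section \<open>A countable dense family of polynomials\<close>

text \<open>Horner's scheme on a coefficient list whose type is countable, so the targets can be
  enumerated by natural numbers.\<close>

definition rat_poly :: "(rat \<times> rat) list \<Rightarrow> complex \<Rightarrow> complex" where
  "rat_poly l z = foldr (\<lambda>(a, b) s. Complex (of_rat a) (of_rat b) + z * s) l 0"

lemma rat_poly_analytic: "rat_poly l analytic_on S"
proof (induction l)
  case Nil
  show ?case by (simp add: rat_poly_def[abs_def])
next
  case (Cons p l)
  have "rat_poly (p # l) = (\<lambda>z. Complex (of_rat (fst p)) (of_rat (snd p)) + z * rat_poly l z)"
    by (auto simp: rat_poly_def split_beta)
  then show ?case using Cons by (auto intro!: analytic_intros)
qed

lemma rat_complex_dense: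
  assumes "0 < \<epsilon>"
  obtains p :: "rat \<times> rat" where "norm (Complex (of_rat (fst p)) (of_rat (snd p)) - c) < \<epsilon>"
proof -
  obtain a :: rat where a: "Re c < of_rat a" "of_rat a < Re c + \<epsilon> / 2"
    using of_rat_dense[of "Re c" "Re c + \<epsilon> / 2"] assms by auto
  obtain b :: rat where b: "Im c < of_rat b" "of_rat b < Im c + \<epsilon> / 2"
    using of_rat_dense[of "Im c" "Im c + \<epsilon> / 2"] assms by auto
  have "norm (Complex (of_rat a) (of_rat b) - c) \<le> \<bar>of_rat a - Re c\<bar> + \<bar>of_rat b - Im c\<bar>"
    using cmod_le[of "Complex (of_rat a) (of_rat b) - c"] by simp
  also have "\<dots> < \<epsilon>" using a b by linarith
  finally show ?thesis using that[of "(a, b)"] by simp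
qed

text \<open>Induction along Horner's scheme: multiplication by \<open>z\<close> does not enlarge
  errors on the unit disc, so each step only adds the error of one coefficient.\<close>

lemma rat_poly_dense:
  assumes "0 < \<epsilon>"
  shows "\<exists>l. \<forall>z\<in>cball 0 1. norm (rat_poly l z - (\<Sum>n<N. c n * z ^ n)) < \<epsilon>"
  using assms
proof (induction N arbitrary: c \<epsilon>)
  case 0
  then show ?case by (intro exI[of _ "[]"]) (simp add: rat_poly_def)
next
  case (Suc N)
  have e2: "0 < \<epsilon> / 2" using Suc.prems by simp
  obtain l where l: "\<And>z. z \<in> cball 0 1 \<Longrightarrow> norm (rat_poly l z - (\<Sum>n<N. c (Suc n) * z ^ n)) < \<epsilon> / 2"
    using Suc.IH[OF e2, of "\<lambda>n. c (Suc n)"] by blast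
  obtain p :: "rat \<times> rat" where p: "norm (Complex (of_rat (fst p)) (of_rat (snd p)) - c 0) < \<epsilon> / 2"
    using rat_complex_dense[OF e2] by blast
  have "norm (rat_poly (p # l) z - (\<Sum>n<Suc N. c n * z ^ n)) < \<epsilon>" if z: "z \<in> cball 0 1" for z
  proof -
    let ?d = "rat_poly l z - (\<Sum>n<N. c (Suc n) * z ^ n)"
    let ?p = "Complex (of_rat (fst p)) (of_rat (snd p)) - c 0"
    have "(\<Sum>n<Suc N. c n * z ^ n) = c 0 + z * (\<Sum>n<N. c (Suc n) * z ^ n)"
      unfolding sum.lessThan_Suc_shift by (simp add: sum_distrib_left mult_ac)
    moreover have "rat_poly (p # l) z = Complex (of_rat (fst p)) (of_rat (snd p)) + z * rat_poly l z"
      by (simp add: rat_poly_def split_beta)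
    ultimately have "rat_poly (p # l) z - (\<Sum>n<Suc N. c n * z ^ n) = ?p + z * ?d"
      by (simp add: algebra_simps)
    also have "norm \<dots> \<le> norm ?p + norm z * norm ?d"
      unfolding norm_mult[symmetric] by (rule norm_triangle_ineq)
    also have "norm z * norm ?d \<le> 1 * norm ?d" using z by (intro mult_right_mono) auto
    finally show ?thesis using p l[OF z] by linarith
  qed
  then show ?case by blast
qed

lemma rat_poly_dense_analytic:
  assumes F: "F analytic_on cball 0 1" and "0 < \<epsilon>"
  obtains l where "\<And>z. z \<in> cball 0 1 \<Longrightarrow> norm (rat_poly l z - F z) < \<epsilon>"
proof -
  have e2: "0 < \<epsilon> / 2" using \<open>0 < \<epsilon>\<close> by simp
  have "\<forall>\<^sub>F N in sequentially. \<forall>z\<in>cball 0 1. dist (Taylor_poly N (disc_restrict F) z) (F z) < \<epsilon> / 2"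
    by (rule uniform_limitD[OF uniform_limit_Taylor_poly[OF F] e2])
  then obtain N where N: "\<And>z. z \<in> cball 0 1 \<Longrightarrow> norm (Taylor_poly N (disc_restrict F) z - F z) < \<epsilon> / 2"
    unfolding eventually_sequentially dist_norm by blast
  obtain l where l: "\<And>z. z \<in> cball 0 1 \<Longrightarrow> norm (rat_poly l z - (\<Sum>n<Suc N. fps_nth (fps_expansion (disc_restrict F) 0) n * z ^ n)) < \<epsilon> / 2"
    using rat_poly_dense[OF e2, where N = "Suc N" and c = "\<lambda>n. fps_nth (fps_expansion (disc_restrict F) 0) n"] by blast
  have "norm (rat_poly l z - F z) < \<epsilon>" if z: "z \<in> cball 0 1" for z
  proof -
    have "norm (rat_poly l z - Taylor_poly N (disc_restrict F) z) < \<epsilon> / 2"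
      using l[OF z] by (simp only: Taylor_poly_def lessThan_Suc_atMost)
    then show ?thesis
      using N[OF z] norm_triangle_ineq[of "rat_poly l z - Taylor_poly N (disc_restrict F) z" "Taylor_poly N (disc_restrict F) z - F z"] by simp
  qed
  then show ?thesis using that by blast
qed

lemma rat_poly_dense_arc:
  assumes \<delta>: "0 < \<delta>" "\<delta> < 1" and u: "continuous_on {0..\<delta>} u" and "0 < \<epsilon>"
  shows "\<exists>l. \<forall>x\<in>{0..\<delta>}. norm (rat_poly l (cis (2 * pi * x)) - u x) < \<epsilon>"
proof -
  have e2: "0 < \<epsilon> / 2" using \<open>0 < \<epsilon>\<close> by simp
  obtain F where F: "F analytic_on cball 0 1" "\<And>x. x \<in> {0..\<delta>} \<Longrightarrow> norm (F (cis (2 * pi * x)) - u x) < \<epsilon> / 2"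
    using arc_approximable_continuous[OF \<delta> u] e2 unfolding arc_approximable_def by meson
  obtain l where l: "\<And>z. z \<in> cball 0 1 \<Longrightarrow> norm (rat_poly l z - F z) < \<epsilon> / 2"
    using rat_poly_dense_analytic[OF F(1) e2] by blast
  have "norm (rat_poly l (cis (2 * pi * x)) - u x) < \<epsilon>" if "x \<in> {0..\<delta>}" for x
    using l[of "cis (2 * pi * x)"] F(2)[OF that]
      norm_triangle_ineq[of "rat_poly l (cis (2 * pi * x)) - F (cis (2 * pi * x))" "F (cis (2 * pi * x)) - u x"]
    by simp
  then show ?thesis by blast
qed

section \<open>Universal Menshov pairs\<close>

definition circle_arc :: "real \<Rightarrow> complex set" where
  "circle_arc \<delta> = (\<lambda>x. cis (2 * pi * x)) ` {0..\<delta>}"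

lemma circle_arc_subset: "circle_arc \<delta> \<subseteq> sphere 0 1"
  by (auto simp: circle_arc_def)

lemma compact_circle_arc: "compact (circle_arc \<delta>)"
  unfolding circle_arc_def by (intro compact_continuous_image continuous_intros) auto

text \<open>The parameter 1 describes the same point as 0; this single exception is a null set and
  is discarded later.\<close>

lemma cis_in_circle_arc_iff:
  assumes \<delta>: "0 < \<delta>" "\<delta> < 1" and x: "x \<in> {0..1}"
  shows "cis (2 * pi * x) \<in> circle_arc \<delta> \<longleftrightarrow> x \<le> \<delta> \<or> x = 1"
proof
  assume "cis (2 * pi * x) \<in> circle_arc \<delta>"
  then obtain y where y: "y \<in> {0..\<delta>}" "cis (2 * pi * x) = cis (2 * pi * y)" by (auto simp: circle_arc_def)
  then obtain n :: int where n: "x = y + n" by (auto simp: cis_2pi_eq_iff)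
  have "- 1 < real_of_int n" "real_of_int n \<le> 1" using n x y \<delta> by auto
  then have "n = 0 \<or> n = 1" by linarith
  then show "x \<le> \<delta> \<or> x = 1" using n x y by auto
next
  assume "x \<le> \<delta> \<or> x = 1"
  moreover have "cis (2 * pi * 1) = cis (2 * pi * 0)" by (simp only: cis_2pi mult_1_right) simp
  ultimately show "cis (2 * pi * x) \<in> circle_arc \<delta>"
    using x \<delta> unfolding circle_arc_def by (metis atLeastAtMost_iff image_eqI less_imp_le order_refl)
qed

text \<open>The measure before completion. Image measures are handled here, and the results are
  carried to \<open>circle_measure\<close> afterwards.\<close>

abbreviation borel_circle_measure :: "complex measure" where
  "borel_circle_measure \<equiv> distr (uniform_measure lborel {0..1}) (restrict_space borel (sphere 0 1))
                       (\<lambda>t. cis (2 * pi * t))"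

lemma sets_borel_circle_measure:
  "A \<in> sets borel \<Longrightarrow> A \<subseteq> sphere 0 1 \<Longrightarrow> A \<in> sets borel_circle_measure"
  by (simp add: sets_restrict_space_iff)

lemma circle_arc_sets: "circle_arc \<delta> \<in> sets circle_measure"
  unfolding circle_measure_def
  by (intro sets_completionI_sets sets_borel_circle_measure borel_compact compact_circle_arc circle_arc_subset)

lemma measure_circle_arc:
  assumes \<delta>: "0 < \<delta>" "\<delta> < 1"
  shows "measure circle_measure (circle_arc \<delta>) = \<delta>"
proof -
  have s: "circle_arc \<delta> \<in> sets borel_circle_measure"
    by (intro sets_borel_circle_measure borel_compact compact_circle_arc circle_arc_subset)
  let ?V = "(\<lambda>t. cis (2 * pi * t)) -` circle_arc \<delta>"
  have V: "?V \<in> sets borel"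
    by (intro borel_closed closed_vimage compact_imp_closed compact_circle_arc continuous_intros)
  have "emeasure circle_measure (circle_arc \<delta>) = emeasure borel_circle_measure (circle_arc \<delta>)"
    unfolding circle_measure_def using s by (simp add: emeasure_completion main_part_sets)
  also have "\<dots> = emeasure (uniform_measure lborel {0..1}) ?V"
    using s by (subst emeasure_distr[OF circle_param_measurable]) simp_all
  also have "\<dots> = emeasure lborel ({0..1} \<inter> ?V)"
    using V by (simp add: divide_ennreal_def)
  also have "\<dots> = emeasure lborel {0..\<delta>}"
  proof (rule emeasure_eq_AE)
    show "AE x in lborel. x \<in> {0..1} \<inter> ?V \<longleftrightarrow> x \<in> {0..\<delta>}"
      using AE_lborel_singleton[of "1::real"]
    proof (rule eventually_mono)
      fix x :: real assume "x \<noteq> 1"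
      then show "x \<in> {0..1} \<inter> ?V \<longleftrightarrow> x \<in> {0..\<delta>}"
        using cis_in_circle_arc_iff[OF \<delta>, of x] \<delta> by (cases "x \<in> {0..1}") auto
    qed
  qed (use V in auto)
  also have "\<dots> = ennreal \<delta>" using \<delta> by simp
  finally show ?thesis using \<delta> by (simp add: measure_def)
qed

text \<open>Measurability of \<open>P\<close> is required before completion, since the
  almost-everywhere statement is pulled through the image measure as an equivalence.\<close>

lemma AE_circle_arcI:
  assumes \<delta>: "0 < \<delta>" "\<delta> < 1" and P: "Measurable.pred borel_circle_measure P"
    and AE: "AE x in lborel. x \<in> {0..\<delta>} \<longrightarrow> P (cis (2 * pi * x))"
  shows "AE \<zeta> in restrict_space circle_measure (circle_arc \<delta>). P \<zeta>"
proof -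
  have s: "circle_arc \<delta> \<in> sets borel_circle_measure"
    by (intro sets_borel_circle_measure borel_compact compact_circle_arc circle_arc_subset)
  have "AE x in lborel. x \<in> {0..1} \<longrightarrow> cis (2 * pi * x) \<in> circle_arc \<delta> \<longrightarrow> P (cis (2 * pi * x))"
    using AE AE_lborel_singleton[of "1::real"]
  proof eventually_elim
    case (elim x)
    then show ?case using cis_in_circle_arc_iff[OF \<delta>, of x] by auto
  qed
  then have "AE x in uniform_measure lborel {0..1}. cis (2 * pi * x) \<in> circle_arc \<delta> \<longrightarrow> P (cis (2 * pi * x))"
    by (intro AE_uniform_measureI) auto
  moreover have "{\<zeta> \<in> space (restrict_space borel (sphere 0 1)). \<zeta> \<in> circle_arc \<delta> \<longrightarrow> P \<zeta>} \<in> sets (restrict_space borel (sphere 0 1))"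
  proof -
    have [measurable]: "Measurable.pred (restrict_space borel (sphere 0 1)) P" using P by (simp cong: measurable_cong_sets)
    have [measurable]: "circle_arc \<delta> \<in> sets (restrict_space borel (sphere 0 1))" using s by simp
    show ?thesis by measurable
  qed
  ultimately have "AE \<zeta> in borel_circle_measure. \<zeta> \<in> circle_arc \<delta> \<longrightarrow> P \<zeta>"
    by (subst AE_distr_iff[OF circle_param_measurable]) auto
  then have "AE \<zeta> in circle_measure. \<zeta> \<in> circle_arc \<delta> \<longrightarrow> P \<zeta>"
    unfolding circle_measure_def by (rule AE_completion)
  then show ?thesis
    by (subst AE_restrict_space_iff) (auto intro: sets.Int circle_arc_sets)
qed

text \<open>A Lebesgue measurable target is traded for a Borel one, so that convergence to it is a
  predicate admissible in \<open>AE_circle_arcI\<close>. After extension by zero, real and imaginary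
  parts are replaced separately.\<close>

lemma ex_borel_version_on_arc:
  fixes g :: "complex \<Rightarrow> complex"
  assumes g: "g \<in> borel_measurable (restrict_space circle_measure (circle_arc \<delta>))"
  obtains g1 where "g1 \<in> borel_measurable borel_circle_measure"
    "AE \<zeta> in restrict_space circle_measure (circle_arc \<delta>). g \<zeta> = g1 \<zeta>"
proof -
  have E: "circle_arc \<delta> \<inter> space circle_measure \<in> sets circle_measure"
    by (intro sets.Int circle_arc_sets) auto
  define h where "h = (\<lambda>\<zeta>. if \<zeta> \<in> circle_arc \<delta> then g \<zeta> else 0)"
  have "h \<in> borel_measurable circle_measure"
    using g measurable_restrict_space_iff[OF E, of 0 borel g] by (simp add: h_def)
  then have h: "h \<in> borel_measurable (completion borel_circle_measure)"
    by (simp add: circle_measure_def)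
  then have "(\<lambda>\<zeta>. Re (h \<zeta>)) \<in> borel_measurable (completion borel_circle_measure)"
    by measurable
  then obtain r where r: "r \<in> borel_measurable borel_circle_measure" "AE \<zeta> in borel_circle_measure. Re (h \<zeta>) = r \<zeta>"
    using completion_ex_borel_measurable_real by blast
  have "(\<lambda>\<zeta>. Im (h \<zeta>)) \<in> borel_measurable (completion borel_circle_measure)"
    using h by measurable
  then obtain i where i: "i \<in> borel_measurable borel_circle_measure" "AE \<zeta> in borel_circle_measure. Im (h \<zeta>) = i \<zeta>"
    using completion_ex_borel_measurable_real by blast
  define g1 where "g1 = (\<lambda>\<zeta>. complex_of_real (r \<zeta>) + \<i> * complex_of_real (i \<zeta>))"
  have "g1 \<in> borel_measurable borel_circle_measure"
  proof -
    have of_real: "complex_of_real \<in> borel_measurable borel"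
      by (intro borel_measurable_continuous_onI continuous_intros)
    show ?thesis
      unfolding g1_def
      by (intro borel_measurable_add borel_measurable_times borel_measurable_const
          measurable_compose[OF r(1) of_real] measurable_compose[OF i(1) of_real])
  qed
  moreover have "AE \<zeta> in restrict_space circle_measure (circle_arc \<delta>). g \<zeta> = g1 \<zeta>"
  proof -
    have "AE \<zeta> in borel_circle_measure. \<zeta> \<in> circle_arc \<delta> \<longrightarrow> g \<zeta> = g1 \<zeta>"
      using r(2) i(2)
    proof eventually_elim
      case (elim \<zeta>)
      then show ?case by (auto simp: h_def g1_def complex_eq_iff)
    qed
    then have "AE \<zeta> in circle_measure. \<zeta> \<in> circle_arc \<delta> \<longrightarrow> g \<zeta> = g1 \<zeta>"
      unfolding circle_measure_def by (rule AE_completion)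
    then show ?thesis by (simp add: AE_restrict_space_iff[OF E])
  qed
  ultimately show ?thesis using that by blast
qed

section \<open>Open dense sets and almost everywhere convergence\<close>

text \<open>A bound \<open>s\<close> strictly below \<open>2\<^sup>-\<^sup>k\<close>, uniform off \<open>B\<close>, is what makes this condition open.\<close>

definition near_target :: "(real \<Rightarrow> real) \<Rightarrow> real \<Rightarrow> (rat \<times> rat) list \<Rightarrow> nat \<Rightarrow> (complex \<Rightarrow> complex) set" where
  "near_target w \<delta> l k = {f \<in> Bloch0 w. \<exists>N\<ge>k. \<exists>B\<in>fmeasurable lborel. \<exists>s < (1 / 2) ^ k.
     measure lborel B \<le> (1 / 2) ^ k \<and>
     (\<forall>x\<in>{0..\<delta>} - B. norm (Taylor_poly N f (cis (2 * pi * x)) - rat_poly l (cis (2 * pi * x))) \<le> s)}"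

text \<open>The same \<open>N\<close> and \<open>B\<close> serve all neighbours of \<open>f\<close>,
  because \<open>Taylor_poly N\<close> is continuous in the Bloch metric, uniformly on the circle.
  Half of the slack below \<open>(1 / 2) ^ k\<close> is spent.\<close>

lemma openin_near_target:
  assumes maj: "majorant w"
  shows "openin (Bloch0_topology w) (near_target w \<delta> l k)"
proof -
  interpret Metric_space "Bloch0 w" "Bloch_dist w" by (rule Metric_space_Bloch0[OF maj])
  have "\<exists>r>0. mball f r \<subseteq> near_target w \<delta> l k" if mem: "f \<in> near_target w \<delta> l k" for f
  proof -
    obtain N B s where f: "f \<in> Bloch0 w" and N: "N \<ge> k" and B: "B \<in> fmeasurable lborel" "measure lborel B \<le> (1 / 2) ^ k"
      and s: "s < (1 / 2) ^ k" "\<And>x. x \<in> {0..\<delta>} - B \<Longrightarrow>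
        norm (Taylor_poly N f (cis (2 * pi * x)) - rat_poly l (cis (2 * pi * x))) \<le> s"
      using mem unfolding near_target_def by blast
    define C where "C = (1 + 2 * w 1) * (\<Sum>n\<le>N. 2 ^ n :: real)"
    have C: "0 < C"
      unfolding C_def using majorant_pos[OF maj, of 1] by (intro mult_pos_pos sum_pos add_pos_pos) auto
    define t where "t = ((1 / 2) ^ k - s) / 2"
    have t: "0 < t" "s + t < (1 / 2) ^ k" using s(1) by (simp_all add: t_def field_simps)
    have "mball f (t / C) \<subseteq> near_target w \<delta> l k"
    proof
      fix h assume "h \<in> mball f (t / C)"
      then have h: "h \<in> Bloch0 w" "Bloch_dist w h f < t / C" by (auto simp: in_mball commute)
      have "norm (Taylor_poly N h (cis (2 * pi * x)) - rat_poly l (cis (2 * pi * x))) \<le> s + t"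
        if x: "x \<in> {0..\<delta>} - B" for x
      proof -
        have "norm (Taylor_poly N h (cis (2 * pi * x)) - Taylor_poly N f (cis (2 * pi * x))) \<le> Bloch_dist w h f * C"
          unfolding C_def by (rule Taylor_poly_diff_le[OF maj h(1) f]) simp
        also have "\<dots> \<le> t / C * C" using h(2) C by (intro mult_right_mono) auto
        also have "\<dots> = t" using C by simp
        finally show ?thesis
          using s(2)[OF x] norm_triangle_ineq[of "Taylor_poly N h (cis (2 * pi * x)) - Taylor_poly N f (cis (2 * pi * x))"
              "Taylor_poly N f (cis (2 * pi * x)) - rat_poly l (cis (2 * pi * x))"] by simp
      qed
      then show "h \<in> near_target w \<delta> l k"
        unfolding near_target_def using h(1) N B t(2) by blast
    qed
    then show ?thesis using t(1) C by (intro exI[of _ "t / C"]) simp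
  qed
  then show ?thesis
    unfolding Bloch0_topology_def openin_mtopology by (auto simp: near_target_def)
qed

text \<open>After replacing \<open>f\<close> by a nearby \<open>F\<close> analytic past the closed
  disc, a Bloch-small \<open>p\<close> close in measure to \<open>rat_poly l - F\<close> is added.
  The sum is close to the target off a small set and its Taylor polynomials converge uniformly, so a
  large \<open>N\<close> works.\<close>

lemma dense_near_target:
  fixes w :: "real \<Rightarrow> real"
  assumes maj: "majorant w"
    and int: "(\<integral>\<^sup>+ t\<in>{0<..1}. ennreal ((w t)\<^sup>2 / t) \<partial>lborel) = \<infinity>" and \<delta>: "0 < \<delta>" "\<delta> < 1"
  shows "Bloch0_topology w closure_of near_target w \<delta> l k = Bloch0 w"
proof -
  interpret Metric_space "Bloch0 w" "Bloch_dist w" by (rule Metric_space_Bloch0[OF maj])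
  have "\<exists>h\<in>near_target w \<delta> l k. h \<in> mball f r" if f: "f \<in> Bloch0 w" and r: "0 < r" for f r
  proof -
    obtain F where F: "F analytic_on cball 0 1" "Bloch_dist w f (disc_restrict F) < r / 2"
      using ex_analytic_near_Bloch0[OF maj f half_gt_zero[OF r]] by blast
    \<comment> \<open>\<open>\<epsilon>\<close> is spent twice on the circle, by the Taylor
      remainder and by \<open>p - h\<close>, and \<open>2 * \<epsilon>\<close> must stay strictly
      below \<open>(1 / 2) ^ k\<close>.\<close>
    define \<epsilon> where "\<epsilon> = min (r / 4) ((1 / 2) ^ k / 4)"
    have \<epsilon>: "0 < \<epsilon>" "\<epsilon> \<le> r / 4" "\<epsilon> \<le> (1 / 2) ^ k / 4" using r by (auto simp: \<epsilon>_def)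
    define h where "h = (\<lambda>z. rat_poly l z - F z)"
    have anh: "h analytic_on cball 0 1" unfolding h_def by (intro analytic_intros rat_poly_analytic F)
    obtain p where p: "p analytic_on cball 0 1" "p 0 = 0"
      "\<And>z. z \<in> ball 0 1 \<Longrightarrow> (1 - norm z) * norm (deriv p z) \<le> \<epsilon> * w (1 - norm z)"
      "measure lborel {x\<in>{0..1}. \<epsilon> \<le> norm (p (cis (2 * pi * x)) - h (cis (2 * pi * x)))} \<le> \<epsilon>"
      using ex_simultaneous_approximation[OF maj int anh \<epsilon>(1)] by blast
    define G where "G = (\<lambda>z. F z + p z)"
    have anG: "G analytic_on cball 0 1" unfolding G_def by (intro analytic_intros F p)
    note FB = disc_restrict_in_Bloch0[OF maj F(1)] and GB = disc_restrict_in_Bloch0[OF maj anG]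
    have "Bloch_dist w (disc_restrict F) (disc_restrict G) \<le> 0 + \<epsilon>"
    proof (rule Bloch_dist_le[OF maj FB GB])
      show "norm (disc_restrict F 0 - disc_restrict G 0) \<le> 0" by (simp add: G_def p(2))
      fix z :: complex assume z: "z \<in> ball 0 1"
      have hol: "F holomorphic_on ball 0 1" "p holomorphic_on ball 0 1" "G holomorphic_on ball 0 1"
        using F p anG by (simp_all add: analytic_cball_holomorphic)
      have "deriv G z = deriv F z + deriv p z"
        unfolding G_def using holomorphic_on_imp_differentiable_at[OF hol(1) open_ball z]
          holomorphic_on_imp_differentiable_at[OF hol(2) open_ball z] by (rule deriv_add)
      then show "(1 - norm z) * norm (deriv (disc_restrict F) z - deriv (disc_restrict G) z) \<le> \<epsilon> * w (1 - norm z)"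
        using p(3)[OF z] by (simp add: deriv_disc_restrict[OF _ z] hol)
    qed
    then have "Bloch_dist w f (disc_restrict G) < r"
      using triangle[OF f FB GB] F(2) \<epsilon>(2) r by linarith
    then have "disc_restrict G \<in> mball f r" using f GB by (simp add: in_mball)
    moreover have "disc_restrict G \<in> near_target w \<delta> l k"
    proof -
      have "\<forall>\<^sub>F N in sequentially. \<forall>z\<in>cball 0 1. dist (Taylor_poly N (disc_restrict G) z) (G z) < \<epsilon>"
        by (rule uniform_limitD[OF uniform_limit_Taylor_poly[OF anG] \<epsilon>(1)])
      then obtain N0 where N0: "\<And>N z. N \<ge> N0 \<Longrightarrow> z \<in> cball 0 1 \<Longrightarrow> norm (Taylor_poly N (disc_restrict G) z - G z) < \<epsilon>"
        unfolding eventually_sequentially dist_norm by blast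
      define N where "N = max k N0"
      define B where "B = {x\<in>{0..1}. \<epsilon> \<le> norm (p (cis (2 * pi * x)) - h (cis (2 * pi * x)))}"
      have "B \<in> fmeasurable lborel" unfolding B_def
        by (intro fmeasurable_compact compact_superlevel_01 continuous_on_norm continuous_on_diff
             continuous_on_circle_param analytic_cball_continuous p anh)
      moreover have "measure lborel B \<le> (1 / 2) ^ k" using p(4) \<epsilon> unfolding B_def by linarith
      moreover have "2 * \<epsilon> < (1 / 2) ^ k" using \<epsilon> by linarith
      moreover have "norm (Taylor_poly N (disc_restrict G) (cis (2 * pi * x)) - rat_poly l (cis (2 * pi * x))) \<le> 2 * \<epsilon>"
        if x: "x \<in> {0..\<delta>} - B" for x
      proof -
        let ?z = "cis (2 * pi * x)"
        have 1: "norm (p ?z - h ?z) < \<epsilon>" using x \<delta> by (auto simp: B_def)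
        have eq: "Taylor_poly N (disc_restrict G) ?z - rat_poly l ?z
            = (Taylor_poly N (disc_restrict G) ?z - G ?z) + (p ?z - h ?z)" by (simp add: G_def h_def)
        have 2: "norm (Taylor_poly N (disc_restrict G) ?z - G ?z) < \<epsilon>"
          by (rule N0) (auto simp: N_def)
        show ?thesis
          unfolding eq using 1 2
            norm_triangle_ineq[of "Taylor_poly N (disc_restrict G) ?z - G ?z" "p ?z - h ?z"] by linarith
      qed
      moreover have "k \<le> N" by (simp add: N_def)
      ultimately show ?thesis
        unfolding near_target_def using GB by blast
    qed
    ultimately show ?thesis by blast
  qed
  then show ?thesis
    unfolding Bloch0_topology_def metric_closure_of by blast
qed

text \<open>The target is an almost everywhere limit of continuous functions, each within
  \<open>(1 / 2) ^ i\<close> of a rational polynomial on the arc. The exceptional sets for these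
  polynomials have summable measures, so almost every point lies in only finitely many of
  them.\<close>

lemma universal_Menshov_pair_arc:
  assumes \<delta>: "0 < \<delta>" "\<delta> < 1" and f: "f \<in> Bloch0 w" "\<And>l k. f \<in> near_target w \<delta> l k"
  shows "universal_Menshov_pair (Bloch0 w) f (circle_arc \<delta>)"
  unfolding universal_Menshov_pair_def
proof (intro conjI allI impI f(1) circle_arc_sets)
  fix g :: "complex \<Rightarrow> complex"
  assume "g \<in> borel_measurable (restrict_space circle_measure (circle_arc \<delta>))"
  then obtain g1 where g1: "g1 \<in> borel_measurable borel_circle_measure"
    "AE \<zeta> in restrict_space circle_measure (circle_arc \<delta>). g \<zeta> = g1 \<zeta>"
    using ex_borel_version_on_arc by blast
  define G where "G = (\<lambda>x. g1 (cis (2 * pi * x)))"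
  have "G \<in> borel_measurable (uniform_measure lborel {0..1})"
    unfolding G_def using g1(1) by (intro measurable_compose[OF circle_param_measurable]) (simp cong: measurable_cong_sets)
  then have "G \<in> borel_measurable lebesgue"
    by (intro measurable_completion) (simp cong: measurable_cong_sets)
  then have "G measurable_on UNIV"
    by (rule lebesgue_measurable_imp_measurable_on) simp
  then obtain Z u where Z: "negligible Z" and u: "\<And>n. continuous_on UNIV (u n)"
      "\<And>x. x \<notin> Z \<Longrightarrow> (\<lambda>n. u n x) \<longlonglongrightarrow> G x"
    unfolding measurable_on_def by auto
  have "\<exists>l. \<forall>x\<in>{0..\<delta>}. norm (rat_poly l (cis (2 * pi * x)) - u i x) < (1 / 2) ^ i" for i
    by (rule rat_poly_dense_arc[OF \<delta>]) (auto intro: continuous_on_subset[OF u(1)])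
  then obtain l where l: "\<And>i x. x \<in> {0..\<delta>} \<Longrightarrow> norm (rat_poly (l i) (cis (2 * pi * x)) - u i x) < (1 / 2) ^ i"
    by metis
  let ?P = "\<lambda>i N. \<exists>B\<in>fmeasurable lborel. measure lborel B \<le> (1 / 2) ^ i \<and>
     (\<forall>x\<in>{0..\<delta>} - B. norm (Taylor_poly N f (cis (2 * pi * x)) - rat_poly (l i) (cis (2 * pi * x))) \<le> (1 / 2) ^ i)"
  have step: "\<exists>N. ?P i N \<and> M < N" for i M
  proof -
    \<comment> \<open>One index serves both demands: \<open>k \<ge> i\<close> gives the precision,
      and \<open>N \<ge> k > M\<close> makes the subsequence increase.\<close>
    define k where "k = max i (Suc M)"
    have ki: "(1 / 2 :: real) ^ k \<le> (1 / 2) ^ i" by (intro power_decreasing) (auto simp: k_def)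
    obtain N B s where N: "N \<ge> k" and B: "B \<in> fmeasurable lborel" "measure lborel B \<le> (1 / 2) ^ k"
      and s: "s < (1 / 2) ^ k" "\<And>x. x \<in> {0..\<delta>} - B \<Longrightarrow>
        norm (Taylor_poly N f (cis (2 * pi * x)) - rat_poly (l i) (cis (2 * pi * x))) \<le> s"
      using f(2)[of "l i" k] unfolding near_target_def by blast
    have "?P i N"
    proof (intro bexI[of _ B] conjI ballI)
      fix x assume "x \<in> {0..\<delta>} - B"
      from s(2)[OF this] show "norm (Taylor_poly N f (cis (2 * pi * x)) - rat_poly (l i) (cis (2 * pi * x))) \<le> (1 / 2) ^ i"
        using s(1) ki by linarith
    qed (fact order_trans[OF B(2) ki] B(1))+
    moreover have "M < N" using N by (simp add: k_def)
    ultimately show ?thesis by blast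
  qed
  have "\<exists>n. \<forall>i. ?P i (n i) \<and> n i < n (Suc i)"
    by (rule dependent_nat_choice) (use step in blast)+
  then obtain n where n: "\<And>i. ?P i (n i)" "\<And>i. n i < n (Suc i)" by blast
  obtain B where B: "\<And>i. B i \<in> fmeasurable lborel" "\<And>i. measure lborel (B i) \<le> (1 / 2) ^ i"
    "\<And>i x. x \<in> {0..\<delta>} - B i \<Longrightarrow> norm (Taylor_poly (n i) f (cis (2 * pi * x)) - rat_poly (l i) (cis (2 * pi * x))) \<le> (1 / 2) ^ i"
    using n(1) by metis
  have "summable (\<lambda>i. measure lborel (B i))"
    by (rule summable_comparison_test'[of "\<lambda>i. (1 / 2) ^ i" 0]) (use B(2) in auto)
  then have bc: "AE x in lborel. eventually (\<lambda>i. x \<in> space lborel - B i) sequentially"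
    using B(1) by (intro borel_cantelli_AE1) (auto simp: fmeasurable_def)
  have "AE x in lebesgue. x \<notin> Z"
    using Z by (intro AE_not_in) (simp add: negligible_iff_null_sets)
  then have Z': "AE x in lborel. x \<notin> Z" by (simp add: AE_completion_iff)
  have conv: "AE x in lborel. x \<in> {0..\<delta>} \<longrightarrow> (\<lambda>i. norm (Taylor_poly (n i) f (cis (2 * pi * x)) - g1 (cis (2 * pi * x)))) \<longlonglongrightarrow> 0"
    using bc Z'
  proof (eventually_elim, intro impI)
    fix x assume ev: "eventually (\<lambda>i. x \<in> space lborel - B i) sequentially" and "x \<notin> Z" and x: "x \<in> {0..\<delta>}"
    let ?T = "\<lambda>i. Taylor_poly (n i) f (cis (2 * pi * x))"
    have half: "(\<lambda>i. 2 * (1 / 2 :: real) ^ i) \<longlonglongrightarrow> 2 * 0" by (intro tendsto_mult_left LIMSEQ_power_zero) simp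
    have "eventually (\<lambda>i. norm (?T i - u i x) \<le> 2 * (1 / 2) ^ i) sequentially"
      using ev
    proof eventually_elim
      case (elim i)
      then have "norm (?T i - rat_poly (l i) (cis (2 * pi * x))) \<le> (1 / 2) ^ i" using x by (intro B(3)) auto
      then show ?case
        using l[OF x, of i] norm_triangle_ineq[of "?T i - rat_poly (l i) (cis (2 * pi * x))" "rat_poly (l i) (cis (2 * pi * x)) - u i x"]
        by simp
    qed
    then have "(\<lambda>i. ?T i - u i x) \<longlonglongrightarrow> 0"
      by (rule Lim_null_comparison) (use half in simp)
    then have "(\<lambda>i. (?T i - u i x) + u i x) \<longlonglongrightarrow> 0 + G x"
      using u(2)[OF \<open>x \<notin> Z\<close>] by (rule tendsto_add)
    then have "?T \<longlonglongrightarrow> g1 (cis (2 * pi * x))" by (simp add: G_def)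
    then show "(\<lambda>i. norm (?T i - g1 (cis (2 * pi * x)))) \<longlonglongrightarrow> 0"
      by (intro tendsto_norm_zero LIM_zero)
  qed
  \<comment> \<open>The Borel version \<open>g1\<close> and the real-valued norm make convergence a
    measurable predicate; \<open>g\<close> itself returns only afterwards, through the almost
    everywhere equality.\<close>
  have "AE \<zeta> in restrict_space circle_measure (circle_arc \<delta>). (\<lambda>i. norm (Taylor_poly (n i) f \<zeta> - g1 \<zeta>)) \<longlonglongrightarrow> 0"
  proof (rule AE_circle_arcI[OF \<delta> measurable_limit2 conv])
    fix i
    have "Taylor_poly (n i) f \<in> borel_measurable borel"
      unfolding Taylor_poly_def[abs_def] by (intro borel_measurable_continuous_onI continuous_intros)
    then have "Taylor_poly (n i) f \<in> borel_measurable borel_circle_measure"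
      by (simp cong: measurable_cong_sets add: measurable_restrict_space1)
    then show "(\<lambda>\<zeta>. norm (Taylor_poly (n i) f \<zeta> - g1 \<zeta>)) \<in> borel_measurable borel_circle_measure"
      using g1(1) by measurable
  qed simp
  then have "AE \<zeta> in restrict_space circle_measure (circle_arc \<delta>). (\<lambda>i. Taylor_poly (n i) f \<zeta>) \<longlonglongrightarrow> g \<zeta>"
    using g1(2)
  proof eventually_elim
    case (elim \<zeta>)
    show ?case
      unfolding elim(2) by (rule LIM_zero_cancel, rule tendsto_norm_zero_cancel, rule elim(1))
  qed
  moreover have "strict_mono n" using n(2) by (simp add: strict_mono_Suc_iff)
  ultimately show "\<exists>n. strict_mono n \<and>
    (AE \<zeta> in restrict_space circle_measure (circle_arc \<delta>). (\<lambda>k. Taylor_poly (n k) f \<zeta>) \<longlonglongrightarrow> g \<zeta>)" by blast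
qed

theorem corollary8p3:
  fixes w :: "real \<Rightarrow> real"
  assumes "majorant w"
    and "(\<integral>\<^sup>+ t\<in>{0<..1}. ennreal ((w t)\<^sup>2 / t) \<partial>lborel) = \<infinity>"
  shows "\<forall>\<delta>::real. 0 < \<delta> \<and> \<delta> < 1 \<longrightarrow>
    (\<exists>E U. E \<in> sets circle_measure \<and> measure circle_measure E = \<delta> \<and>
       U \<subseteq> Bloch0 w \<and> Baire_generic (Bloch0_topology w) U \<and>
       (\<forall>f\<in>U. universal_Menshov_pair (Bloch0 w) f E))"
proof (intro allI impI)
  fix \<delta> :: real assume "0 < \<delta> \<and> \<delta> < 1"
  then have \<delta>: "0 < \<delta>" "\<delta> < 1" by auto
  note maj = assms(1)
  interpret Metric_space "Bloch0 w" "Bloch_dist w" by (rule Metric_space_Bloch0[OF maj])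
  \<comment> \<open>\<open>from_nat\<close> is onto the countable type of pairs, so the intersection
    runs over all targets and all precisions.\<close>
  define G where "G = (\<lambda>n. case from_nat n of (l, k) \<Rightarrow> near_target w \<delta> l k)"
  define U where "U = (\<Inter>n. G n)"
  have G: "openin (Bloch0_topology w) (G n)" "Bloch0_topology w closure_of G n = Bloch0 w" for n
    by (auto simp: G_def split_beta openin_near_target[OF maj] dense_near_target[OF maj assms(2) \<delta>])
  have U: "f \<in> Bloch0 w" "f \<in> near_target w \<delta> l k" if "f \<in> U" for f l k
  proof -
    have "f \<in> G (to_nat (l, k))" using that by (auto simp: U_def)
    then show "f \<in> near_target w \<delta> l k" by (simp add: G_def)
    then show "f \<in> Bloch0 w" by (simp add: near_target_def)
  qed
  have "Bloch0_topology w closure_of U = Bloch0 w"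
    unfolding U_def Bloch0_topology_def
    by (rule metric_Baire_category[OF mcomplete_Bloch0[OF maj]]) (use G in \<open>auto simp: Bloch0_topology_def\<close>)
  then have "Baire_generic (Bloch0_topology w) U"
    unfolding Baire_generic_def topspace_Bloch0_topology[OF maj]
    by (intro conjI exI[of _ G] allI G U_def)
  moreover have "\<forall>f\<in>U. universal_Menshov_pair (Bloch0 w) f (circle_arc \<delta>)"
    using U by (intro ballI universal_Menshov_pair_arc[OF \<delta>]) blast+
  ultimately show "\<exists>E U. E \<in> sets circle_measure \<and> measure circle_measure E = \<delta> \<and>
       U \<subseteq> Bloch0 w \<and> Baire_generic (Bloch0_topology w) U \<and>
       (\<forall>f\<in>U. universal_Menshov_pair (Bloch0 w) f E)"
    using U(1) circle_arc_sets measure_circle_arc[OF \<delta>] by blast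
qed

end
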